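(* Let $J>0$, $\beta>0$, and consider the Ising model with triple mixed spins $(\tfrac12,1,\tfrac32)$ on the Cayley tree $\Gamma^2$ of order $k=2$. Let $\preccurlyeq$ denote the stochastic order on probability measures on $\Xi$ induced by the coordinatewise partial order on configurations. Then: 1. The weak limits $\mu^-:=\lim_{n\to\infty}\mu^{-,n}$ and $\mu^+:=\lim_{n\to\infty}\mu^{+,n}$, where $\mu^{-,n}$ (resp. $\mu^{+,n}$) is the finite-volume Gibbs measure in $V_n$ with all boundary spins fixed to their minimal (resp. maximal) values, exist and are Gibbs measures for the model. 2. The measures $\mu^-$ and $\mu^+$ are splitting Gibbs measures and are translation-invariant with the same period-$3$ structure as the interaction (i.e. invariant under all automorphisms of $\Gamma^2$ which preserve the decomposition $\Gamma^2_0,\Gamma^2_1,\Gamma^2_2$). 3. For any Gibbs measure $\mu$ of the model one has $\mu^-\preccurlyeq\mu\preccurlyeq\mu^+$. Hence $\mu^-$ and $\mu^+$ are the minimal and maximal Gibbs measures in this stochastic order.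
   Context: Tree. $\Gamma^2=(V,L)$ is the semi-infinite Cayley tree of order $2$: an infinite tree with root $x^{(0)}$ in which the root has exactly $2$ edges and every other vertex has exactly $3$ edges. $d$ is graph distance, $W_n=\{x: d(x,x^{(0)})=n\}$, $V_n=\bigcup_{m=0}^n W_m$, $L_n$ is the set of edges with both endpoints in $V_n$, and $\Gamma^2_i=\{x\in V: d(x^{(0)},x)\equiv i \pmod 3\}$ for $i=0,1,2$. Model. $\Psi=\{-\tfrac12,\tfrac12\}$, $\Phi=\{-1,0,1\}$, $\Upsilon=\{-\tfrac32,-\tfrac12,\tfrac12,\tfrac32\}$. The spin set $S_x$ of a vertex $x$ is $\Psi$, $\Phi$ or $\Upsilon$ according to whether $x\in\Gamma^2_0$, $\Gamma^2_1$ or $\Gamma^2_2$. Configurations are $\xi\in\Xi=\prod_{x\in V}S_x$ (product topology), and $\Xi_n=\prod_{x\in V_n}S_x$. The Hamiltonian is $H(\xi)=-J\sum_{\langle x,y\rangle\in L}\xi(x)\xi(y)$, and $H_n(\xi)=-J\sum_{\langle x,y\rangle\in L_n}\xi(x)\xi(y)$ for $\xi\in\Xi_n$. Gibbs measures. For finite $\Lambda\subset V$ and $\eta\in\prod_{x\in V\setminus\Lambda}S_x$, $\gamma_\Lambda(\cdot\mid\eta)$ is the probability measure on $\prod_{x\in\Lambda}S_x$ with weight of $\sigma$ proportional to $\exp\{\beta J\sum\zeta(x)\zeta(y)\}$, the sum being over edges $\langle x,y\rangle$ with at least one endpoint in $\Lambda$ and $\zeta=\sigma$ on $\Lambda$,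 $\zeta=\eta$ off $\Lambda$. A Gibbs measure is a probability measure $\mu$ on $\Xi$ such that, for every finite $\Lambda$, $\gamma_\Lambda(\cdot\mid\eta)$ is a version of the conditional distribution under $\mu$ of the spins in $\Lambda$ given the spins $\eta$ outside $\Lambda$ (DLR equations). Boundary conditions. Let $\xi^+$ (resp. $\xi^-$) be the configuration equal to $\tfrac12,1,\tfrac32$ (resp. $-\tfrac12,-1,-\tfrac32$) on $\Gamma^2_0,\Gamma^2_1,\Gamma^2_2$. $\mu^{\pm,n}$ is the probability measure on $\Xi_n$ proportional to $\exp\{-\beta H_n(\xi)\}$ restricted to $\{\xi\in\Xi_n:\xi=\xi^\pm\text{ on }W_n\}$; it is regarded as a measure on $\Xi$ by setting the spins outside $V_n$ equal to $\xi^\pm$. Order. $\xi\le\xi'$ iff $\xi(x)\le\xi'(x)$ for all $x\in V$; $\nu\preccurlyeq\nu'$ iff $\int F\,d\nu\le\int F\,d\nu'$ for every bounded (measurable) increasing $F:\Xi\to\mathbb R$. Splitting Gibbs measures. Given a family of real vectors $h_x=(h_{s,x})_{s\in S_x}$, $x\in V$, let $\mu_n^h(\xi)=\frac1{Z_n}\exp\{-\beta H_n(\xi)+\sum_{x\in W_n}h_{\xi(x),x}\}$, $\xi\in\Xi_n$. If $\sum_{\omega\in\prod_{x\in W_n}S_x}\mu_n^h(\xi_{n-1}\vee\omega)=\mu_{n-1}^h(\xi_{n-1})$ for all $n\ge1$ and $\xi_{n-1}\in\Xi_{n-1}$ ($\vee$ denotes concatenation), the unique probability measure on $\Xi$ with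 marginals $\mu_n^h$ on $V_n$ is called a splitting Gibbs measure. *)

theory Defs
  imports "HOL-Probability.Probability"
begin

text \<open>The tree is determined up to isomorphism by its degrees; we take the full binary tree,
  where \<open>b # x\<close> ranges over the two children of \<open>x\<close> and the root is \<open>[]\<close>.\<close>

type_synonym vertex = "bool list"

definition root :: vertex where
  "root = []"

definition adj :: "vertex \<Rightarrow> vertex \<Rightarrow> bool" where
  "adj x y \<longleftrightarrow> (\<exists>b. y = b # x) \<or> (\<exists>b. x = b # y)"

definition edges :: "vertex set set" where
  "edges = {{x, y} |x y. adj x y}"

definition gdist :: "vertex \<Rightarrow> vertex \<Rightarrow> nat" where
  "gdist x y = (LEAST n. (adj ^^ n) x y)"

definition W :: "nat \<Rightarrow> vertex set" where
  "W n = {x. gdist x root = n}"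

definition V :: "nat \<Rightarrow> vertex set" where
  "V n = (\<Union>m\<le>n. W m)"

definition L :: "nat \<Rightarrow> vertex set set" where
  "L n = {e \<in> edges. e \<subseteq> V n}"

definition Gam :: "nat \<Rightarrow> vertex set" where
  "Gam i = {x. gdist root x mod 3 = i}"

definition tree_automorphism :: "(vertex \<Rightarrow> vertex) \<Rightarrow> bool" where
  "tree_automorphism \<phi> \<longleftrightarrow> bij \<phi> \<and> (\<forall>x y. adj (\<phi> x) (\<phi> y) \<longleftrightarrow> adj x y)"

lemma adj_sym: "adj x y \<longleftrightarrow> adj y x"
  by (auto simp: adj_def)

lemma card_neighbours_root: "card {y. adj root y} = 2"
proof -
  have "{y. adj root y} = {[True], [False]}"
    by (auto simp: adj_def root_def)
  then show ?thesis by simp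
qed

lemma card_neighbours:
  assumes "x \<noteq> root"
  shows "card {y. adj x y} = 3"
proof -
  obtain b z where x: "x = b # z"
    using assms by (cases x) (auto simp: root_def)
  have "{y. adj x y} = {True # x, False # x, z}"
    by (auto simp: adj_def x)
  moreover have "z \<noteq> True # x" "z \<noteq> False # x"
    by (auto simp: x dest: arg_cong[where f = length])
  ultimately show ?thesis by simp
qed

lemma walk_length: "(adj ^^ n) x y \<Longrightarrow> length x \<le> length y + n"
proof (induction n arbitrary: y)
  case (Suc n)
  then obtain z where "(adj ^^ n) x z" "adj z y"
    by auto
  moreover from \<open>adj z y\<close> have "length z \<le> Suc (length y)"
    by (auto simp: adj_def)
  ultimately show ?case
    using Suc.IH[of z] by linarith
qed simp

lemma walk_sym: "(adj ^^ n) x y \<Longrightarrow> (adj ^^ n) y x"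
proof (induction n arbitrary: y)
  case (Suc n)
  then obtain z where "(adj ^^ n) x z" "adj z y"
    by auto
  then show ?case
    using Suc.IH[of z] adj_sym by (metis relpowp_Suc_I2)
qed simp

lemma walk_to_root: "(adj ^^ length x) x root"
proof (induction x)
  case (Cons b x)
  have "adj (b # x) x"
    by (auto simp: adj_def)
  then show ?case
    using relpowp_Suc_I2[of adj "b # x" x "length x" root] Cons by simp
qed (simp add: root_def)

lemma gdist_commute: "gdist x y = gdist y x"
  unfolding gdist_def using walk_sym by metis

lemma gdist_root: "gdist x root = length x"
  unfolding gdist_def
proof (rule Least_equality)
  show "length x \<le> n" if "(adj ^^ n) x root" for n
    using walk_length[OF that] by (simp add: root_def)
qed (rule walk_to_root)

definition Psi :: "real set" where "Psi = {-1/2, 1/2}"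
definition Phi :: "real set" where "Phi = {-1, 0, 1}"
definition Upsilon :: "real set" where "Upsilon = {-3/2, -1/2, 1/2, 3/2}"

definition S :: "vertex \<Rightarrow> real set" where
  "S x = (if x \<in> Gam 0 then Psi else if x \<in> Gam 1 then Phi else Upsilon)"

type_synonym config = "vertex \<Rightarrow> real"

definition conf :: "vertex set \<Rightarrow> config set" where
  "conf \<Lambda> = PiE \<Lambda> S"

text \<open>Since there are countably many vertices, this product \<open>\<sigma>\<close>-algebra on \<open>conf \<Lambda>\<close> is the Borel
  \<open>\<sigma>\<close>-algebra of the product topology.\<close>

definition conf_space :: "vertex set \<Rightarrow> config measure" where
  "conf_space \<Lambda> = PiM \<Lambda> (\<lambda>x. count_space (S x))"

abbreviation Xi :: "config measure" where
  "Xi \<equiv> conf_space UNIV"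

definition Xi_top :: "config topology" where
  "Xi_top = product_topology (\<lambda>x. discrete_topology (S x)) UNIV"

definition prob_on_Xi :: "config measure \<Rightarrow> bool" where
  "prob_on_Xi \<mu> \<longleftrightarrow> prob_space \<mu> \<and> sets \<mu> = sets Xi"

lemma space_conf_space: "space (conf_space \<Lambda>) = conf \<Lambda>"
  by (simp add: conf_space_def conf_def space_PiM)

lemma topspace_Xi_top: "topspace Xi_top = space Xi"
  by (simp add: Xi_top_def space_conf_space conf_def)

definition weak_limit :: "(nat \<Rightarrow> config measure) \<Rightarrow> config measure \<Rightarrow> bool" where
  "weak_limit M \<mu> \<longleftrightarrow> prob_on_Xi \<mu> \<and>
     (\<forall>f. continuous_map Xi_top euclideanreal f \<and> bounded (f ` topspace Xi_top) \<longrightarrow>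
        (\<lambda>n. \<integral>\<xi>. f \<xi> \<partial>M n) \<longlonglongrightarrow> (\<integral>\<xi>. f \<xi> \<partial>\<mu>))"

definition stoch_le :: "config measure \<Rightarrow> config measure \<Rightarrow> bool"  (infix "\<preceq>\<^sub>s" 50) where
  "\<nu> \<preceq>\<^sub>s \<nu>' \<longleftrightarrow>
     (\<forall>F :: config \<Rightarrow> real. F \<in> borel_measurable Xi \<and> bounded (F ` space Xi) \<and> mono_on (space Xi) F \<longrightarrow>
        (\<integral>\<xi>. F \<xi> \<partial>\<nu>) \<le> (\<integral>\<xi>. F \<xi> \<partial>\<nu>'))"

definition period3_invariant :: "config measure \<Rightarrow> bool" where
  "period3_invariant \<mu> \<longleftrightarrow>
     (\<forall>\<phi>. tree_automorphism \<phi> \<and> (\<forall>i<3. \<phi> ` Gam i = Gam i) \<longrightarrow> distr \<mu> Xi (\<lambda>\<xi>. \<xi> \<circ> \<phi>) = \<mu>)"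

text \<open>For an edge \<open>e = {x, y}\<close> the product over \<open>e\<close> is \<open>\<xi> x * \<xi> y\<close>.\<close>

definition Ham :: "real \<Rightarrow> nat \<Rightarrow> config \<Rightarrow> real" where
  "Ham J n \<xi> = - J * (\<Sum>e\<in>L n. \<Prod>x\<in>e. \<xi> x)"

definition prob_propto :: "'a set \<Rightarrow> ('a \<Rightarrow> real) \<Rightarrow> 'a measure" where
  "prob_propto A w = point_measure A (\<lambda>a. ennreal (w a / (\<Sum>b\<in>A. w b)))"

definition gibbs_kernel :: "real \<Rightarrow> real \<Rightarrow> vertex set \<Rightarrow> config \<Rightarrow> config measure" where
  "gibbs_kernel J \<beta> \<Lambda> \<eta> = prob_propto (conf \<Lambda>)
     (\<lambda>\<sigma>. exp (\<beta> * J * (\<Sum>e | e \<in> edges \<and> e \<inter> \<Lambda> \<noteq> {}. \<Prod>x\<in>e. merge \<Lambda> (- \<Lambda>) (\<sigma>, \<eta>) x)))"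

definition gibbs_measure :: "real \<Rightarrow> real \<Rightarrow> config measure \<Rightarrow> bool" where
  "gibbs_measure J \<beta> \<mu> \<longleftrightarrow> prob_on_Xi \<mu> \<and>
     (\<forall>\<Lambda>. finite \<Lambda> \<longrightarrow>
       (\<forall>A \<in> sets (conf_space \<Lambda>). \<forall>B \<in> sets (conf_space (- \<Lambda>)).
          emeasure \<mu> {\<xi> \<in> space Xi. restrict \<xi> \<Lambda> \<in> A \<and> restrict \<xi> (- \<Lambda>) \<in> B} =
          (\<integral>\<^sup>+\<eta>\<in>B. emeasure (gibbs_kernel J \<beta> \<Lambda> \<eta>) A
             \<partial>distr \<mu> (conf_space (- \<Lambda>)) (\<lambda>\<xi>. restrict \<xi> (- \<Lambda>)))))"

definition xi_plus :: config where
  "xi_plus x = (if x \<in> Gam 0 then 1/2 else if x \<in> Gam 1 then 1 else 3/2)"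

definition xi_minus :: config where
  "xi_minus x = (if x \<in> Gam 0 then -1/2 else if x \<in> Gam 1 then -1 else -3/2)"

definition bc_measure :: "real \<Rightarrow> real \<Rightarrow> config \<Rightarrow> nat \<Rightarrow> config measure" where
  "bc_measure J \<beta> \<zeta> n =
     distr (prob_propto {\<xi> \<in> conf (V n). \<forall>x\<in>W n. \<xi> x = \<zeta> x} (\<lambda>\<xi>. exp (- \<beta> * Ham J n \<xi>)))
       Xi (\<lambda>\<xi>. merge (V n) (- V n) (\<xi>, \<zeta>))"

definition mu_h_weight :: "real \<Rightarrow> real \<Rightarrow> (vertex \<Rightarrow> real \<Rightarrow> real) \<Rightarrow> nat \<Rightarrow> config \<Rightarrow> real" where
  "mu_h_weight J \<beta> h n \<xi> = exp (- \<beta> * Ham J n \<xi> + (\<Sum>x\<in>W n. h x (\<xi> x)))"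

definition mu_h :: "real \<Rightarrow> real \<Rightarrow> (vertex \<Rightarrow> real \<Rightarrow> real) \<Rightarrow> nat \<Rightarrow> config \<Rightarrow> real" where
  "mu_h J \<beta> h n \<xi> = mu_h_weight J \<beta> h n \<xi> / (\<Sum>\<xi>'\<in>conf (V n). mu_h_weight J \<beta> h n \<xi>')"

definition compatible :: "real \<Rightarrow> real \<Rightarrow> (vertex \<Rightarrow> real \<Rightarrow> real) \<Rightarrow> bool" where
  "compatible J \<beta> h \<longleftrightarrow>
     (\<forall>n\<ge>1. \<forall>\<xi> \<in> conf (V (n - 1)).
        (\<Sum>\<omega>\<in>conf (W n). mu_h J \<beta> h n (merge (V (n - 1)) (W n) (\<xi>, \<omega>))) = mu_h J \<beta> h (n - 1) \<xi>)"

definition splitting_gibbs_measure :: "real \<Rightarrow> real \<Rightarrow> config measure \<Rightarrow> bool" where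
  "splitting_gibbs_measure J \<beta> \<mu> \<longleftrightarrow> prob_on_Xi \<mu> \<and>
     (\<exists>h. compatible J \<beta> h \<and>
       (\<forall>n. \<forall>\<xi> \<in> conf (V n). measure \<mu> {\<zeta> \<in> space Xi. restrict \<zeta> (V n) = \<xi>} = mu_h J \<beta> h n \<xi>))"

end

theory Submission
  imports Defs
begin

text \<open>Write \<open>\<zeta>\<close> for one of the two boundary conditions \<open>xi_minus\<close>, \<open>xi_plus\<close>. Summing out the leaves of the tree
replaces a boundary factor \<open>g x (\<xi> x)\<close> on the vertices of \<open>W (Suc n)\<close> by the factor \<open>collapse g\<close> on \<open>W n\<close>.
So the marginal on \<open>V m\<close> of the finite-volume measure in \<open>V (m + k)\<close> with boundary condition \<open>\<zeta>\<close> is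
\<open>law m ((collapse ^^ k) (pinned \<zeta>))\<close>, and the whole problem becomes one about iterating \<open>collapse\<close>.

Messages carry the monotone likelihood ratio order \<open>lr_le\<close>, and because \<open>J > 0\<close> the map \<open>collapse\<close>
preserves it. A message pinned to the maximal (minimal) spin is above (below) every other message.
Hence the iterates of \<open>collapse\<close> on the pinned message are monotone in this order, their ratios to the
value at the boundary spin are increasing and bounded, and they converge. The logarithm of the limit is a
family \<open>h\<close> that satisfies the compatibility condition and depends only on the distance from the root.
Kolmogorov's theorem turns the consistent laws \<open>mu_h J \<beta> h n\<close> into a measure on \<open>Xi\<close>. It is the weak
limit because a continuous function on the compact configuration space is uniformly close to a local one;
it is a Gibbs measure because in \<open>mu_h J \<beta> h n\<close> the spins of an inner finite set only interact through the
edges that meet this set; and it is invariant because a tree automorphism fixes the root and therefore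
preserves the distance from it.

For the comparison with an arbitrary Gibbs measure, the kernel of \<open>V n\<close> with outer configuration \<open>\<xi>\<close> is
\<open>law n (collapse (pinned \<xi>))\<close>, whose message lies between those for \<open>xi_minus\<close> and \<open>xi_plus\<close>. Holley's inequality,
a consequence of the four functions theorem, turns the order of messages into the order of expectations
of increasing functions. This gives the domination for increasing functions of finitely many spins; inner
regularity extends it to all bounded measurable increasing functions.\<close>

section \<open>The four functions theorem and Holley's inequality\<close>

text \<open>This is \<open>(X - p) (X - q) \<ge> 0\<close> divided by \<open>X\<close>; it is the only inequality behind the four functions theorem.\<close>

lemma two_chain_ineq:
  fixes p q X Y :: real
  assumes "0 \<le> p" "0 \<le> q" "0 \<le> Y" "p \<le> X" "q \<le> X" "p * q \<le> X * Y"
  shows "p + q \<le> X + Y"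
proof (cases "X = 0")
  case True
  then show ?thesis using assms by linarith
next
  case False
  with assms have X: "X > 0" by linarith
  have "0 \<le> (X - p) * (X - q)" using assms by simp
  also have "\<dots> \<le> X * X - X * p - X * q + X * Y" using assms(6) by (simp add: algebra_simps)
  also have "\<dots> = X * (X + Y - p - q)" by (simp add: algebra_simps)
  finally show ?thesis using X by (simp add: zero_le_mult_iff)
qed

text \<open>The diagonal terms of the two double sums compare directly, and each pair of off-diagonal terms is
compared with the pair at the same two points.\<close>

lemma four_functions_chain:
  fixes a b c d :: "'a::linorder \<Rightarrow> real"
  assumes nonneg: "\<And>s. s \<in> A \<Longrightarrow> 0 \<le> a s \<and> 0 \<le> b s \<and> 0 \<le> c s \<and> 0 \<le> d s"
    and le: "\<And>s t. s \<in> A \<Longrightarrow> t \<in> A \<Longrightarrow> a s * b t \<le> c (min s t) * d (max s t)"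
  shows "sum a A * sum b A \<le> sum c A * sum d A"
proof -
  have double: "2 * (sum f A * sum g A) = (\<Sum>s\<in>A. \<Sum>t\<in>A. f s * g t + f t * g s)" for f g :: "'a \<Rightarrow> real"
  proof -
    have "sum f A * sum g A = (\<Sum>s\<in>A. \<Sum>t\<in>A. f t * g s)"
      by (subst sum.swap) (simp add: sum_product)
    then show ?thesis by (simp add: sum.distrib sum_product)
  qed
  have ordered: "a s * b t + a t * b s \<le> c s * d t + c t * d s"
    if "s \<in> A" "t \<in> A" "s \<le> t" for s t
  proof (rule two_chain_ineq)
    have "a s * b s \<le> c s * d s" "a t * b t \<le> c t * d t"
      using le[of s s] le[of t t] that by auto
    then have "(a s * b s) * (a t * b t) \<le> (c s * d s) * (c t * d t)"
      by (rule mult_mono) (use nonneg that in auto)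
    then show "(a s * b t) * (a t * b s) \<le> (c s * d t) * (c t * d s)"
      by (simp add: ac_simps)
    show "a s * b t \<le> c s * d t" "a t * b s \<le> c s * d t"
      using le[of s t] le[of t s] that by (auto simp: min_def max_def split: if_splits)
  qed (use nonneg that in auto)
  have "a s * b t + a t * b s \<le> c s * d t + c t * d s" if "s \<in> A" "t \<in> A" for s t
    using ordered[of s t] ordered[of t s] that by (cases "s \<le> t") (auto simp: add.commute)
  then have "2 * (sum a A * sum b A) \<le> 2 * (sum c A * sum d A)"
    unfolding double by (intro sum_mono)
  then show ?thesis by simp
qed

lemma sum_PiE_insert:
  assumes "i \<notin> I"
  shows "sum f (PiE (insert i I) B) = (\<Sum>s\<in>B i. \<Sum>\<sigma>\<in>PiE I B. f (\<sigma>(i := s)))"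
proof -
  have "sum f (PiE (insert i I) B) = (\<Sum>(s, \<sigma>)\<in>B i \<times> PiE I B. f (\<sigma>(i := s)))"
    unfolding PiE_insert_eq
    using inj_combinator[OF assms, of B] by (subst sum.reindex) (simp_all add: case_prod_unfold)
  then show ?thesis by (simp add: sum.cartesian_product)
qed

text \<open>The Ahlswede-Daykin theorem for a product of chains. For one fixed coordinate, the sums over the other
coordinates satisfy the hypothesis on a single chain by induction, so the one-chain case finishes.\<close>

theorem four_functions_PiE:
  fixes f1 f2 f3 f4 :: "('i \<Rightarrow> 'a::linorder) \<Rightarrow> real"
  assumes "finite I"
    and "\<And>\<sigma>. \<sigma> \<in> PiE I B \<Longrightarrow> 0 \<le> f1 \<sigma> \<and> 0 \<le> f2 \<sigma> \<and> 0 \<le> f3 \<sigma> \<and> 0 \<le> f4 \<sigma>"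
    and "\<And>\<sigma> \<tau>. \<sigma> \<in> PiE I B \<Longrightarrow> \<tau> \<in> PiE I B \<Longrightarrow>
      f1 \<sigma> * f2 \<tau> \<le> f3 (\<lambda>x. min (\<sigma> x) (\<tau> x)) * f4 (\<lambda>x. max (\<sigma> x) (\<tau> x))"
  shows "sum f1 (PiE I B) * sum f2 (PiE I B) \<le> sum f3 (PiE I B) * sum f4 (PiE I B)"
  using assms
proof (induction I arbitrary: f1 f2 f3 f4 rule: finite_induct)
  case empty
  then show ?case
    using empty.prems(2)[of "\<lambda>x. undefined" "\<lambda>x. undefined"] by simp
next
  case (insert i I)
  have in_PiE: "\<sigma>(i := s) \<in> PiE (insert i I) B" if "\<sigma> \<in> PiE I B" "s \<in> B i" for \<sigma> s
    using that by (auto simp: PiE_iff extensional_def)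
  have nonneg: "0 \<le> f1 (\<sigma>(i := s)) \<and> 0 \<le> f2 (\<sigma>(i := s)) \<and> 0 \<le> f3 (\<sigma>(i := s)) \<and> 0 \<le> f4 (\<sigma>(i := s))"
    if "\<sigma> \<in> PiE I B" "s \<in> B i" for \<sigma> s
    using insert.prems(1) in_PiE[OF that] by blast
  show ?case
    unfolding sum_PiE_insert[OF insert.hyps(2)]
  proof (rule four_functions_chain)
    fix s t assume st: "s \<in> B i" "t \<in> B i"
    have "min s t \<in> B i" "max s t \<in> B i" using st by (auto simp: min_def max_def)
    note mm = this
    show "(\<Sum>\<sigma>\<in>PiE I B. f1 (\<sigma>(i := s))) * (\<Sum>\<sigma>\<in>PiE I B. f2 (\<sigma>(i := t)))
        \<le> (\<Sum>\<sigma>\<in>PiE I B. f3 (\<sigma>(i := min s t))) * (\<Sum>\<sigma>\<in>PiE I B. f4 (\<sigma>(i := max s t)))"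
    proof (rule insert.IH)
      fix \<sigma> \<tau> assume \<sigma>\<tau>: "\<sigma> \<in> PiE I B" "\<tau> \<in> PiE I B"
      have "(\<lambda>x. min ((\<sigma>(i := s)) x) ((\<tau>(i := t)) x)) = (\<lambda>x. min (\<sigma> x) (\<tau> x))(i := min s t)"
        and "(\<lambda>x. max ((\<sigma>(i := s)) x) ((\<tau>(i := t)) x)) = (\<lambda>x. max (\<sigma> x) (\<tau> x))(i := max s t)"
        by auto
      then show "f1 (\<sigma>(i := s)) * f2 (\<tau>(i := t))
          \<le> f3 ((\<lambda>x. min (\<sigma> x) (\<tau> x))(i := min s t)) * f4 ((\<lambda>x. max (\<sigma> x) (\<tau> x))(i := max s t))"
        using insert.prems(2)[OF in_PiE[OF \<sigma>\<tau>(1) st(1)] in_PiE[OF \<sigma>\<tau>(2) st(2)]] by metis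
    qed (use nonneg st mm in blast)
  qed (intro conjI sum_nonneg; use nonneg in blast)
qed

text \<open>For nonnegative \<open>F\<close> this is the four functions theorem for \<open>F \<cdot> w\<close>, \<open>w'\<close>, \<open>w\<close>, \<open>F \<cdot> w'\<close>. Both sides change by the
same amount when a constant is added to \<open>F\<close>.\<close>

corollary holley:
  fixes w w' F :: "('i \<Rightarrow> 'a::linorder) \<Rightarrow> real"
  assumes "finite I" and "\<And>i. i \<in> I \<Longrightarrow> finite (B i)"
    and nonneg: "\<And>\<sigma>. \<sigma> \<in> PiE I B \<Longrightarrow> 0 \<le> w \<sigma> \<and> 0 \<le> w' \<sigma>"
    and le: "\<And>\<sigma> \<tau>. \<sigma> \<in> PiE I B \<Longrightarrow> \<tau> \<in> PiE I B \<Longrightarrow>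
      w \<sigma> * w' \<tau> \<le> w (\<lambda>x. min (\<sigma> x) (\<tau> x)) * w' (\<lambda>x. max (\<sigma> x) (\<tau> x))"
    and F: "mono_on (PiE I B) F"
  shows "(\<Sum>\<sigma>\<in>PiE I B. F \<sigma> * w \<sigma>) * sum w' (PiE I B) \<le> sum w (PiE I B) * (\<Sum>\<sigma>\<in>PiE I B. F \<sigma> * w' \<sigma>)"
proof -
  have fin: "finite (PiE I B)" using assms by (intro finite_PiE)
  \<comment> \<open>Shift \<open>F\<close> to make it nonnegative.\<close>
  obtain a where a: "\<And>\<sigma>. \<sigma> \<in> PiE I B \<Longrightarrow> 0 \<le> F \<sigma> + a"
  proof (rule that[of "\<Sum>\<sigma>\<in>PiE I B. \<bar>F \<sigma>\<bar>"])
    fix \<sigma> assume "\<sigma> \<in> PiE I B"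
    then have "\<bar>F \<sigma>\<bar> \<le> (\<Sum>\<sigma>\<in>PiE I B. \<bar>F \<sigma>\<bar>)" using fin by (intro member_le_sum) auto
    then show "0 \<le> F \<sigma> + (\<Sum>\<sigma>\<in>PiE I B. \<bar>F \<sigma>\<bar>)" by linarith
  qed
  have "(\<Sum>\<sigma>\<in>PiE I B. (F \<sigma> + a) * w \<sigma>) * sum w' (PiE I B)
      \<le> sum w (PiE I B) * (\<Sum>\<sigma>\<in>PiE I B. (F \<sigma> + a) * w' \<sigma>)"
  proof (rule four_functions_PiE[OF assms(1)])
    fix \<sigma> \<tau> assume \<sigma>\<tau>: "\<sigma> \<in> PiE I B" "\<tau> \<in> PiE I B"
    let ?m = "\<lambda>x. min (\<sigma> x) (\<tau> x)" and ?M = "\<lambda>x. max (\<sigma> x) (\<tau> x)"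
    have mM: "?m \<in> PiE I B" "?M \<in> PiE I B" using \<sigma>\<tau>
      by (auto simp: PiE_iff extensional_def min_def max_def)
    have "F \<sigma> \<le> F ?M" using F \<sigma>\<tau> mM by (intro mono_onD[OF F]) (auto simp: le_fun_def)
    then have "(F \<sigma> + a) * (w \<sigma> * w' \<tau>) \<le> (F ?M + a) * (w ?m * w' ?M)"
      by (intro mult_mono[OF _ le]) (use a \<sigma>\<tau> mM nonneg in auto)
    then show "(F \<sigma> + a) * w \<sigma> * w' \<tau> \<le> w ?m * ((F ?M + a) * w' ?M)"
      by (simp add: ac_simps)
  qed (use a nonneg in auto)
  then show ?thesis
    by (simp add: distrib_right sum.distrib distrib_left sum_distrib_left[symmetric] ac_simps)
qed

section \<open>The tree, its spins and its edges\<close>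

lemma gdist_root_left: "gdist root x = length x"
  by (subst gdist_commute) (rule gdist_root)

lemma W_eq: "W n = {x. length x = n}"
  by (simp add: W_def gdist_root)

lemma V_eq: "V n = {x. length x \<le> n}"
  by (auto simp: V_def W_eq)

lemma Gam_eq: "Gam i = {x. length x mod 3 = i}"
  by (simp add: Gam_def gdist_root_left)

lemma S_eq: "S x = (if length x mod 3 = 0 then Psi else if length x mod 3 = 1 then Phi else Upsilon)"
  by (simp add: S_def Gam_eq)

lemma S_cong: "length x = length y \<Longrightarrow> S x = S y"
  by (simp add: S_eq)

lemma finite_S [simp]: "finite (S x)"
  by (simp add: S_eq Psi_def Phi_def Upsilon_def)

lemma xi_plus_eq: "xi_plus x = (if length x mod 3 = 0 then 1/2 else if length x mod 3 = 1 then 1 else 3/2)"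
  by (simp add: xi_plus_def Gam_eq)

lemma xi_minus_eq: "xi_minus x = (if length x mod 3 = 0 then -1/2 else if length x mod 3 = 1 then -1 else -3/2)"
  by (simp add: xi_minus_def Gam_eq)

lemma xi_plus_in_S [simp]: "xi_plus x \<in> S x" and xi_minus_in_S [simp]: "xi_minus x \<in> S x"
  by (simp_all add: xi_plus_eq xi_minus_eq S_eq Psi_def Phi_def Upsilon_def)

lemma le_xi_plus: "s \<in> S x \<Longrightarrow> s \<le> xi_plus x" and xi_minus_le: "s \<in> S x \<Longrightarrow> xi_minus x \<le> s"
  by (auto simp: xi_plus_eq xi_minus_eq S_eq Psi_def Phi_def Upsilon_def split: if_splits)

lemma abs_spin_le: "s \<in> S x \<Longrightarrow> \<bar>s\<bar> \<le> 3/2"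
  by (auto simp: S_eq Psi_def Phi_def Upsilon_def split: if_splits)

lemma conf_UNIV_iff: "\<xi> \<in> conf UNIV \<longleftrightarrow> (\<forall>x. \<xi> x \<in> S x)"
  by (auto simp: conf_def PiE_iff)

lemma finite_W [simp]: "finite (W n)"
  using finite_lists_length_eq[of "UNIV :: bool set" n] by (simp add: W_eq)

lemma finite_V [simp]: "finite (V n)"
  by (simp add: V_def)

lemma finite_conf [simp]: "finite \<Lambda> \<Longrightarrow> finite (conf \<Lambda>)"
  by (simp add: conf_def finite_PiE)

lemma restrict_in_conf [simp]: "\<xi> \<in> conf UNIV \<Longrightarrow> restrict \<xi> \<Lambda> \<in> conf \<Lambda>"
  by (auto simp: conf_def PiE_iff)

lemma conf_nonempty: "conf \<Lambda> \<noteq> {}"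
  using restrict_in_conf[of xi_plus \<Lambda>] by (force simp: conf_UNIV_iff)

lemma V_Suc: "V (Suc n) = V n \<union> W (Suc n)" and V_W_disjoint: "V n \<inter> W (Suc n) = {}"
  and V_mono: "m \<le> n \<Longrightarrow> V m \<subseteq> V n" and W_subset_V: "W n \<subseteq> V n"
  by (auto simp: V_eq W_eq)

lemma prod_W_Suc:
  fixes f :: "vertex \<Rightarrow> 'a::comm_monoid_mult"
  shows "(\<Prod>y\<in>W (Suc n). f y) = (\<Prod>x\<in>W n. \<Prod>b\<in>UNIV. f (b # x))"
proof -
  have "(\<Prod>y\<in>W (Suc n). f y) = (\<Prod>(x, b)\<in>W n \<times> UNIV. f (b # x))"
    by (rule prod.reindex_bij_witness[of _ "\<lambda>(x, b). b # x" "\<lambda>y. (tl y, hd y)"])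
       (auto simp: W_eq length_Suc_conv)
  then show ?thesis by (simp add: prod.cartesian_product)
qed

lemma sum_conf_Un:
  assumes "\<Lambda> \<inter> \<Delta> = {}"
  shows "(\<Sum>\<tau>\<in>conf (\<Lambda> \<union> \<Delta>). f \<tau>) = (\<Sum>\<sigma>\<in>conf \<Lambda>. \<Sum>\<omega>\<in>conf \<Delta>. f (merge \<Lambda> \<Delta> (\<sigma>, \<omega>)))"
proof -
  have "(\<Sum>\<tau>\<in>conf (\<Lambda> \<union> \<Delta>). f \<tau>) = (\<Sum>(\<sigma>, \<omega>)\<in>conf \<Lambda> \<times> conf \<Delta>. f (merge \<Lambda> \<Delta> (\<sigma>, \<omega>)))"
    by (rule sum.reindex_bij_witness[of _ "\<lambda>(\<sigma>, \<omega>). merge \<Lambda> \<Delta> (\<sigma>, \<omega>)" "\<lambda>\<tau>. (restrict \<tau> \<Lambda>, restrict \<tau> \<Delta>)"])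
       (use assms in \<open>auto simp: conf_def merge_def PiE_iff extensional_def restrict_def fun_eq_iff disjoint_iff
         intro!: arg_cong[of _ _ f]\<close>)
  then show ?thesis by (simp add: sum.cartesian_product)
qed

lemma edges_eq: "edges = (\<lambda>y. {tl y, y}) ` (- {[]})"
  (is "_ = ?R")
proof (intro set_eqI iffI)
  fix e assume "e \<in> edges"
  then obtain x y where e: "e = {x, y}" and "adj x y" by (auto simp: edges_def)
  then consider b where "y = b # x" | b where "x = b # y" by (auto simp: adj_def)
  then show "e \<in> ?R"
    by cases (auto simp: e insert_commute intro!: rev_image_eqI)
next
  fix e assume "e \<in> ?R"
  then obtain y where "e = {tl y, y}" "y \<noteq> []" by auto
  moreover have "adj (tl y) y" using \<open>y \<noteq> []\<close> by (cases y) (auto simp: adj_def)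
  ultimately show "e \<in> edges" by (auto simp: edges_def)
qed

lemma inj_on_edge: "inj_on (\<lambda>y :: vertex. {tl y, y}) (- {[]})"
proof (rule inj_onI)
  fix y z :: vertex assume "y \<in> - {[]}" "z \<in> - {[]}" "{tl y, y} = {tl z, z}"
  then show "y = z"
    by (cases y; cases z) (auto simp: doubleton_eq_iff dest: arg_cong[of _ _ length])
qed

text \<open>An edge of the tree is determined by its endpoint \<open>y\<close> that is farther from the root, the other endpoint
being \<open>tl y\<close>. All sums over edges are written as sums over such \<open>y\<close>.\<close>

lemma sum_edges:
  fixes \<xi> :: config
  assumes "\<And>y. y \<noteq> [] \<Longrightarrow> P {tl y, y} \<longleftrightarrow> y \<in> Y" "[] \<notin> Y"
  shows "(\<Sum>e | e \<in> edges \<and> P e. \<Prod>x\<in>e. \<xi> x) = (\<Sum>y\<in>Y. \<xi> (tl y) * \<xi> y)"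
proof -
  have eq: "{e. e \<in> edges \<and> P e} = (\<lambda>y. {tl y, y}) ` Y"
    using assms by (auto simp: edges_eq image_iff) metis
  have ne: "tl y \<noteq> y" if "y \<in> Y" for y
    using that assms(2) by (cases y) (auto dest: arg_cong[of _ _ length])
  have "inj_on (\<lambda>y :: vertex. {tl y, y}) Y"
    by (rule inj_on_subset[OF inj_on_edge]) (use assms(2) in auto)
  then have "(\<Sum>e | e \<in> edges \<and> P e. \<Prod>x\<in>e. \<xi> x) = (\<Sum>y\<in>Y. \<Prod>x\<in>{tl y, y}. \<xi> x)"
    unfolding eq by (subst sum.reindex) auto
  also have "\<dots> = (\<Sum>y\<in>Y. \<xi> (tl y) * \<xi> y)"
    using ne by (intro sum.cong) auto
  finally show ?thesis .
qed

lemma Ham_eq: "Ham J n \<xi> = - J * (\<Sum>y\<in>V n - {[]}. \<xi> (tl y) * \<xi> y)"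
  unfolding Ham_def L_def by (subst sum_edges[where Y = "V n - {[]}"]) (auto simp: V_eq)

lemma Ham_cong: "(\<And>x. x \<in> V n \<Longrightarrow> \<xi> x = \<xi>' x) \<Longrightarrow> Ham J n \<xi> = Ham J n \<xi>'"
  unfolding Ham_eq by (intro arg_cong2[where f = "(*)"] refl sum.cong) (auto simp: V_eq)

text \<open>One vertex for each edge that meets \<open>\<Lambda>\<close>: its endpoint farther from the root.\<close>

definition touching :: "vertex set \<Rightarrow> vertex set" where
  "touching \<Lambda> = {y. y \<noteq> [] \<and> (y \<in> \<Lambda> \<or> tl y \<in> \<Lambda>)}"

lemma gibbs_kernel_eq: "gibbs_kernel J \<beta> \<Lambda> \<eta> = prob_propto (conf \<Lambda>) (\<lambda>\<sigma>. exp (\<beta> * J *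
    (\<Sum>y\<in>touching \<Lambda>. merge \<Lambda> (- \<Lambda>) (\<sigma>, \<eta>) (tl y) * merge \<Lambda> (- \<Lambda>) (\<sigma>, \<eta>) y)))"
  unfolding gibbs_kernel_def by (subst sum_edges[where Y = "touching \<Lambda>"]) (auto simp: touching_def)

lemma touching_V: "touching (V n) = V (Suc n) - {[]}"
  by (auto simp: touching_def V_eq)

lemma bond_sum_Suc:
  fixes \<tau> :: config
  assumes V: "\<And>x. x \<in> V n \<Longrightarrow> \<tau> x = \<sigma> x" and W: "\<And>x. x \<in> W (Suc n) \<Longrightarrow> \<tau> x = \<omega> x"
  shows "(\<Sum>y\<in>V (Suc n) - {[]}. \<tau> (tl y) * \<tau> y) =
    (\<Sum>y\<in>V n - {[]}. \<sigma> (tl y) * \<sigma> y) + (\<Sum>y\<in>W (Suc n). \<sigma> (tl y) * \<omega> y)"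
proof -
  have "(\<Sum>y\<in>V (Suc n) - {[]}. \<tau> (tl y) * \<tau> y) =
      (\<Sum>y\<in>V n - {[]}. \<tau> (tl y) * \<tau> y) + (\<Sum>y\<in>W (Suc n). \<tau> (tl y) * \<tau> y)"
    by (subst sum.union_disjoint[symmetric])
      (use finite_V[of n] finite_W[of "Suc n"] in \<open>auto simp: V_eq W_eq intro!: sum.cong\<close>)
  also have "(\<Sum>y\<in>V n - {[]}. \<tau> (tl y) * \<tau> y) = (\<Sum>y\<in>V n - {[]}. \<sigma> (tl y) * \<sigma> y)"
  proof (intro sum.cong refl)
    fix y assume "y \<in> V n - {[]}"
    then have "y \<in> V n" "tl y \<in> V n" by (auto simp: V_eq)
    then show "\<tau> (tl y) * \<tau> y = \<sigma> (tl y) * \<sigma> y" by (simp only: V)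
  qed
  also have "(\<Sum>y\<in>W (Suc n). \<tau> (tl y) * \<tau> y) = (\<Sum>y\<in>W (Suc n). \<sigma> (tl y) * \<omega> y)"
  proof (intro sum.cong refl)
    fix y assume y: "y \<in> W (Suc n)"
    then have "tl y \<in> V n" by (simp add: V_eq W_eq)
    then show "\<tau> (tl y) * \<tau> y = \<sigma> (tl y) * \<omega> y" by (simp only: V W[OF y])
  qed
  finally show ?thesis .
qed

section \<open>Summing out the leaves: messages\<close>

locale ferromagnet =
  fixes J \<beta> :: real
  assumes J: "0 < J" and \<beta>: "0 < \<beta>"
begin

text \<open>The unnormalised law on \<open>V n\<close> with a free factor \<open>g x\<close> at every boundary vertex \<open>x\<close>. It covers at once fixed
boundary spins (\<open>pinned\<close> below), the boundary laws \<open>exp (h x s)\<close> of splitting measures, and Gibbs kernels.\<close>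

definition weight :: "nat \<Rightarrow> (vertex \<Rightarrow> real \<Rightarrow> real) \<Rightarrow> config \<Rightarrow> real" where
  "weight n g \<sigma> = exp (- \<beta> * Ham J n \<sigma>) * (\<Prod>x\<in>W n. g x (\<sigma> x))"

definition law :: "nat \<Rightarrow> (vertex \<Rightarrow> real \<Rightarrow> real) \<Rightarrow> config \<Rightarrow> real" where
  "law n g \<sigma> = weight n g \<sigma> / (\<Sum>\<tau>\<in>conf (V n). weight n g \<tau>)"

text \<open>The factor that remains at \<open>x\<close> when the spins of its two children are summed out.\<close>

definition collapse :: "(vertex \<Rightarrow> real \<Rightarrow> real) \<Rightarrow> vertex \<Rightarrow> real \<Rightarrow> real" where
  "collapse g x s = (\<Prod>b\<in>UNIV. \<Sum>t\<in>S (b # x). exp (\<beta> * J * (s * t)) * g (b # x) t)"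

text \<open>Zeros are allowed so that fixed boundary spins are included; one positive value per vertex makes all
partition functions positive.\<close>

definition message :: "(vertex \<Rightarrow> real \<Rightarrow> real) \<Rightarrow> bool" where
  "message g \<longleftrightarrow> (\<forall>x. (\<forall>s\<in>S x. 0 \<le> g x s) \<and> (\<exists>s\<in>S x. 0 < g x s))"

text \<open>The monotone likelihood ratio order at every vertex, written without division because messages may vanish.\<close>

definition lr_le :: "(vertex \<Rightarrow> real \<Rightarrow> real) \<Rightarrow> (vertex \<Rightarrow> real \<Rightarrow> real) \<Rightarrow> bool" where
  "lr_le g g' \<longleftrightarrow> (\<forall>x. \<forall>s\<in>S x. \<forall>t\<in>S x. s \<le> t \<longrightarrow> g x t * g' x s \<le> g x s * g' x t)"

lemma weight_Suc_merge:
  assumes "\<sigma> \<in> conf (V n)"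
  shows "weight (Suc n) g (merge (V n) (W (Suc n)) (\<sigma>, \<omega>)) =
    exp (- \<beta> * Ham J n \<sigma>) * (\<Prod>y\<in>W (Suc n). exp (\<beta> * J * (\<sigma> (tl y) * \<omega> y)) * g y (\<omega> y))"
proof -
  let ?\<tau> = "merge (V n) (W (Suc n)) (\<sigma>, \<omega>)"
  have V: "?\<tau> x = \<sigma> x" if "x \<in> V n" for x using that by (simp add: merge_def)
  have W: "?\<tau> x = \<omega> x" if "x \<in> W (Suc n)" for x
    using that V_W_disjoint by (auto simp: merge_def)
  have "(\<Sum>y\<in>V (Suc n) - {[]}. ?\<tau> (tl y) * ?\<tau> y) =
      (\<Sum>y\<in>V n - {[]}. \<sigma> (tl y) * \<sigma> y) + (\<Sum>y\<in>W (Suc n). \<sigma> (tl y) * \<omega> y)"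
    by (rule bond_sum_Suc) (simp_all only: V W)
  then have "- \<beta> * Ham J (Suc n) ?\<tau> =
      - \<beta> * Ham J n \<sigma> + (\<Sum>y\<in>W (Suc n). \<beta> * J * (\<sigma> (tl y) * \<omega> y))"
    unfolding Ham_eq by (simp add: algebra_simps sum_distrib_left)
  then have "exp (- \<beta> * Ham J (Suc n) ?\<tau>) =
      exp (- \<beta> * Ham J n \<sigma>) * (\<Prod>y\<in>W (Suc n). exp (\<beta> * J * (\<sigma> (tl y) * \<omega> y)))"
    by (simp only: exp_add exp_sum[OF finite_W])
  moreover have "(\<Prod>y\<in>W (Suc n). g y (?\<tau> y)) = (\<Prod>y\<in>W (Suc n). g y (\<omega> y))"
    by (intro prod.cong) (auto simp: W)
  ultimately show ?thesis by (simp add: weight_def prod.distrib mult.assoc)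
qed

lemma sum_weight_Suc:
  assumes "\<sigma> \<in> conf (V n)"
  shows "(\<Sum>\<omega>\<in>conf (W (Suc n)). weight (Suc n) g (merge (V n) (W (Suc n)) (\<sigma>, \<omega>))) = weight n (collapse g) \<sigma>"
proof -
  have "(\<Sum>\<omega>\<in>conf (W (Suc n)). weight (Suc n) g (merge (V n) (W (Suc n)) (\<sigma>, \<omega>))) =
      exp (- \<beta> * Ham J n \<sigma>) * (\<Sum>\<omega>\<in>conf (W (Suc n)). \<Prod>y\<in>W (Suc n). exp (\<beta> * J * (\<sigma> (tl y) * \<omega> y)) * g y (\<omega> y))"
    by (simp only: weight_Suc_merge[OF assms] sum_distrib_left)
  also have "(\<Sum>\<omega>\<in>conf (W (Suc n)). \<Prod>y\<in>W (Suc n). exp (\<beta> * J * (\<sigma> (tl y) * \<omega> y)) * g y (\<omega> y)) =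
      (\<Prod>y\<in>W (Suc n). \<Sum>t\<in>S y. exp (\<beta> * J * (\<sigma> (tl y) * t)) * g y t)"
    unfolding conf_def by (rule prod_sum_PiE[symmetric]) auto
  also have "\<dots> = (\<Prod>x\<in>W n. collapse g x (\<sigma> x))"
    by (simp add: prod_W_Suc collapse_def)
  finally show ?thesis by (simp add: weight_def)
qed

lemma sum_conf_V_Suc:
  "(\<Sum>\<tau>\<in>conf (V (Suc n)). f \<tau>) = (\<Sum>\<sigma>\<in>conf (V n). \<Sum>\<omega>\<in>conf (W (Suc n)). f (merge (V n) (W (Suc n)) (\<sigma>, \<omega>)))"
  unfolding V_Suc by (rule sum_conf_Un) (rule V_W_disjoint)

lemma sum_weight_V_Suc: "(\<Sum>\<tau>\<in>conf (V (Suc n)). weight (Suc n) g \<tau>) = (\<Sum>\<tau>\<in>conf (V n). weight n (collapse g) \<tau>)"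
  unfolding sum_conf_V_Suc by (intro sum.cong sum_weight_Suc refl)

lemma sum_law_Suc:
  assumes "\<sigma> \<in> conf (V n)"
  shows "(\<Sum>\<omega>\<in>conf (W (Suc n)). law (Suc n) g (merge (V n) (W (Suc n)) (\<sigma>, \<omega>))) = law n (collapse g) \<sigma>"
  unfolding law_def sum_weight_V_Suc by (simp only: sum_divide_distrib[symmetric] sum_weight_Suc[OF assms])

lemma restrict_merge_V:
  assumes "m \<le> n"
  shows "restrict (merge (V n) (W (Suc n)) (\<sigma>, \<omega>)) (V m) = restrict \<sigma> (V m)"
  using V_mono[OF assms] by (auto simp: merge_def restrict_def fun_eq_iff)

lemma sum_law_marginal:
  "(\<Sum>\<tau>\<in>conf (V (m + k)). f (restrict \<tau> (V m)) * law (m + k) g \<tau>) =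
   (\<Sum>\<sigma>\<in>conf (V m). f \<sigma> * law m ((collapse ^^ k) g) \<sigma>)"
proof (induction k arbitrary: g)
  case 0
  show ?case by (auto intro!: sum.cong simp: conf_def PiE_restrict)
next
  case (Suc k)
  have "(\<Sum>\<tau>\<in>conf (V (m + Suc k)). f (restrict \<tau> (V m)) * law (m + Suc k) g \<tau>) =
     (\<Sum>\<tau>\<in>conf (V (m + k)). f (restrict \<tau> (V m)) * law (m + k) (collapse g) \<tau>)"
    by (simp add: sum_conf_V_Suc restrict_merge_V sum_distrib_left[symmetric] sum_law_Suc)
  also have "\<dots> = (\<Sum>\<sigma>\<in>conf (V m). f \<sigma> * law m ((collapse ^^ k) (collapse g)) \<sigma>)" by (rule Suc.IH)
  finally show ?case by (simp only: funpow_Suc_right o_apply)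
qed

lemma collapse_pos: "message g \<Longrightarrow> 0 < collapse g x s"
proof -
  assume g: "message g"
  have "0 < (\<Sum>t\<in>S y. exp (\<beta> * J * (s * t)) * g y t)" for y
  proof -
    obtain t where "t \<in> S y" "0 < g y t" using g by (auto simp: message_def)
    then show ?thesis using g by (intro sum_pos2[of _ t]) (auto simp: message_def)
  qed
  then show ?thesis by (simp add: collapse_def prod_pos)
qed

lemma message_collapse: "message g \<Longrightarrow> message (collapse g)"
  using collapse_pos[of g] xi_plus_in_S unfolding message_def by (meson less_imp_le)

lemma message_collapse_funpow: "message g \<Longrightarrow> message ((collapse ^^ k) g)"
  by (induction k) (auto simp: message_collapse)

lemma weight_nonneg: "message g \<Longrightarrow> \<sigma> \<in> conf (V n) \<Longrightarrow> 0 \<le> weight n g \<sigma>"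
  using W_subset_V[of n] by (auto simp: weight_def message_def conf_def PiE_iff intro!: prod_nonneg mult_nonneg_nonneg)

lemma sum_weight_pos: assumes "message g" shows "0 < (\<Sum>\<tau>\<in>conf (V n). weight n g \<tau>)"
proof -
  obtain \<tau> where \<tau>: "\<And>x. \<tau> x \<in> S x \<and> 0 < g x (\<tau> x)" using assms unfolding message_def by metis
  have "0 < weight n g (restrict \<tau> (V n))"
    using \<tau> W_subset_V[of n] by (auto simp: weight_def intro!: prod_pos mult_pos_pos)
  then show ?thesis
    using \<tau> weight_nonneg[OF assms] by (intro sum_pos2[of _ "restrict \<tau> (V n)"]) (auto simp: conf_UNIV_iff)
qed

lemma law_nonneg: "message g \<Longrightarrow> \<sigma> \<in> conf (V n) \<Longrightarrow> 0 \<le> law n g \<sigma>"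
  using weight_nonneg sum_weight_pos[of g n] by (auto simp: law_def intro!: divide_nonneg_pos)

lemma sum_law: "message g \<Longrightarrow> (\<Sum>\<tau>\<in>conf (V n). law n g \<tau>) = 1"
  using sum_weight_pos[of g n] by (simp add: law_def sum_divide_distrib[symmetric])

text \<open>Only the ratios of the values of a message matter.\<close>

lemma law_rescale:
  assumes "\<And>x. a x \<noteq> 0"
  shows "law n (\<lambda>x s. a x * g x s) \<sigma> = law n g \<sigma>"
proof -
  have "weight n (\<lambda>x s. a x * g x s) \<tau> = (\<Prod>x\<in>W n. a x) * weight n g \<tau>" for \<tau>
    by (simp add: weight_def prod.distrib)
  moreover have "(\<Prod>x\<in>W n. a x) \<noteq> 0" using assms by simp
  ultimately show ?thesis by (simp add: law_def sum_distrib_left[symmetric])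
qed

text \<open>Changing the spin at \<open>x\<close> changes each of the two edge energies by a bounded amount. This keeps the iterated
messages away from \<open>0\<close> and \<open>\<infinity>\<close> relative to each other.\<close>

lemma collapse_bounded_ratio:
  assumes "message g" "s \<in> S x" "s' \<in> S x"
  shows "collapse g x s \<le> exp (9 * \<beta> * J) * collapse g x s'"
proof -
  have "collapse g x s \<le> (\<Prod>b\<in>(UNIV::bool set). exp (9/2 * \<beta> * J) * (\<Sum>t\<in>S (b # x). exp (\<beta> * J * (s' * t)) * g (b # x) t))"
    unfolding collapse_def
  proof (intro prod_mono conjI)
    fix b
    show "0 \<le> (\<Sum>t\<in>S (b # x). exp (\<beta> * J * (s * t)) * g (b # x) t)"
      using assms(1) by (auto simp: message_def intro!: sum_nonneg)
    show "(\<Sum>t\<in>S (b # x). exp (\<beta> * J * (s * t)) * g (b # x) t) \<le>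
        exp (9/2 * \<beta> * J) * (\<Sum>t\<in>S (b # x). exp (\<beta> * J * (s' * t)) * g (b # x) t)"
      unfolding sum_distrib_left
    proof (rule sum_mono)
      fix t assume t: "t \<in> S (b # x)"
      \<comment> \<open>Products of two spins have modulus at most \<open>9/4\<close>, so two of them differ by at most \<open>9/2\<close>; two children give the exponent \<open>9\<close>.\<close>
      have "\<bar>s * t\<bar> \<le> 3/2 * (3/2)" "\<bar>s' * t\<bar> \<le> 3/2 * (3/2)"
        unfolding abs_mult using t assms by (intro mult_mono abs_spin_le; auto)+
      then have "s * t \<le> 9/2 + s' * t" by linarith
      then have "\<beta> * J * (s * t) \<le> \<beta> * J * (9/2 + s' * t)" using J \<beta> by (intro mult_left_mono) auto
      then have "exp (\<beta> * J * (s * t)) \<le> exp (9/2 * \<beta> * J) * exp (\<beta> * J * (s' * t))"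
        unfolding mult_exp_exp by (simp add: algebra_simps)
      then show "exp (\<beta> * J * (s * t)) * g (b # x) t \<le> exp (9/2 * \<beta> * J) * (exp (\<beta> * J * (s' * t)) * g (b # x) t)"
        using assms(1) t unfolding mult.assoc[symmetric] by (intro mult_right_mono) (auto simp: message_def)
    qed
  qed
  also have "\<dots> = exp (9 * \<beta> * J) * collapse g x s'"
    by (simp add: collapse_def UNIV_bool mult_exp_exp)
  finally show ?thesis .
qed

text \<open>At one child this is the four functions theorem on the chain of its spins; \<open>exp (\<beta> * J * (s * u))\<close> is
supermodular in \<open>(s, u)\<close> because the interaction is ferromagnetic. The order is preserved by products.\<close>

lemma lr_le_collapse:
  assumes "message g" "message g'" "lr_le g g'"
  shows "lr_le (collapse g) (collapse g')"
  unfolding lr_le_def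
proof (intro allI ballI impI)
  fix x s t assume st: "s \<in> S x" "t \<in> S x" "s \<le> t"
  let ?A = "\<lambda>g s b. \<Sum>u\<in>S (b # x). exp (\<beta> * J * (s * u)) * g (b # x) u"
  have nonneg: "0 \<le> g y u" "0 \<le> g' y u" if "u \<in> S y" for y u using assms that by (auto simp: message_def)
  have "?A g t b * ?A g' s b \<le> ?A g s b * ?A g' t b" for b
  proof (rule four_functions_chain)
    fix u v assume uv: "u \<in> S (b # x)" "v \<in> S (b # x)"
    have "0 \<le> (t - s) * (max u v - u)" using st by simp
    moreover have "min u v + max u v = u + v" by (simp add: min_def max_def)
    ultimately have "t * u + s * v \<le> s * min u v + t * max u v"
      by (smt (verit, best) distrib_left left_diff_distrib right_diff_distrib)
    then have "\<beta> * J * (t * u + s * v) \<le> \<beta> * J * (s * min u v + t * max u v)"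
      using J \<beta> by (intro mult_left_mono) auto
    then have E: "exp (\<beta> * J * (t * u)) * exp (\<beta> * J * (s * v)) \<le>
        exp (\<beta> * J * (s * min u v)) * exp (\<beta> * J * (t * max u v))"
      unfolding mult_exp_exp by (simp add: distrib_left)
    have G: "g (b # x) u * g' (b # x) v \<le> g (b # x) (min u v) * g' (b # x) (max u v)"
      using assms(3) uv by (cases "u \<le> v") (auto simp: lr_le_def min_def max_def)
    have "(exp (\<beta> * J * (t * u)) * exp (\<beta> * J * (s * v))) * (g (b # x) u * g' (b # x) v) \<le>
        (exp (\<beta> * J * (s * min u v)) * exp (\<beta> * J * (t * max u v))) *
        (g (b # x) (min u v) * g' (b # x) (max u v))"
      using uv by (intro mult_mono E G mult_nonneg_nonneg nonneg) auto
    then show "exp (\<beta> * J * (t * u)) * g (b # x) u * (exp (\<beta> * J * (s * v)) * g' (b # x) v) \<le>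
        exp (\<beta> * J * (s * min u v)) * g (b # x) (min u v) * (exp (\<beta> * J * (t * max u v)) * g' (b # x) (max u v))"
      by (simp only: ac_simps)
  qed (use nonneg in auto)
  then have "(\<Prod>b\<in>(UNIV::bool set). ?A g t b * ?A g' s b) \<le> (\<Prod>b\<in>UNIV. ?A g s b * ?A g' t b)"
    using nonneg by (intro prod_mono) (auto intro!: mult_nonneg_nonneg sum_nonneg)
  then show "collapse g x t * collapse g' x s \<le> collapse g x s * collapse g' x t"
    by (simp add: collapse_def prod.distrib)
qed

lemma lr_le_collapse_funpow:
  assumes "message g" "message g'" "lr_le g g'" shows "lr_le ((collapse ^^ k) g) ((collapse ^^ k) g')"
  using assms by (induction k) (auto intro!: lr_le_collapse message_collapse_funpow)

lemma mult_add_mult_le_min_max: 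
  fixes a b c d :: real
  shows "a * b + c * d \<le> min a c * min b d + max a c * max b d"
proof -
  have "0 \<le> (a - c) * (b - d)" if "(a \<le> c \<and> b \<le> d) \<or> (c \<le> a \<and> d \<le> b)"
    using that by (auto intro: mult_nonpos_nonpos)
  moreover have "(a - c) * (b - d) \<le> 0" if "(a \<le> c \<and> d \<le> b) \<or> (c \<le> a \<and> b \<le> d)"
    using that by (auto intro: mult_nonpos_nonneg mult_nonneg_nonpos)
  ultimately show ?thesis
    by (auto simp: min_def max_def algebra_simps not_le)
qed

text \<open>Holley's inequality: the interaction is supermodular, and at the boundary the hypothesis of Holley's
inequality is the likelihood ratio order.\<close>

lemma average_mono:
  assumes "message g" "message g'" "lr_le g g'" "mono_on (conf (V n)) F"
  shows "(\<Sum>\<sigma>\<in>conf (V n). F \<sigma> * law n g \<sigma>) \<le> (\<Sum>\<sigma>\<in>conf (V n). F \<sigma> * law n g' \<sigma>)"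
proof -
  let ?Z = "\<Sum>\<sigma>\<in>conf (V n). weight n g \<sigma>" and ?Z' = "\<Sum>\<sigma>\<in>conf (V n). weight n g' \<sigma>"
  have "(\<Sum>\<sigma>\<in>conf (V n). F \<sigma> * weight n g \<sigma>) * ?Z' \<le> ?Z * (\<Sum>\<sigma>\<in>conf (V n). F \<sigma> * weight n g' \<sigma>)"
    unfolding conf_def
  proof (rule holley)
    fix \<sigma> \<tau> assume \<sigma>\<tau>: "\<sigma> \<in> PiE (V n) S" "\<tau> \<in> PiE (V n) S"
    let ?m = "\<lambda>x. min (\<sigma> x) (\<tau> x)" and ?M = "\<lambda>x. max (\<sigma> x) (\<tau> x)"
    have spin: "\<sigma> x \<in> S x" "\<tau> x \<in> S x" if "x \<in> W n" for x
      using that \<sigma>\<tau> W_subset_V by (auto simp: PiE_iff)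
    have "(\<Sum>y\<in>V n - {[]}. \<sigma> (tl y) * \<sigma> y) + (\<Sum>y\<in>V n - {[]}. \<tau> (tl y) * \<tau> y) \<le>
        (\<Sum>y\<in>V n - {[]}. ?m (tl y) * ?m y) + (\<Sum>y\<in>V n - {[]}. ?M (tl y) * ?M y)"
      unfolding sum.distrib[symmetric] by (intro sum_mono mult_add_mult_le_min_max)
    then have "\<beta> * J * ((\<Sum>y\<in>V n - {[]}. \<sigma> (tl y) * \<sigma> y) + (\<Sum>y\<in>V n - {[]}. \<tau> (tl y) * \<tau> y)) \<le>
        \<beta> * J * ((\<Sum>y\<in>V n - {[]}. ?m (tl y) * ?m y) + (\<Sum>y\<in>V n - {[]}. ?M (tl y) * ?M y))"
      using J \<beta> by (intro mult_left_mono) auto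
    then have E: "exp (- \<beta> * Ham J n \<sigma>) * exp (- \<beta> * Ham J n \<tau>) \<le>
        exp (- \<beta> * Ham J n ?m) * exp (- \<beta> * Ham J n ?M)"
      unfolding mult_exp_exp exp_le_cancel_iff Ham_eq by (simp add: distrib_left mult.assoc)
    have "g x (\<sigma> x) * g' x (\<tau> x) \<le> g x (?m x) * g' x (?M x)" if "x \<in> W n" for x
      using spin[OF that] assms(3) by (cases "\<sigma> x \<le> \<tau> x") (auto simp: lr_le_def min_def max_def)
    then have G: "(\<Prod>x\<in>W n. g x (\<sigma> x) * g' x (\<tau> x)) \<le> (\<Prod>x\<in>W n. g x (?m x) * g' x (?M x))"
      using spin assms by (intro prod_mono) (auto simp: message_def)
    have "(exp (- \<beta> * Ham J n \<sigma>) * exp (- \<beta> * Ham J n \<tau>)) * (\<Prod>x\<in>W n. g x (\<sigma> x) * g' x (\<tau> x)) \<le>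
        (exp (- \<beta> * Ham J n ?m) * exp (- \<beta> * Ham J n ?M)) * (\<Prod>x\<in>W n. g x (?m x) * g' x (?M x))"
      using spin assms by (intro mult_mono E G) (auto intro!: prod_nonneg simp: message_def)
    then show "weight n g \<sigma> * weight n g' \<tau> \<le> weight n g ?m * weight n g' ?M"
      unfolding weight_def prod.distrib by (simp only: ac_simps)
  qed (use assms weight_nonneg in \<open>auto simp: conf_def\<close>)
  then show ?thesis
    using sum_weight_pos[OF assms(1), of n] sum_weight_pos[OF assms(2), of n]
    by (simp add: law_def sum_divide_distrib[symmetric] divide_simps mult.commute)
qed

definition pinned :: "config \<Rightarrow> vertex \<Rightarrow> real \<Rightarrow> real" where
  "pinned \<zeta> x s = of_bool (s = \<zeta> x)"

lemma message_pinned: "\<zeta> \<in> conf UNIV \<Longrightarrow> message (pinned \<zeta>)"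
  by (auto simp: message_def pinned_def conf_UNIV_iff)

lemma collapse_pinned: "\<eta> \<in> conf UNIV \<Longrightarrow> collapse (pinned \<eta>) x s = (\<Prod>b\<in>UNIV. exp (\<beta> * J * (s * \<eta> (b # x))))"
  by (simp add: collapse_def pinned_def conf_UNIV_iff if_distrib sum.delta cong: if_cong)

lemma lr_le_pinned_plus: "message g \<Longrightarrow> lr_le g (pinned xi_plus)"
  by (auto simp: lr_le_def pinned_def message_def dest: le_xi_plus)

lemma lr_le_pinned_minus: "message g \<Longrightarrow> lr_le (pinned xi_minus) g"
  by (auto simp: lr_le_def pinned_def message_def dest: xi_minus_le)

section \<open>Convergence of the finite-volume laws\<close>

lemma mu_h_eq_law: "mu_h J \<beta> h n = law n (\<lambda>x s. exp (h x s))"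
proof -
  have "mu_h_weight J \<beta> h n \<sigma> = weight n (\<lambda>x s. exp (h x s)) \<sigma>" for \<sigma>
    by (simp only: mu_h_weight_def weight_def exp_add exp_sum[OF finite_W])
  then show ?thesis by (simp add: mu_h_def law_def fun_eq_iff)
qed

lemma collapse_funpow_radial:
  assumes "\<And>x y. length x = length y \<Longrightarrow> \<zeta> x = \<zeta> y" "length x = length y"
  shows "(collapse ^^ k) (pinned \<zeta>) x s = (collapse ^^ k) (pinned \<zeta>) y s"
  using assms(2)
proof (induction k arbitrary: x y s)
  case 0
  then show ?case using assms(1)[of x y] by (simp add: pinned_def)
next
  case (Suc k)
  have "S (b # x) = S (b # y)" for b using Suc.prems by (intro S_cong) simp
  moreover have "(collapse ^^ k) (pinned \<zeta>) (b # x) t = (collapse ^^ k) (pinned \<zeta>) (b # y) t" for b t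
    using Suc by auto
  ultimately show ?case by (simp add: collapse_def[of "(collapse ^^ k) (pinned \<zeta>)"])
qed

text \<open>Monotone convergence of message ratios. Normalising by the value at the extremal spin \<open>\<zeta> x\<close> makes the
ratios increasing in the depth for both boundary conditions.\<close>

theorem extremal_limit:
  assumes \<zeta>: "\<zeta> = xi_minus \<or> \<zeta> = xi_plus"
  obtains h where "\<And>x y. length x = length y \<Longrightarrow> h x = h y" and "compatible J \<beta> h"
    and "\<And>m \<sigma>. \<sigma> \<in> conf (V m) \<Longrightarrow> (\<lambda>k. law m ((collapse ^^ k) (pinned \<zeta>)) \<sigma>) \<longlonglongrightarrow> mu_h J \<beta> h m \<sigma>"
proof -
  let ?g = "\<lambda>k. (collapse ^^ k) (pinned \<zeta>)"
  have \<zeta>S: "\<zeta> x \<in> S x" for x using \<zeta> by auto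
  have message: "message (?g k)" for k
    using \<zeta>S by (intro message_collapse_funpow message_pinned) (simp add: conf_UNIV_iff)
  have pos: "0 < ?g k x (\<zeta> x)" for k x
    using message collapse_pos by (cases k) (auto simp: pinned_def)
  \<comment> \<open>\<open>R k\<close> gives the same law as the \<open>k\<close>-th iterate but has value \<open>1\<close> at the boundary spin.\<close>
  define R where "R k x s = ?g k x s / ?g k x (\<zeta> x)" for k x s
  have R_nonneg: "0 \<le> R k x s" if "s \<in> S x" for k x s
    using message[of k] that pos[of k x] by (auto simp: R_def message_def intro!: divide_nonneg_pos)
  have inc: "incseq (\<lambda>k. R k x s)" if s: "s \<in> S x" for x s
  proof (rule incseq_SucI)
    fix k
    have "?g k x s * ?g (Suc k) x (\<zeta> x) \<le> ?g (Suc k) x s * ?g k x (\<zeta> x)"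
      using \<zeta>
    proof
      assume z: "\<zeta> = xi_minus"
      have "lr_le (?g k) (?g (Suc k))"
        unfolding funpow_Suc_right o_apply
        using message[of 0] message[of 1] unfolding z by (intro lr_le_collapse_funpow lr_le_pinned_minus) auto
      then have "?g k x s * ?g (Suc k) x (\<zeta> x) \<le> ?g k x (\<zeta> x) * ?g (Suc k) x s"
        using s \<zeta>S[of x] xi_minus_le[OF s] unfolding lr_le_def z by blast
      then show ?thesis by (simp only: mult.commute)
    next
      assume z: "\<zeta> = xi_plus"
      have "lr_le (?g (Suc k)) (?g k)"
        unfolding funpow_Suc_right o_apply
        using message[of 0] message[of 1] unfolding z by (intro lr_le_collapse_funpow lr_le_pinned_plus) auto
      then have "?g (Suc k) x (\<zeta> x) * ?g k x s \<le> ?g (Suc k) x s * ?g k x (\<zeta> x)"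
        using s \<zeta>S[of x] le_xi_plus[OF s] unfolding lr_le_def z by blast
      then show ?thesis by (simp only: mult.commute)
    qed
    then show "R k x s \<le> R (Suc k) x s"
      using pos[of k x] pos[of "Suc k" x] by (simp add: R_def divide_simps mult.commute)
  qed
  have bound: "R k x s \<le> exp (9 * \<beta> * J)" if "s \<in> S x" for k x s
  proof -
    have "R k x s \<le> R (Suc k) x s" using inc[OF that] by (rule incseqD) simp
    also have "\<dots> \<le> exp (9 * \<beta> * J)"
      using collapse_bounded_ratio[OF message that \<zeta>S, of k] pos[of "Suc k" x]
      by (simp add: R_def divide_simps)
    finally show ?thesis .
  qed
  \<comment> \<open>The value for \<open>s \<notin> S x\<close> is arbitrary; it only has to be positive and radial for \<open>h\<close> to be so.\<close>
  define r where "r x s = (if s \<in> S x then lim (\<lambda>k. R k x s) else 1)" for x s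
  have lim: "(\<lambda>k. R k x s) \<longlonglongrightarrow> r x s" if s: "s \<in> S x" for x s
  proof -
    have "convergent (\<lambda>k. R k x s)"
      by (rule Bseq_mono_convergent[OF BseqI'[where K = "exp (9 * \<beta> * J)"]])
        (use bound[OF s] R_nonneg[OF s] incseqD[OF inc[OF s]] in auto)
    then show ?thesis using s by (simp add: r_def convergent_LIMSEQ_iff)
  qed
  have r_pos: "0 < r x s" for x s
  proof (cases "s \<in> S x")
    case True
    \<comment> \<open>The pinned message itself vanishes off \<open>\<zeta> x\<close>, but one step makes it positive.\<close>
    have "0 < R 1 x s" using collapse_pos[OF message[of 0]] pos[of 1 x] by (simp add: R_def)
    also have "R 1 x s \<le> r x s" using incseq_le[OF inc lim] True by blast
    finally show ?thesis .
  qed (simp add: r_def)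
  define h where "h x s = ln (r x s)" for x s
  have conv: "(\<lambda>k. law m (?g k) \<sigma>) \<longlonglongrightarrow> mu_h J \<beta> h m \<sigma>" if \<sigma>: "\<sigma> \<in> conf (V m)" for m \<sigma>
  proof -
    have law_R: "law m (?g k) = law m (R k)" for k
      using law_rescale[of "\<lambda>x. 1 / ?g k x (\<zeta> x)" m "?g k"] pos[of k]
      by (fastforce simp: fun_eq_iff R_def[abs_def] less_le)
    have mu_r: "mu_h J \<beta> h m = law m r"
      using r_pos by (simp add: mu_h_eq_law h_def)
    have weight_lim: "(\<lambda>k. weight m (R k) \<tau>) \<longlonglongrightarrow> weight m r \<tau>" if "\<tau> \<in> conf (V m)" for \<tau>
      unfolding weight_def using that W_subset_V[of m]
      by (intro tendsto_intros lim) (auto simp: conf_def PiE_iff)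
    have "message r" using r_pos \<zeta>S by (auto simp: message_def less_imp_le)
    then show ?thesis
      using \<sigma> sum_weight_pos[of r m] unfolding law_R mu_r law_def by (auto intro!: tendsto_intros weight_lim)
  qed
  show thesis
  proof (rule that[OF _ _ conv])
    fix x y :: vertex assume xy: "length x = length y"
    have radial: "\<zeta> x = \<zeta> y" if "length x = length y" for x y
      using that \<zeta> by (auto simp: xi_plus_eq xi_minus_eq)
    have "?g k x s = ?g k y s" for k s by (rule collapse_funpow_radial[OF radial xy])
    then show "h x = h y"
      by (simp add: fun_eq_iff h_def r_def R_def S_cong[OF xy] radial[OF xy])
  next
    have "(\<Sum>\<omega>\<in>conf (W (Suc n)). mu_h J \<beta> h (Suc n) (merge (V n) (W (Suc n)) (\<sigma>, \<omega>))) = mu_h J \<beta> h n \<sigma>"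
      if \<sigma>: "\<sigma> \<in> conf (V n)" for n \<sigma>
    proof (rule LIMSEQ_unique)
      have "merge (V n) (W (Suc n)) (\<sigma>, \<omega>) \<in> conf (V (Suc n))" if "\<omega> \<in> conf (W (Suc n))" for \<omega>
        using \<sigma> that by (auto simp: conf_def PiE_iff V_Suc merge_def extensional_def)
      then show "(\<lambda>k. \<Sum>\<omega>\<in>conf (W (Suc n)). law (Suc n) (?g k) (merge (V n) (W (Suc n)) (\<sigma>, \<omega>)))
          \<longlonglongrightarrow> (\<Sum>\<omega>\<in>conf (W (Suc n)). mu_h J \<beta> h (Suc n) (merge (V n) (W (Suc n)) (\<sigma>, \<omega>)))"
        by (intro tendsto_sum conv)
      have "(\<lambda>k. law n (?g (Suc k)) \<sigma>) \<longlonglongrightarrow> mu_h J \<beta> h n \<sigma>"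
        using conv[OF \<sigma>] by (rule LIMSEQ_Suc)
      then show "(\<lambda>k. \<Sum>\<omega>\<in>conf (W (Suc n)). law (Suc n) (?g k) (merge (V n) (W (Suc n)) (\<sigma>, \<omega>)))
          \<longlonglongrightarrow> mu_h J \<beta> h n \<sigma>"
        by (simp add: sum_law_Suc[OF \<sigma>])
    qed
    then show "compatible J \<beta> h"
      unfolding compatible_def by (auto simp: gr0_conv_Suc Suc_le_eq)
  qed
qed

end

section \<open>Local functions and Kolmogorov extension\<close>

definition cyl :: "vertex set \<Rightarrow> config \<Rightarrow> config set" where
  "cyl \<Lambda> \<sigma> = {\<xi> \<in> space Xi. restrict \<xi> \<Lambda> = \<sigma>}"

lemma space_Xi: "space Xi = conf UNIV"
  by (simp add: space_conf_space)

text \<open>Every function of finitely many spins is therefore measurable.\<close>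

lemma sets_conf_space:
  assumes "finite \<Lambda>" shows "sets (conf_space \<Lambda>) = Pow (conf \<Lambda>)"
proof
  show "sets (conf_space \<Lambda>) \<subseteq> Pow (conf \<Lambda>)"
    using sets.sets_into_space by (force simp: space_conf_space)
  have single: "{\<sigma>} \<in> sets (conf_space \<Lambda>)" if "\<sigma> \<in> conf \<Lambda>" for \<sigma>
  proof -
    have "{\<sigma>} = (\<Pi>\<^sub>E x\<in>\<Lambda>. {\<sigma> x})"
      using that by (auto simp: conf_def PiE_iff extensional_def fun_eq_iff) metis
    also have "\<dots> \<in> sets (conf_space \<Lambda>)"
      unfolding conf_space_def using assms that by (intro sets_PiM_I_finite) (auto simp: conf_def)
    finally show ?thesis .
  qed
  show "Pow (conf \<Lambda>) \<subseteq> sets (conf_space \<Lambda>)"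
  proof
    fix A assume A: "A \<in> Pow (conf \<Lambda>)"
    have "(\<Union>\<sigma>\<in>A. {\<sigma>}) \<in> sets (conf_space \<Lambda>)"
      using A assms finite_subset[of A "conf \<Lambda>"] by (intro sets.finite_UN single) auto
    then show "A \<in> sets (conf_space \<Lambda>)" by simp
  qed
qed

lemma measurable_restrict_conf:
  assumes "\<Lambda> \<subseteq> \<Delta>"
  shows "(\<lambda>\<xi>. restrict \<xi> \<Lambda>) \<in> conf_space \<Delta> \<rightarrow>\<^sub>M conf_space \<Lambda>"
  unfolding conf_space_def by (rule measurable_restrict_subset[OF assms])

lemma measurable_local:
  fixes f :: "config \<Rightarrow> 'b::topological_space"
  assumes "finite \<Lambda>" "\<Lambda> \<subseteq> \<Delta>"
  shows "(\<lambda>\<xi>. f (restrict \<xi> \<Lambda>)) \<in> borel_measurable (conf_space \<Delta>)"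
proof (rule measurable_compose[OF measurable_restrict_conf[OF assms(2)]])
  show "f \<in> borel_measurable (conf_space \<Lambda>)"
    using sets_conf_space[OF assms(1)] by (auto simp: measurable_def space_conf_space)
qed

lemma sets_cyl:
  assumes "finite \<Lambda>" "\<sigma> \<in> conf \<Lambda>" shows "cyl \<Lambda> \<sigma> \<in> sets Xi"
proof -
  have "(\<lambda>\<xi>. restrict \<xi> \<Lambda>) -` {\<sigma>} \<inter> space Xi \<in> sets Xi"
    by (rule measurable_sets[OF measurable_restrict_conf]) (use assms sets_conf_space in auto)
  then show ?thesis by (simp add: cyl_def vimage_def Int_def conj_commute)
qed

lemma local_eq_sum_cyl:
  fixes f :: "config \<Rightarrow> 'a::comm_semiring_1"
  assumes "finite \<Lambda>" and \<xi>: "\<xi> \<in> conf UNIV"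
  shows "f (restrict \<xi> \<Lambda>) = (\<Sum>\<sigma>\<in>conf \<Lambda>. f \<sigma> * indicator (cyl \<Lambda> \<sigma>) \<xi>)"
proof -
  have "(\<Sum>\<sigma>\<in>conf \<Lambda>. f \<sigma> * indicator (cyl \<Lambda> \<sigma>) \<xi>) = (\<Sum>\<sigma>\<in>conf \<Lambda>. if restrict \<xi> \<Lambda> = \<sigma> then f \<sigma> else 0)"
    using \<xi> by (intro sum.cong refl) (auto simp: cyl_def space_Xi indicator_def)
  also have "\<dots> = f (restrict \<xi> \<Lambda>)"
    using restrict_in_conf[OF \<xi>, of \<Lambda>] by (simp add: assms(1))
  finally show ?thesis by simp
qed

lemma nn_integral_local:
  fixes f :: "config \<Rightarrow> ennreal"
  assumes "sets \<mu> = sets Xi" "finite \<Lambda>"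
  shows "(\<integral>\<^sup>+\<xi>. f (restrict \<xi> \<Lambda>) \<partial>\<mu>) = (\<Sum>\<sigma>\<in>conf \<Lambda>. f \<sigma> * emeasure \<mu> (cyl \<Lambda> \<sigma>))"
proof -
  have space: "space \<mu> = conf UNIV" using sets_eq_imp_space_eq[OF assms(1)] by (simp add: space_Xi)
  have "(\<integral>\<^sup>+\<xi>. f (restrict \<xi> \<Lambda>) \<partial>\<mu>) = (\<integral>\<^sup>+\<xi>. (\<Sum>\<sigma>\<in>conf \<Lambda>. f \<sigma> * indicator (cyl \<Lambda> \<sigma>) \<xi>) \<partial>\<mu>)"
  by (rule nn_integral_cong) (simp add: space local_eq_sum_cyl[OF assms(2)])
  also have "\<dots> = (\<Sum>\<sigma>\<in>conf \<Lambda>. f \<sigma> * emeasure \<mu> (cyl \<Lambda> \<sigma>))"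
    using assms sets_cyl by (subst nn_integral_sum) (auto simp: nn_integral_cmult_indicator)
  finally show ?thesis .
qed

lemma integral_local:
  fixes f :: "config \<Rightarrow> real"
  assumes "prob_on_Xi \<mu>" "finite \<Lambda>"
  shows "(\<integral>\<xi>. f (restrict \<xi> \<Lambda>) \<partial>\<mu>) = (\<Sum>\<sigma>\<in>conf \<Lambda>. f \<sigma> * measure \<mu> (cyl \<Lambda> \<sigma>))"
proof -
  interpret prob_space \<mu> using assms by (simp add: prob_on_Xi_def)
  have sets: "sets \<mu> = sets Xi" using assms by (simp add: prob_on_Xi_def)
  have space: "space \<mu> = conf UNIV" using sets_eq_imp_space_eq[OF sets] by (simp add: space_Xi)
  have "(\<integral>\<xi>. f (restrict \<xi> \<Lambda>) \<partial>\<mu>) = (\<integral>\<xi>. (\<Sum>\<sigma>\<in>conf \<Lambda>. f \<sigma> * indicator (cyl \<Lambda> \<sigma>) \<xi>) \<partial>\<mu>)"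
  by (rule Bochner_Integration.integral_cong) (simp_all add: space local_eq_sum_cyl[OF assms(2)])
  also have "\<dots> = (\<Sum>\<sigma>\<in>conf \<Lambda>. f \<sigma> * measure \<mu> (cyl \<Lambda> \<sigma>))"
    using assms sets sets_cyl
    by (subst Bochner_Integration.integral_sum) (auto simp: emeasure_eq_measure sets.sets_into_space Int_absorb2
      intro!: integrable_mult_right integrable_real_indicator)
  finally show ?thesis .
qed

lemma finite_subset_V:
  assumes "finite K" obtains n where "K \<subseteq> V n"
proof
  show "K \<subseteq> V (Max (length ` K))" using assms by (auto simp: V_eq)
qed

lemma prob_on_Xi_eqI:
  assumes "prob_on_Xi \<mu>" "prob_on_Xi \<nu>"
    and "\<And>n \<sigma>. \<sigma> \<in> conf (V n) \<Longrightarrow> measure \<mu> (cyl (V n) \<sigma>) = measure \<nu> (cyl (V n) \<sigma>)"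
  shows "\<mu> = \<nu>"
proof -
  interpret \<mu>: prob_space \<mu> using assms by (simp add: prob_on_Xi_def)
  interpret \<nu>: prob_space \<nu> using assms by (simp add: prob_on_Xi_def)
  have sets: "sets \<mu> = sets Xi" "sets \<nu> = sets Xi" using assms by (auto simp: prob_on_Xi_def)
  have space: "space \<mu> = conf UNIV" "space \<nu> = conf UNIV"
    using sets[THEN sets_eq_imp_space_eq] by (simp_all add: space_Xi)
  show ?thesis
  proof (rule measure_eqI_PiM_infinite[of _ UNIV "\<lambda>x. count_space (S x)"])
    fix A :: "vertex \<Rightarrow> real set" and K :: "vertex set" assume "finite K"
    then obtain n where n: "K \<subseteq> V n" by (rule finite_subset_V)
    let ?E = "prod_emb UNIV (\<lambda>x. count_space (S x)) K (Pi\<^sub>E K A)"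
    assume "\<And>x. x \<in> K \<Longrightarrow> A x \<in> sets (count_space (S x))"
    with \<open>finite K\<close> have E: "?E \<in> sets Xi" unfolding conf_space_def by (intro sets_PiM_I) auto
    let ?f = "\<lambda>\<sigma>. of_bool (\<forall>x\<in>K. \<sigma> x \<in> A x) :: ennreal"
    have ind: "indicator ?E \<xi> = ?f (restrict \<xi> (V n))" if "\<xi> \<in> conf UNIV" for \<xi>
      using that n by (auto simp: indicator_def prod_emb_def space_PiM conf_def PiE_iff subset_iff)
    have int: "emeasure M ?E = (\<integral>\<^sup>+\<xi>. ?f (restrict \<xi> (V n)) \<partial>M)"
      if "sets M = sets Xi" "space M = conf UNIV" for M
    proof -
      have "emeasure M ?E = (\<integral>\<^sup>+\<xi>. indicator ?E \<xi> \<partial>M)" using E that by simp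
      also have "\<dots> = (\<integral>\<^sup>+\<xi>. ?f (restrict \<xi> (V n)) \<partial>M)"
        by (rule nn_integral_cong) (simp only: ind that)
      finally show ?thesis .
    qed
    have "emeasure \<mu> ?E = (\<integral>\<^sup>+\<xi>. ?f (restrict \<xi> (V n)) \<partial>\<mu>)"
      by (rule int) (rule sets space)+
    also have "\<dots> = (\<integral>\<^sup>+\<xi>. ?f (restrict \<xi> (V n)) \<partial>\<nu>)"
      unfolding nn_integral_local[where f = ?f, OF sets(1) finite_V]
        nn_integral_local[where f = ?f, OF sets(2) finite_V]
      by (simp add: assms(3) \<mu>.emeasure_eq_measure \<nu>.emeasure_eq_measure)
    also have "\<dots> = emeasure \<nu> ?E"
      by (rule int[symmetric]) (rule sets space)+
    finally show "emeasure \<mu> ?E = emeasure \<nu> ?E" .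
  qed (use sets \<mu>.finite_measure_axioms in \<open>auto simp: conf_space_def\<close>)
qed

text \<open>A measurable retraction of all real-valued configurations onto the configurations with admissible
spins. It transports results about Borel measures on a Polish space to \<open>Xi\<close>.\<close>

definition clip :: "config \<Rightarrow> config" where
  "clip \<xi> x = (if \<xi> x \<in> S x then \<xi> x else xi_plus x)"

lemma clip_component:
  assumes "x \<in> K"
  shows "(\<lambda>\<xi>. clip \<xi> x) \<in> PiM K (\<lambda>_. borel) \<rightarrow>\<^sub>M count_space (S x)"
proof -
  let ?c = "\<lambda>s. if s \<in> S x then s else xi_plus x"
  have "?c \<in> borel \<rightarrow>\<^sub>M count_space (S x)"
  proof (subst measurable_count_space_eq2)
    have S: "A \<in> sets borel" if "A \<subseteq> S x" for A
      using that finite_subset[OF that] by (auto intro: borel_closed finite_imp_closed)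
    show "?c \<in> space borel \<rightarrow> S x \<and> (\<forall>a\<in>S x. ?c -` {a} \<inter> space borel \<in> sets borel)"
    proof (intro conjI ballI)
      fix a assume a: "a \<in> S x"
      have "?c -` {a} = (if a = xi_plus x then - (S x - {a}) else {a})"
        using a by auto
      moreover have "- (S x - {a}) \<in> sets borel" using S[of "S x - {a}"] by (intro borel_comp) auto
      ultimately show "?c -` {a} \<inter> space borel \<in> sets borel" by auto
    qed auto
  qed simp
  from measurable_compose[OF measurable_component_singleton[OF assms, of "\<lambda>_. borel"] this]
  show ?thesis by (simp add: clip_def)
qed

lemma clip_measurable: "clip \<in> PiM UNIV (\<lambda>_. borel) \<rightarrow>\<^sub>M Xi"
  unfolding conf_space_def
proof (rule measurable_PiM_single')
  show "(\<lambda>\<xi>. clip \<xi> x) \<in> PiM UNIV (\<lambda>_. borel) \<rightarrow>\<^sub>M count_space (S x)" for x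
    by (rule clip_component) simp
qed (auto simp: clip_def)

text \<open>Consistency for the steps from \<open>V n\<close> to \<open>V (Suc n)\<close> suffices, since the marginal on an arbitrary finite set can be
read off from any \<open>V n\<close> that contains it. The limit is formed over the real line and then clipped.\<close>

theorem kolmogorov_extension_V:
  fixes p :: "nat \<Rightarrow> config \<Rightarrow> real"
  assumes nonneg: "\<And>n \<sigma>. \<sigma> \<in> conf (V n) \<Longrightarrow> 0 \<le> p n \<sigma>"
    and total: "\<And>n. (\<Sum>\<sigma>\<in>conf (V n). p n \<sigma>) = 1"
    and consistent: "\<And>n \<sigma>. \<sigma> \<in> conf (V n) \<Longrightarrow>
      (\<Sum>\<omega>\<in>conf (W (Suc n)). p (Suc n) (merge (V n) (W (Suc n)) (\<sigma>, \<omega>))) = p n \<sigma>"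
  obtains \<mu> where "prob_on_Xi \<mu>"
    and "\<And>n \<sigma>. \<sigma> \<in> conf (V n) \<Longrightarrow> measure \<mu> (cyl (V n) \<sigma>) = p n \<sigma>"
proof -
  let ?B = "\<lambda>_ :: vertex. borel :: real measure"
  define pm where "pm n = point_measure (conf (V n)) (\<lambda>\<sigma>. ennreal (p n \<sigma>))" for n
  have meas: "(\<lambda>\<sigma>. restrict \<sigma> K) \<in> pm n \<rightarrow>\<^sub>M PiM K ?B" for n K
    by (auto simp: pm_def measurable_point_measure_eq1 space_PiM)
  define Q where "Q n K = distr (pm n) (PiM K ?B) (\<lambda>\<sigma>. restrict \<sigma> K)" for n K
  have Q: "emeasure (Q n K) X = ennreal (\<Sum>\<sigma>\<in>conf (V n). p n \<sigma> * of_bool (restrict \<sigma> K \<in> X))"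
    if X: "X \<in> sets (PiM K ?B)" for n K X
  proof -
    have "emeasure (Q n K) X = emeasure (pm n) {\<sigma> \<in> conf (V n). restrict \<sigma> K \<in> X}"
      unfolding Q_def using X
      by (subst emeasure_distr[OF meas]) (auto simp: pm_def space_point_measure intro!: arg_cong2[of _ _ _ _ emeasure])
    also have "\<dots> = (\<Sum>\<sigma> | \<sigma> \<in> conf (V n) \<and> restrict \<sigma> K \<in> X. ennreal (p n \<sigma>))"
      unfolding pm_def by (rule emeasure_point_measure_finite2) auto
    also have "\<dots> = ennreal (\<Sum>\<sigma> | \<sigma> \<in> conf (V n) \<and> restrict \<sigma> K \<in> X. p n \<sigma>)"
      using nonneg by (intro sum_ennreal) auto
    also have "(\<Sum>\<sigma> | \<sigma> \<in> conf (V n) \<and> restrict \<sigma> K \<in> X. p n \<sigma>) =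
        (\<Sum>\<sigma>\<in>conf (V n). p n \<sigma> * of_bool (restrict \<sigma> K \<in> X))"
      by (rule sum.mono_neutral_cong_left) auto
    finally show ?thesis .
  qed
  have Q_Suc: "Q (Suc n) K = Q n K" if K: "K \<subseteq> V n" for n K
  proof (rule measure_eqI)
    fix X assume "X \<in> sets (Q (Suc n) K)"
    then have X: "X \<in> sets (PiM K ?B)" by (simp add: Q_def)
    have r: "restrict (merge (V n) (W (Suc n)) (\<sigma>, \<omega>)) K = restrict \<sigma> K" for \<sigma> \<omega>
      using K by (auto simp: merge_def restrict_def fun_eq_iff)
    have "(\<Sum>\<sigma>\<in>conf (V (Suc n)). p (Suc n) \<sigma> * of_bool (restrict \<sigma> K \<in> X)) =
        (\<Sum>\<sigma>\<in>conf (V n). p n \<sigma> * of_bool (restrict \<sigma> K \<in> X))"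
      unfolding V_Suc by (subst sum_conf_Un[OF V_W_disjoint])
        (simp add: r sum_distrib_right[symmetric] consistent V_Suc[symmetric])
    then show "emeasure (Q (Suc n) K) X = emeasure (Q n K) X" by (simp only: Q[OF X])
  qed (simp add: Q_def)
  have Q_le: "Q n K = Q m K" if "K \<subseteq> V m" "m \<le> n" for m n K
    using that(2)
  proof (induction rule: dec_induct)
    case (step n)
    then show ?case using Q_Suc[of K n] V_mono[of m n] that by auto
  qed simp
  define N where "N K = (LEAST n. K \<subseteq> V n)" for K
  have N: "K \<subseteq> V (N K)" if "finite K" for K
  proof -
    have "K \<subseteq> V (Max (length ` K))" using that by (auto simp: V_eq)
    then show ?thesis unfolding N_def by (rule LeastI)
  qed
  define P where "P K = Q (N K) K" for K
  have P_eq: "P K = Q n K" if "K \<subseteq> V n" for K n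
    using that Q_le[of K "N K" n] unfolding P_def N_def by (metis LeastI Least_le)
  interpret polish_projective UNIV P
  proof (intro polish_projective.intro projective_family.intro)
    fix K H :: "vertex set" assume KH: "K \<subseteq> H" "finite H"
    have "P K = Q (N H) K" using KH N[of H] by (intro P_eq) auto
    also have "\<dots> = distr (Q (N H) H) (PiM K ?B) (\<lambda>f. restrict f K)"
      unfolding Q_def
      by (subst distr_distr[OF _ meas])
        (use KH in \<open>auto simp: o_def Int_absorb1 restrict_restrict intro!: measurable_restrict_subset\<close>)
    finally show "P K = distr (P H) (PiM K ?B) (\<lambda>f. restrict f K)" by (simp add: P_def)
  next
    fix K :: "vertex set" assume "finite K"
    show "prob_space (P K)"
    proof (rule prob_spaceI)
      have "space (P K) \<in> sets (PiM K ?B)" unfolding P_def Q_def by simp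
      moreover have "restrict \<sigma> K \<in> space (P K)" for \<sigma> by (simp add: P_def Q_def space_PiM)
      ultimately show "emeasure (P K) (space (P K)) = 1"
        using Q[of "space (P K)" K "N K"] total by (simp add: P_def)
    qed
  qed
  have r_lim: "clip \<in> lim \<rightarrow>\<^sub>M Xi" using clip_measurable by (simp cong: measurable_cong_sets)
  show thesis
  proof (rule that[of "distr lim Xi clip"])
    show "prob_on_Xi (distr lim Xi clip)"
      unfolding prob_on_Xi_def using P.prob_space_distr[OF r_lim] by simp
  next
    fix n \<sigma> assume \<sigma>: "\<sigma> \<in> conf (V n)"
    let ?X = "{\<tau> \<in> space (PiM (V n) ?B). \<forall>x\<in>V n. clip \<tau> x = \<sigma> x}"
    have comp: "{\<tau> \<in> space (PiM (V n) ?B). clip \<tau> x = \<sigma> x} \<in> sets (PiM (V n) ?B)" if "x \<in> V n" for x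
    proof -
      have "(\<lambda>\<tau>. clip \<tau> x) \<in> PiM (V n) ?B \<rightarrow>\<^sub>M count_space (S x)"
        by (rule clip_component) fact
      from measurable_sets[OF this, of "{\<sigma> x}"] show ?thesis
        using that \<sigma> by (auto simp: vimage_def Int_def conf_def PiE_iff conj_commute)
    qed
    then have X: "?X \<in> sets (PiM (V n) ?B)"
      by (intro sets.sets_Collect_finite_All) auto
    have "emeasure (distr lim Xi clip) (cyl (V n) \<sigma>) = emeasure lim (emb UNIV (V n) ?X)"
    proof (subst emeasure_distr[OF r_lim sets_cyl[OF finite_V \<sigma>]])
      have "clip -` (cyl (V n) \<sigma>) = emb UNIV (V n) ?X"
        using \<sigma> by (auto simp: cyl_def prod_emb_def space_PiM space_conf_space conf_UNIV_iff clip_def conf_def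
          PiE_iff extensional_def restrict_def fun_eq_iff)
      then show "emeasure lim (clip -` (cyl (V n) \<sigma>) \<inter> space lim) = emeasure lim (emb UNIV (V n) ?X)"
        by (simp add: space_PiM)
    qed
    also have "\<dots> = emeasure (Q n (V n)) ?X"
      using emeasure_lim_emb[OF _ finite_V X] P_eq[of "V n" n] by simp
    also have "\<dots> = ennreal (\<Sum>\<tau>\<in>conf (V n). p n \<tau> * of_bool (restrict \<tau> (V n) \<in> ?X))"
      by (rule Q[OF X])
    also have "(\<Sum>\<tau>\<in>conf (V n). p n \<tau> * of_bool (restrict \<tau> (V n) \<in> ?X)) = (\<Sum>\<tau>\<in>conf (V n). if \<tau> = \<sigma> then p n \<tau> else 0)"
    proof (intro sum.cong refl)
      fix \<tau> assume \<tau>: "\<tau> \<in> conf (V n)"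
      have "restrict \<tau> (V n) \<in> ?X \<longleftrightarrow> \<tau> = \<sigma>"
        using \<tau> \<sigma> by (auto simp: conf_def clip_def space_PiM PiE_iff intro: extensionalityI)
      then show "p n \<tau> * of_bool (restrict \<tau> (V n) \<in> ?X) = (if \<tau> = \<sigma> then p n \<tau> else 0)" by simp
    qed
    also have "\<dots> = p n \<sigma>" using \<sigma> by simp
    finally show "measure (distr lim Xi clip) (cyl (V n) \<sigma>) = p n \<sigma>"
      using nonneg[OF \<sigma>] by (simp add: measure_def)
  qed
qed

section \<open>From local to measurable increasing functions\<close>

lemma prob_on_Xi_space: "prob_on_Xi \<mu> \<Longrightarrow> space \<mu> = conf UNIV"
  using sets_eq_imp_space_eq[of \<mu> Xi] by (simp add: prob_on_Xi_def space_Xi)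

lemma prob_on_Xi_sets: "prob_on_Xi \<mu> \<Longrightarrow> sets \<mu> = sets Xi"
  by (simp add: prob_on_Xi_def)

definition local_le :: "config measure \<Rightarrow> config measure \<Rightarrow> bool" where
  "local_le \<mu> \<nu> \<longleftrightarrow> (\<forall>m F. mono_on (conf (V m)) F \<longrightarrow>
     (\<integral>\<xi>. F (restrict \<xi> (V m)) \<partial>\<mu>) \<le> (\<integral>\<xi>. (F (restrict \<xi> (V m)) :: real) \<partial>\<nu>))"

lemma compact_conf: "compact (conf UNIV :: config set)"
proof -
  have "compactin (product_topology (\<lambda>_. euclidean) UNIV) (PiE UNIV S)"
    by (subst compactin_PiE) (auto intro: finite_imp_compact)
  then show ?thesis
    by (simp add: conf_def euclidean_product_topology)
qed

lemma measure_local: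
  assumes \<mu>: "prob_on_Xi \<mu>"
  shows "measure \<mu> {\<xi> \<in> space Xi. P (restrict \<xi> (V m))} = (\<integral>\<xi>. of_bool (P (restrict \<xi> (V m))) \<partial>\<mu>)"
    and "{\<xi> \<in> space Xi. P (restrict \<xi> (V m))} \<in> sets Xi"
proof -
  let ?E = "{\<xi> \<in> space Xi. P (restrict \<xi> (V m))}"
  have "(\<lambda>\<xi>. (of_bool (P (restrict \<xi> (V m)))) :: real) \<in> borel_measurable Xi"
    by (rule measurable_local[where f = "\<lambda>\<sigma>. of_bool (P \<sigma>)"]) auto
  from measurable_sets[OF this, of "{1}"]
  show E: "?E \<in> sets Xi" by (simp add: vimage_def Int_def conj_commute)
  have "measure \<mu> ?E = (\<integral>\<xi>. indicator ?E \<xi> \<partial>\<mu>)"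
    using E prob_on_Xi_sets[OF \<mu>] sets.sets_into_space[of ?E \<mu>] by (simp add: Int_absorb2)
  also have "\<dots> = (\<integral>\<xi>. of_bool (P (restrict \<xi> (V m))) \<partial>\<mu>)"
    using prob_on_Xi_space[OF \<mu>]
    by (intro Bochner_Integration.integral_cong) (auto simp: space_Xi indicator_def)
  finally show "measure \<mu> ?E = (\<integral>\<xi>. of_bool (P (restrict \<xi> (V m))) \<partial>\<mu>)" .
qed

text \<open>The upward closure of a compact set is an intersection of cylinder sets: if \<open>\<xi>\<close> dominates some point of \<open>K\<close>
on each \<open>V m\<close>, then it dominates any limit point of these points.\<close>

lemma up_closure_cylinders:
  assumes K: "compact K" and A: "A \<subseteq> conf UNIV" "K \<subseteq> A"
    and up: "\<And>\<xi> \<kappa>. \<kappa> \<in> A \<Longrightarrow> \<xi> \<in> conf UNIV \<Longrightarrow> \<kappa> \<le> \<xi> \<Longrightarrow> \<xi> \<in> A"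
    and \<xi>: "\<xi> \<in> conf UNIV" "\<And>m. \<exists>\<kappa>\<in>K. \<forall>x\<in>V m. \<kappa> x \<le> \<xi> x"
  shows "\<xi> \<in> (A :: config set)"
proof -
  obtain \<kappa> where \<kappa>: "\<And>m. \<kappa> m \<in> K" "\<And>m x. x \<in> V m \<Longrightarrow> \<kappa> m x \<le> \<xi> x" using \<xi>(2) by metis
  then obtain l r where l: "l \<in> K" "strict_mono r" "(\<kappa> \<circ> r) \<longlonglongrightarrow> l"
    using K unfolding compact_eq_seq_compact_metric seq_compact_def by blast
  have "l x \<le> \<xi> x" for x
  proof (rule LIMSEQ_le_const2)
    have "isCont (\<lambda>\<xi> :: config. \<xi> x) l"
      by (rule continuous_on_interior[of UNIV]) (auto intro: continuous_on_product_coordinates)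
    from isCont_tendsto_compose[OF this l(3)] show "(\<lambda>n. (\<kappa> \<circ> r) n x) \<longlonglongrightarrow> l x" .
    have "x \<in> V (r n)" if "n \<ge> length x" for n
      using seq_suble[OF l(2), of n] that by (simp add: V_eq)
    then show "\<exists>N. \<forall>n\<ge>N. (\<kappa> \<circ> r) n x \<le> \<xi> x" using \<kappa>(2) by (intro exI[of _ "length x"]) auto
  qed
  then show ?thesis using up[of l \<xi>] A l(1) \<xi>(1) by (auto simp: le_fun_def)
qed

text \<open>Approximate \<open>A\<close> from inside by a compact set \<open>K\<close>. The cylinder sets \<open>C m\<close> of configurations that dominate a
point of \<open>K\<close> on \<open>V m\<close> are increasing sets, so the hypothesis applies to them, and they decrease to the upward
closure of \<open>K\<close>, which lies in \<open>A\<close>.\<close>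

lemma local_le_up_set:
  assumes \<mu>: "prob_on_Xi \<mu>" and \<nu>: "prob_on_Xi \<nu>" and le: "local_le \<mu> \<nu>"
    and A: "A \<in> sets Xi" and up: "\<And>\<xi> \<kappa>. \<kappa> \<in> A \<Longrightarrow> \<xi> \<in> conf UNIV \<Longrightarrow> \<kappa> \<le> \<xi> \<Longrightarrow> \<xi> \<in> A"
  shows "measure \<mu> A \<le> measure \<nu> A"
proof (rule field_le_epsilon)
  fix e :: real assume e: "0 < e"
  interpret \<mu>: prob_space \<mu> using \<mu> by (simp add: prob_on_Xi_def)
  interpret \<nu>: prob_space \<nu> using \<nu> by (simp add: prob_on_Xi_def)
  note sets = prob_on_Xi_sets[OF \<mu>] prob_on_Xi_sets[OF \<nu>]
  note space = prob_on_Xi_space[OF \<mu>] prob_on_Xi_space[OF \<nu>]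
  have AX: "A \<subseteq> conf UNIV" using sets.sets_into_space[OF A] by (simp add: space_Xi)
  have sets_borel: "sets (borel :: config measure) = sets (PiM UNIV (\<lambda>_. borel))"
    by (rule sets_PiM_equal_borel[symmetric])
  have id: "(\<lambda>\<xi>. \<xi>) \<in> \<mu> \<rightarrow>\<^sub>M (borel :: config measure)"
  proof -
    have "(\<lambda>\<xi> :: config. \<xi>) \<in> Xi \<rightarrow>\<^sub>M PiM UNIV (\<lambda>_. borel)"
    proof (rule measurable_PiM_single')
      show "(\<lambda>\<xi>. \<xi> x) \<in> Xi \<rightarrow>\<^sub>M borel" for x
        unfolding conf_space_def
        by (rule measurable_compose[OF measurable_component_singleton]) auto
    qed auto
    then show ?thesis using sets(1) sets_borel by (simp cong: measurable_cong_sets)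
  qed
  have clip: "clip \<in> borel \<rightarrow>\<^sub>M Xi" using clip_measurable sets_borel by (simp cong: measurable_cong_sets)
  have clip_id: "clip \<xi> = \<xi>" if "\<xi> \<in> conf UNIV" for \<xi> using that by (auto simp: clip_def conf_UNIV_iff)
  \<comment> \<open>View \<open>\<mu>\<close> as a Borel measure on the Polish space of all real configurations to use inner regularity there.\<close>
  let ?M = "distr \<mu> borel (\<lambda>\<xi>. \<xi>)"
  let ?A = "clip -` A"
  have A': "?A \<in> sets borel" using measurable_sets[OF clip A] by simp
  have M: "emeasure ?M B = emeasure \<mu> (B \<inter> conf UNIV)" if "B \<in> sets borel" for B
    using that by (subst emeasure_distr[OF id]) (auto simp: space)
  have "emeasure ?M ?A = (SUP K \<in> {K. K \<subseteq> ?A \<and> compact K}. emeasure ?M K)"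
    by (rule inner_regular[OF _ _ A']) (auto simp: emeasure_distr[OF id])
  moreover have "?A \<inter> conf UNIV = A" using AX clip_id by auto
  ultimately have sup: "emeasure \<mu> A = (SUP K \<in> {K. K \<subseteq> ?A \<and> compact K}. emeasure ?M K)"
    using M[OF A'] by simp
  obtain K where K: "K \<subseteq> ?A" "compact K" "measure \<mu> A - e \<le> measure \<mu> (K \<inter> conf UNIV)"
  proof (cases "measure \<mu> A < e")
    case True
    then show ?thesis using that[of "{}"] by simp
  next
    case False
    then have "ennreal (measure \<mu> A - e) < emeasure \<mu> A"
      using e by (simp add: \<mu>.emeasure_eq_measure ennreal_less_iff)
    then obtain K where K: "K \<subseteq> ?A" "compact K" "ennreal (measure \<mu> A - e) < emeasure ?M K"
      unfolding sup less_SUP_iff by blast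
    moreover have "emeasure ?M K = ennreal (measure \<mu> (K \<inter> conf UNIV))"
      using M[of K] borel_compact[OF K(2)] by (simp add: \<mu>.emeasure_eq_measure)
    ultimately show ?thesis using that[of K] False by (simp add: ennreal_less_iff)
  qed
  let ?K = "K \<inter> conf UNIV"
  define C where "C m = {\<xi> \<in> space Xi. \<exists>\<kappa>\<in>?K. \<forall>x\<in>V m. \<kappa> x \<le> restrict \<xi> (V m) x}" for m
  let ?P = "\<lambda>m \<sigma>. \<exists>\<kappa>\<in>?K. \<forall>x\<in>V m. \<kappa> x \<le> (\<sigma> x :: real)"
  have C: "C m \<in> sets Xi" for m
    unfolding C_def by (rule measure_local(2)[OF \<mu>, where P = "?P m" for m])
  have "measure \<mu> A - e \<le> measure \<nu> (C m)" for m
  proof -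
    have Kb: "?K \<in> sets \<mu>"
      using measurable_sets[OF id, of K] borel_compact[OF K(2)] by (simp add: space vimage_def Int_def)
    have "measure \<mu> A - e \<le> measure \<mu> ?K" by (rule K)
    also have "\<dots> \<le> measure \<mu> (C m)"
      using C Kb by (intro \<mu>.finite_measure_mono) (auto simp: C_def sets space_Xi)
    also have "\<dots> = (\<integral>\<xi>. of_bool (?P m (restrict \<xi> (V m))) \<partial>\<mu>)"
      unfolding C_def by (rule measure_local(1)[OF \<mu>, where P = "?P m" for m])
    also have "\<dots> \<le> (\<integral>\<xi>. of_bool (?P m (restrict \<xi> (V m))) \<partial>\<nu>)"
    proof -
      have "mono_on (conf (V m)) (\<lambda>\<sigma>. of_bool (?P m \<sigma>) :: real)"
        by (rule mono_onI) (auto simp: le_fun_def intro: order_trans)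
      then show ?thesis using le unfolding local_le_def by blast
    qed
    also have "\<dots> = measure \<nu> (C m)"
      unfolding C_def by (rule measure_local(1)[OF \<nu>, where P = "?P m" for m, symmetric])
    finally show ?thesis .
  qed
  moreover have "(\<lambda>m. measure \<nu> (C m)) \<longlonglongrightarrow> measure \<nu> (\<Inter>m. C m)"
  proof (rule \<nu>.finite_Lim_measure_decseq)
    show "range C \<subseteq> sets \<nu>" using C sets by auto
    show "decseq C"
    proof (rule decseq_SucI)
      show "C (Suc m) \<subseteq> C m" for m
        unfolding C_def V_Suc by (rule Collect_mono) auto
    qed
  qed
  ultimately have "measure \<mu> A - e \<le> measure \<nu> (\<Inter>m. C m)"
    by (intro LIMSEQ_le_const) auto
  also have "\<dots> \<le> measure \<nu> A"
  proof (rule \<nu>.finite_measure_mono)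
    show "(\<Inter>m. C m) \<subseteq> A"
    proof
      fix \<xi> assume \<xi>: "\<xi> \<in> (\<Inter>m. C m)"
      show "\<xi> \<in> A"
      proof (rule up_closure_cylinders[OF _ AX _ up])
        show "compact ?K" using K(2) compact_conf by (intro compact_Int)
        show "?K \<subseteq> A" using K(1) clip_id by auto
        show "\<xi> \<in> conf UNIV" using \<xi> by (auto simp: C_def space_Xi)
        show "\<exists>\<kappa>\<in>?K. \<forall>x\<in>V m. \<kappa> x \<le> \<xi> x" for m
          using \<xi> unfolding C_def by simp
      qed
    qed
  qed (use A sets in simp)
  finally show "measure \<mu> A \<le> measure \<nu> A + e" by simp
qed

lemma sum_thresholds:
  fixes y :: real
  assumes "0 \<le> y" "y \<le> real N"
  shows "(\<Sum>j=1..N. of_bool (real j \<le> y)) \<le> y \<and> y \<le> (\<Sum>j=1..N. of_bool (real j \<le> y)) + 1"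
proof -
  have "{j \<in> {1..N}. real j \<le> y} = {1..nat \<lfloor>y\<rfloor>}"
    using assms by (auto simp: le_nat_iff le_floor_iff)
  then have "(\<Sum>j=1..N. of_bool (real j \<le> y)) = real (nat \<lfloor>y\<rfloor>)"
    by (simp add: of_bool_def sum.If_cases Int_def)
  then show ?thesis using assms by linarith
qed

text \<open>A bounded increasing function is a uniform limit of nonnegative combinations of indicators of its
superlevel sets, up to an additive constant.\<close>

theorem local_le_imp_stoch_le:
  assumes \<mu>: "prob_on_Xi \<mu>" and \<nu>: "prob_on_Xi \<nu>" and le: "local_le \<mu> \<nu>"
  shows "\<mu> \<preceq>\<^sub>s \<nu>"
  unfolding stoch_le_def
proof (intro allI impI, elim conjE)
  fix F :: "config \<Rightarrow> real"
  assume F: "F \<in> borel_measurable Xi" "bounded (F ` space Xi)" "mono_on (space Xi) F"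
  interpret \<mu>: prob_space \<mu> using \<mu> by (simp add: prob_on_Xi_def)
  interpret \<nu>: prob_space \<nu> using \<nu> by (simp add: prob_on_Xi_def)
  note sets = prob_on_Xi_sets[OF \<mu>] prob_on_Xi_sets[OF \<nu>]
  note space = prob_on_Xi_space[OF \<mu>] prob_on_Xi_space[OF \<nu>]
  obtain b where b: "0 < b" "\<And>\<xi>. \<xi> \<in> conf UNIV \<Longrightarrow> \<bar>F \<xi>\<bar> \<le> b"
    using F(2) unfolding bounded_pos by (auto simp: space_Xi)
  define G where "G \<xi> = F \<xi> + b" for \<xi>
  have G: "0 \<le> G \<xi>" "G \<xi> \<le> 2 * b" if "\<xi> \<in> conf UNIV" for \<xi>
    using b(2)[OF that] by (auto simp: G_def)
  have int: "integrable M F" "integrable M G" "integrable M (\<lambda>\<xi>. of_bool (c \<le> G \<xi>) :: real)"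
    if "prob_space M" "sets M = sets Xi" "space M = conf UNIV" for M c
  proof -
    interpret prob_space M by fact
    have [measurable]: "F \<in> borel_measurable M" using F(1) that by (simp cong: measurable_cong_sets)
    show "integrable M F" by (rule integrable_const_bound[of _ b]) (auto simp: that b)
    then show "integrable M G" by (simp add: G_def[abs_def])
    have [measurable]: "G \<in> borel_measurable M" by (simp add: G_def[abs_def])
    show "integrable M (\<lambda>\<xi>. of_bool (c \<le> G \<xi>) :: real)"
      by (rule integrable_const_bound[of _ 1]) auto
  qed
  note int\<mu> = int[OF \<mu>.prob_space_axioms sets(1) space(1)]
  note int\<nu> = int[OF \<nu>.prob_space_axioms sets(2) space(2)]
  have level: "(\<integral>\<xi>. of_bool (c \<le> G \<xi>) \<partial>\<mu>) \<le> (\<integral>\<xi>. (of_bool (c \<le> G \<xi>) :: real) \<partial>\<nu>)" for c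
  proof -
    let ?A = "{\<xi> \<in> conf UNIV. c \<le> G \<xi>}"
    have "(\<lambda>\<xi>. G \<xi>) -` {c..} \<inter> space Xi \<in> sets Xi"
      by (rule measurable_sets[where A = borel]) (use F(1) in \<open>auto simp: G_def[abs_def]\<close>)
    then have A: "?A \<in> sets Xi" by (simp add: space_Xi vimage_def Int_def conj_commute)
    have eq: "(\<integral>\<xi>. of_bool (c \<le> G \<xi>) \<partial>M) = measure M ?A"
      if "sets M = sets Xi" "space M = conf UNIV" for M
    proof -
      have "(\<integral>\<xi>. of_bool (c \<le> G \<xi>) \<partial>M) = (\<integral>\<xi>. indicator ?A \<xi> \<partial>M)"
        using that by (intro Bochner_Integration.integral_cong) (auto simp: indicator_def)
      also have "\<dots> = measure M ?A" using that by (simp add: Int_absorb2)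
      finally show ?thesis .
    qed
    have "measure \<mu> ?A \<le> measure \<nu> ?A"
    proof (rule local_le_up_set[OF \<mu> \<nu> le A])
      fix \<xi> \<kappa> :: config assume *: "\<kappa> \<in> ?A" "\<xi> \<in> conf UNIV" "\<kappa> \<le> \<xi>"
      then have "F \<kappa> \<le> F \<xi>" by (intro mono_onD[OF F(3)]) (auto simp: space_Xi)
      then show "\<xi> \<in> ?A" using * by (auto simp: G_def)
    qed
    then show ?thesis by (simp add: eq sets space)
  qed
  have "(\<integral>\<xi>. G \<xi> \<partial>\<mu>) \<le> (\<integral>\<xi>. G \<xi> \<partial>\<nu>) + 2 * b / real (Suc N)" for N
  proof -
    define d where "d = 2 * b / real (Suc N)"
    have d: "0 < d" "d * real (Suc N) = 2 * b" using b by (simp_all add: d_def)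
    \<comment> \<open>\<open>D\<close> rounds \<open>G\<close> down to a multiple of \<open>d\<close>.\<close>
    define D where "D \<xi> = d * (\<Sum>j=1..Suc N. of_bool (d * real j \<le> G \<xi>))" for \<xi>
    have D: "D \<xi> \<le> G \<xi> \<and> G \<xi> \<le> D \<xi> + d" if "\<xi> \<in> conf UNIV" for \<xi>
    proof -
      have "0 \<le> G \<xi> / d" "G \<xi> / d \<le> real (Suc N)"
        using G[OF that] d by (auto simp: divide_simps mult.commute)
      note t = sum_thresholds[OF this]
      have "(\<Sum>j=1..Suc N. of_bool (real j \<le> G \<xi> / d)) = D \<xi> / d"
        using d by (simp add: D_def field_simps del: sum.cl_ivl_Suc of_nat_Suc)
      then show ?thesis using t d by (simp add: field_simps)
    qed
    have intD: "integrable \<mu> D" "integrable \<nu> D"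
      unfolding D_def[abs_def] by (intro integrable_mult_right Bochner_Integration.integrable_sum int\<mu> int\<nu>)+
    have "(\<integral>\<xi>. G \<xi> \<partial>\<mu>) \<le> (\<integral>\<xi>. D \<xi> + d \<partial>\<mu>)"
      using D by (intro integral_mono int\<mu> Bochner_Integration.integrable_add intD) (auto simp: space)
    also have "\<dots> = (\<integral>\<xi>. D \<xi> \<partial>\<mu>) + d" using intD by (simp add: \<mu>.prob_space)
    also have "(\<integral>\<xi>. D \<xi> \<partial>\<mu>) \<le> (\<integral>\<xi>. D \<xi> \<partial>\<nu>)"
    proof -
      have "(\<integral>\<xi>. D \<xi> \<partial>\<mu>) = d * (\<Sum>j=1..Suc N. \<integral>\<xi>. of_bool (d * real j \<le> G \<xi>) \<partial>\<mu>)"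
        unfolding D_def by (subst integral_mult_right_zero, subst Bochner_Integration.integral_sum) (auto intro: int\<mu>)
      also have "\<dots> \<le> d * (\<Sum>j=1..Suc N. \<integral>\<xi>. of_bool (d * real j \<le> G \<xi>) \<partial>\<nu>)"
        using d by (intro mult_left_mono sum_mono level) auto
      also have "\<dots> = (\<integral>\<xi>. D \<xi> \<partial>\<nu>)"
        unfolding D_def by (subst integral_mult_right_zero, subst Bochner_Integration.integral_sum) (auto intro: int\<nu>)
      finally show ?thesis .
    qed
    also have "(\<integral>\<xi>. D \<xi> \<partial>\<nu>) \<le> (\<integral>\<xi>. G \<xi> \<partial>\<nu>)"
      using D by (intro integral_mono int\<nu> intD) (auto simp: space)
    finally show ?thesis by (simp add: d_def)
  qed
  moreover have "(\<lambda>N. (\<integral>\<xi>. G \<xi> \<partial>\<nu>) + 2 * b / real (Suc N)) \<longlonglongrightarrow> (\<integral>\<xi>. G \<xi> \<partial>\<nu>) + 0"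
    by (intro tendsto_intros LIMSEQ_Suc lim_const_over_n)
  ultimately have "(\<integral>\<xi>. G \<xi> \<partial>\<mu>) \<le> (\<integral>\<xi>. G \<xi> \<partial>\<nu>)"
    by (intro LIMSEQ_le_const[where X = "\<lambda>N. (\<integral>\<xi>. G \<xi> \<partial>\<nu>) + 2 * b / real (Suc N)"]) auto
  then show "(\<integral>\<xi>. F \<xi> \<partial>\<mu>) \<le> (\<integral>\<xi>. F \<xi> \<partial>\<nu>)"
    using int\<mu>(1) int\<nu>(1) by (simp add: G_def \<mu>.prob_space \<nu>.prob_space)
qed

text \<open>The indicator of \<open>cyl (V n) \<sigma>\<close> is the difference of the increasing indicators of \<open>\<sigma> \<le> \<xi>\<close> and \<open>\<sigma> < \<xi>\<close> on \<open>V n\<close>.\<close>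

theorem stoch_le_antisym:
  assumes \<mu>: "prob_on_Xi \<mu>" and \<nu>: "prob_on_Xi \<nu>" and le: "\<mu> \<preceq>\<^sub>s \<nu>" "\<nu> \<preceq>\<^sub>s \<mu>"
  shows "\<mu> = \<nu>"
proof (rule prob_on_Xi_eqI[OF \<mu> \<nu>])
  fix n \<sigma> assume \<sigma>: "\<sigma> \<in> conf (V n)"
  interpret \<mu>: prob_space \<mu> using \<mu> by (simp add: prob_on_Xi_def)
  interpret \<nu>: prob_space \<nu> using \<nu> by (simp add: prob_on_Xi_def)
  have eq: "measure \<mu> {\<xi> \<in> space Xi. P (restrict \<xi> (V n))} = measure \<nu> {\<xi> \<in> space Xi. P (restrict \<xi> (V n))}"
    if P: "mono_on (conf (V n)) P" for P :: "config \<Rightarrow> bool"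
  proof -
    let ?F = "\<lambda>\<xi>. of_bool (P (restrict \<xi> (V n))) :: real"
    have "?F \<in> borel_measurable Xi"
      by (rule measurable_local[where f = "\<lambda>\<sigma>. of_bool (P \<sigma>)"]) auto
    moreover have "bounded (?F ` space Xi)" by (rule boundedI[of _ 1]) auto
    moreover have "mono_on (space Xi) ?F"
    proof (rule mono_onI)
      fix \<xi> \<xi>' assume *: "\<xi> \<in> space Xi" "\<xi>' \<in> space Xi" "\<xi> \<le> \<xi>'"
      have "restrict \<xi> (V n) \<le> restrict \<xi>' (V n)" using * by (auto simp: le_fun_def restrict_def)
      then have "P (restrict \<xi> (V n)) \<le> P (restrict \<xi>' (V n))"
        using * by (intro mono_onD[OF P]) (auto simp: space_Xi)
      then show "?F \<xi> \<le> ?F \<xi>'" by auto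
    qed
    ultimately have "(\<integral>\<xi>. ?F \<xi> \<partial>\<mu>) = (\<integral>\<xi>. ?F \<xi> \<partial>\<nu>)"
      using le unfolding stoch_le_def by (meson antisym)
    then show ?thesis by (simp add: measure_local(1) \<mu> \<nu>)
  qed
  let ?U = "{\<xi> \<in> space Xi. \<sigma> \<le> restrict \<xi> (V n)}" and ?U' = "{\<xi> \<in> space Xi. \<sigma> < restrict \<xi> (V n)}"
  have U: "?U \<in> sets Xi" "?U' \<in> sets Xi" using measure_local(2)[OF \<mu>] by blast+
  have cyl: "cyl (V n) \<sigma> = ?U - ?U'" by (auto simp: cyl_def less_le)
  have "measure \<mu> ?U = measure \<nu> ?U" by (rule eq) (auto intro!: mono_onI intro: order_trans)
  moreover have "measure \<mu> ?U' = measure \<nu> ?U'" by (rule eq) (auto intro!: mono_onI intro: order_less_le_trans)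
  moreover have "?U' \<subseteq> ?U" by auto
  ultimately show "measure \<mu> (cyl (V n) \<sigma>) = measure \<nu> (cyl (V n) \<sigma>)"
    unfolding cyl using U \<mu> \<nu>
    by (subst \<mu>.finite_measure_Diff, auto simp: prob_on_Xi_def)
       (subst \<nu>.finite_measure_Diff, auto simp: prob_on_Xi_def)
qed

section \<open>Weak convergence\<close>

lemma openin_Xi_cylinder:
  assumes U: "openin Xi_top U" and \<xi>: "\<xi> \<in> U"
  shows "\<exists>m. {\<xi>' \<in> conf UNIV. restrict \<xi>' (V m) = restrict \<xi> (V m)} \<subseteq> U"
proof -
  obtain X where X: "finite {x. X x \<noteq> topspace (discrete_topology (S x))}" "\<xi> \<in> Pi\<^sub>E UNIV X" "Pi\<^sub>E UNIV X \<subseteq> U"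
    using U \<xi> unfolding Xi_top_def openin_product_topology_alt by fastforce
  obtain m where m: "{x. X x \<noteq> S x} \<subseteq> V m"
    using X(1) finite_subset_V by auto
  show ?thesis
  proof (intro exI subsetI, elim CollectE conjE)
    fix \<xi>' assume *: "\<xi>' \<in> conf UNIV" "restrict \<xi>' (V m) = restrict \<xi> (V m)"
    have "\<xi>' x \<in> X x" for x
    proof (cases "x \<in> V m")
      case True
      then show ?thesis using fun_cong[OF *(2), of x] X(2) by (auto simp: PiE_iff)
    next
      case False
      then show ?thesis using m *(1) by (auto simp: conf_UNIV_iff)
    qed
    then show "\<xi>' \<in> U" using X(3) by auto
  qed
qed

text \<open>Uniform continuity by compactness: finitely many cylinder sets on which \<open>f\<close> varies by less than \<open>e\<close> cover the space.\<close>

lemma continuous_almost_local: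
  assumes f: "continuous_map Xi_top euclideanreal f" and e: "0 < e"
  obtains m where "\<And>\<xi> \<xi>'. \<xi> \<in> conf UNIV \<Longrightarrow> \<xi>' \<in> conf UNIV \<Longrightarrow>
    restrict \<xi> (V m) = restrict \<xi>' (V m) \<Longrightarrow> \<bar>f \<xi> - f \<xi>'\<bar> < e"
proof -
  have top: "topspace Xi_top = conf UNIV" by (simp add: topspace_Xi_top space_Xi)
  let ?O = "\<lambda>\<xi>. {\<xi>' \<in> conf UNIV. \<bar>f \<xi>' - f \<xi>\<bar> < e/2}"
  let ?cyl = "\<lambda>\<xi> m. {\<xi>' \<in> conf UNIV. restrict \<xi>' (V m) = restrict \<xi> (V m)}"
  have "\<exists>m. ?cyl \<xi> m \<subseteq> ?O \<xi>" if "\<xi> \<in> conf UNIV" for \<xi>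
  proof -
    have "openin Xi_top {\<xi>' \<in> topspace Xi_top. f \<xi>' \<in> ball (f \<xi>) (e/2)}"
      using f by (rule openin_continuous_map_preimage) simp
    then have O: "openin Xi_top (?O \<xi>)" by (simp add: top dist_real_def abs_minus_commute)
    have "\<xi> \<in> ?O \<xi>" using that e by simp
    with O show ?thesis by (rule openin_Xi_cylinder)
  qed
  then have "\<forall>\<xi>\<in>conf UNIV. \<exists>m. ?cyl \<xi> m \<subseteq> ?O \<xi>" by (rule ballI)
  from bchoice[OF this] obtain m where m: "\<forall>\<xi>\<in>conf UNIV. ?cyl \<xi> (m \<xi>) \<subseteq> ?O \<xi>" by (rule exE)
  have cyl_open: "openin Xi_top (?cyl \<xi> n)" if "\<xi> \<in> conf UNIV" for \<xi> n
  proof -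
    have "openin Xi_top (PiE UNIV (\<lambda>x. if x \<in> V n then {\<xi> x} else S x))"
      unfolding Xi_top_def using that finite_subset[of _ "V n"]
      by (subst openin_PiE_gen) (auto simp: conf_UNIV_iff)
    also have "PiE UNIV (\<lambda>x. if x \<in> V n then {\<xi> x} else S x) = ?cyl \<xi> n"
      using that by (auto simp: PiE_iff conf_UNIV_iff restrict_def fun_eq_iff split: if_splits)
    finally show ?thesis .
  qed
  have "compactin Xi_top (conf UNIV)"
    using compact_space_product_topology[of "\<lambda>x. discrete_topology (S x)" UNIV] top
    by (auto simp: Xi_top_def compact_space_def finite_imp_compactin_eq)
  moreover have "openin Xi_top U" if "U \<in> (\<lambda>\<xi>. ?cyl \<xi> (m \<xi>)) ` conf UNIV" for U
    using that cyl_open by (elim imageE) simp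
  moreover have "conf UNIV \<subseteq> (\<Union>\<xi>\<in>conf UNIV. ?cyl \<xi> (m \<xi>))" by auto
  ultimately have "\<exists>\<F>. finite \<F> \<and> \<F> \<subseteq> (\<lambda>\<xi>. ?cyl \<xi> (m \<xi>)) ` conf UNIV \<and> conf UNIV \<subseteq> \<Union>\<F>"
    by (rule compactinD)
  then obtain \<F> where \<F>: "finite \<F>" "\<F> \<subseteq> (\<lambda>\<xi>. ?cyl \<xi> (m \<xi>)) ` conf UNIV" "conf UNIV \<subseteq> \<Union>\<F>"
    by (elim exE conjE)
  obtain X where X: "finite X" "X \<subseteq> conf UNIV" "\<F> = (\<lambda>\<xi>. ?cyl \<xi> (m \<xi>)) ` X"
    using finite_subset_image[OF \<F>(1,2)] by blast
  show thesis
  proof (rule that[of "Max (m ` X)"])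
    fix \<xi> \<xi>' assume *: "\<xi> \<in> conf UNIV" "\<xi>' \<in> conf UNIV" "restrict \<xi> (V (Max (m ` X))) = restrict \<xi>' (V (Max (m ` X)))"
    obtain \<eta> where \<eta>: "\<eta> \<in> X" "\<xi> \<in> ?cyl \<eta> (m \<eta>)" using \<F>(3) X(3) *(1) by auto
    have "V (m \<eta>) \<subseteq> V (Max (m ` X))" using X \<eta> by (intro V_mono) auto
    then have "\<xi> x = \<xi>' x" if "x \<in> V (m \<eta>)" for x using that fun_cong[OF *(3), of x] by auto
    then have "restrict \<xi>' (V (m \<eta>)) = restrict \<xi> (V (m \<eta>))" by auto
    then have "\<xi>' \<in> ?cyl \<eta> (m \<eta>)" using \<eta>(2) *(2) by simp
    moreover have "?cyl \<eta> (m \<eta>) \<subseteq> ?O \<eta>" using m \<eta>(1) X(2) by (intro bspec[OF m]) auto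
    ultimately have "\<xi> \<in> ?O \<eta>" "\<xi>' \<in> ?O \<eta>" using \<eta>(2) by (auto simp only: subset_iff)
    then have "\<bar>f \<xi> - f \<eta>\<bar> < e/2" "\<bar>f \<xi>' - f \<eta>\<bar> < e/2" by simp_all
    then show "\<bar>f \<xi> - f \<xi>'\<bar> < e" by linarith
  qed
qed

text \<open>The filling used by \<open>bc_measure\<close>; it also serves to turn a function on \<open>Xi\<close> into a local one.\<close>

definition ext :: "nat \<Rightarrow> config \<Rightarrow> config \<Rightarrow> config" where
  "ext m \<zeta> \<sigma> = merge (V m) (- V m) (\<sigma>, \<zeta>)"

lemma ext_in_conf: "\<zeta> \<in> conf UNIV \<Longrightarrow> \<sigma> \<in> conf (V m) \<Longrightarrow> ext m \<zeta> \<sigma> \<in> conf UNIV"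
  by (auto simp: ext_def merge_def conf_def PiE_iff)

lemma restrict_ext: "\<sigma> \<in> conf (V m) \<Longrightarrow> restrict (ext m \<zeta> \<sigma>) (V m) = \<sigma>"
  by (auto simp: ext_def merge_def conf_def PiE_iff extensional_def restrict_def fun_eq_iff)

lemma continuous_measurable:
  assumes f: "continuous_map Xi_top euclideanreal f"
  shows "f \<in> borel_measurable Xi"
proof (rule borel_measurable_LIMSEQ_metric)
  let ?f = "\<lambda>m \<xi>. f (ext m xi_plus (restrict \<xi> (V m)))"
  have plus: "xi_plus \<in> conf UNIV" by (simp add: conf_UNIV_iff)
  show "?f m \<in> borel_measurable Xi" for m
    by (rule measurable_local[where f = "\<lambda>\<sigma>. f (ext m xi_plus \<sigma>)"]) auto
  show "(\<lambda>m. ?f m \<xi>) \<longlonglongrightarrow> f \<xi>" if "\<xi> \<in> space Xi" for \<xi>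
  proof (rule metric_LIMSEQ_I)
    fix e :: real assume "0 < e"
    then obtain m where m: "\<And>\<xi> \<xi>'. \<xi> \<in> conf UNIV \<Longrightarrow> \<xi>' \<in> conf UNIV \<Longrightarrow>
        restrict \<xi> (V m) = restrict \<xi>' (V m) \<Longrightarrow> \<bar>f \<xi> - f \<xi>'\<bar> < e"
      using continuous_almost_local[OF f] by blast
    have "dist (?f n \<xi>) (f \<xi>) < e" if "n \<ge> m" for n
      unfolding dist_real_def
    proof (rule m)
      show "restrict (ext n xi_plus (restrict \<xi> (V n))) (V m) = restrict \<xi> (V m)"
        using V_mono[OF that] by (auto simp: ext_def merge_def restrict_def fun_eq_iff)
    qed (use \<open>\<xi> \<in> space Xi\<close> plus in \<open>auto simp: space_Xi intro!: ext_in_conf\<close>)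
    then show "\<exists>no. \<forall>n\<ge>no. dist (?f n \<xi>) (f \<xi>) < e" by blast
  qed
qed

context ferromagnet
begin

lemma integral_bc_measure:
  assumes \<zeta>: "\<zeta> \<in> conf UNIV" and f: "f \<in> borel_measurable Xi"
  shows "(\<integral>\<xi>. f \<xi> \<partial>bc_measure J \<beta> \<zeta> n) = (\<Sum>\<sigma>\<in>conf (V n). (f (ext n \<zeta> \<sigma>) :: real) * law n (pinned \<zeta>) \<sigma>)"
proof -
  let ?A = "{\<sigma> \<in> conf (V n). \<forall>x\<in>W n. \<sigma> x = \<zeta> x}"
  let ?w = "\<lambda>\<sigma>. exp (- \<beta> * Ham J n \<sigma>)"
  have fin: "finite ?A" by simp
  have weight: "weight n (pinned \<zeta>) \<sigma> = (if \<sigma> \<in> ?A then ?w \<sigma> else 0)" if "\<sigma> \<in> conf (V n)" for \<sigma>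
    using that by (auto simp: weight_def pinned_def intro: prod_zero)
  have Z: "(\<Sum>\<sigma>\<in>conf (V n). weight n (pinned \<zeta>) \<sigma>) = (\<Sum>\<sigma>\<in>?A. ?w \<sigma>)"
    by (rule sum.mono_neutral_cong_right) (auto simp: weight)
  have meas: "ext n \<zeta> \<in> prob_propto ?A ?w \<rightarrow>\<^sub>M Xi"
    using ext_in_conf[OF \<zeta>] by (auto simp: prob_propto_def measurable_point_measure_eq1 space_Xi)
  have "(\<integral>\<xi>. f \<xi> \<partial>bc_measure J \<beta> \<zeta> n) = (\<integral>\<sigma>. f (ext n \<zeta> \<sigma>) \<partial>prob_propto ?A ?w)"
    unfolding bc_measure_def ext_def[symmetric] using meas f by (rule integral_distr)
  also have "\<dots> = (\<Sum>\<sigma>\<in>?A. ?w \<sigma> / (\<Sum>\<tau>\<in>?A. ?w \<tau>) * f (ext n \<zeta> \<sigma>))"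
    unfolding prob_propto_def
    by (subst lebesgue_integral_point_measure_finite[OF fin]) (auto intro!: divide_nonneg_nonneg sum_nonneg)
  also have "\<dots> = (\<Sum>\<sigma>\<in>conf (V n). f (ext n \<zeta> \<sigma>) * law n (pinned \<zeta>) \<sigma>)"
    unfolding law_def Z by (rule sum.mono_neutral_cong_left) (auto simp: weight)
  finally show ?thesis .
qed

theorem weak_limit_bc_measure:
  assumes \<zeta>: "\<zeta> \<in> conf UNIV" and \<mu>: "prob_on_Xi \<mu>"
    and conv: "\<And>m \<sigma>. \<sigma> \<in> conf (V m) \<Longrightarrow> (\<lambda>k. law m ((collapse ^^ k) (pinned \<zeta>)) \<sigma>) \<longlonglongrightarrow> measure \<mu> (cyl (V m) \<sigma>)"
  shows "weak_limit (bc_measure J \<beta> \<zeta>) \<mu>"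
  unfolding weak_limit_def
proof (intro conjI allI impI \<mu>, elim conjE)
  fix f assume f: "continuous_map Xi_top euclideanreal f" and bdd: "bounded (f ` topspace Xi_top)"
  interpret \<mu>: prob_space \<mu> using \<mu> by (simp add: prob_on_Xi_def)
  have f_meas: "f \<in> borel_measurable Xi" using f by (rule continuous_measurable)
  obtain b where b: "\<And>\<xi>. \<xi> \<in> conf UNIV \<Longrightarrow> \<bar>f \<xi>\<bar> \<le> b"
    using bdd unfolding bounded_iff by (auto simp: topspace_Xi_top space_Xi)
  have int_f: "integrable \<mu> f"
    by (rule \<mu>.integrable_const_bound[of _ b])
       (use f_meas b prob_on_Xi_space[OF \<mu>] prob_on_Xi_sets[OF \<mu>] in \<open>auto cong: measurable_cong_sets\<close>)
  show "(\<lambda>n. \<integral>\<xi>. f \<xi> \<partial>bc_measure J \<beta> \<zeta> n) \<longlonglongrightarrow> (\<integral>\<xi>. f \<xi> \<partial>\<mu>)"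
  proof (rule metric_LIMSEQ_I)
    fix e :: real assume e: "0 < e"
    obtain m where m: "\<And>\<xi> \<xi>'. \<xi> \<in> conf UNIV \<Longrightarrow> \<xi>' \<in> conf UNIV \<Longrightarrow>
        restrict \<xi> (V m) = restrict \<xi>' (V m) \<Longrightarrow> \<bar>f \<xi> - f \<xi>'\<bar> < e/3"
      using continuous_almost_local[OF f, of "e/3"] e by auto
    let ?g = "\<lambda>\<sigma>. f (ext m \<zeta> \<sigma>)"
    have near: "\<bar>f \<xi> - ?g (restrict \<xi> (V m))\<bar> \<le> e/3" if "\<xi> \<in> conf UNIV" for \<xi>
      using that m[of \<xi> "ext m \<zeta> (restrict \<xi> (V m))"]
      by (simp add: ext_in_conf[OF \<zeta>] restrict_ext less_imp_le)
    \<comment> \<open>Replacing \<open>f\<close> by the local function \<open>f \<circ> ext m \<zeta>\<close> costs \<open>e/3\<close> both in the limit and, below, in each finite volume.\<close>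
    have 1: "\<bar>(\<integral>\<xi>. f \<xi> \<partial>\<mu>) - (\<Sum>\<sigma>\<in>conf (V m). ?g \<sigma> * measure \<mu> (cyl (V m) \<sigma>))\<bar> \<le> e/3"
    proof -
      have int_g: "integrable \<mu> (\<lambda>\<xi>. ?g (restrict \<xi> (V m)))"
      proof (rule \<mu>.integrable_const_bound[of _ b])
        show "(\<lambda>\<xi>. ?g (restrict \<xi> (V m))) \<in> borel_measurable \<mu>"
          using measurable_local[of "V m" UNIV ?g] prob_on_Xi_sets[OF \<mu>] by (simp cong: measurable_cong_sets)
      qed (use b prob_on_Xi_space[OF \<mu>] in \<open>auto simp: ext_in_conf[OF \<zeta>]\<close>)
      have "\<bar>(\<integral>\<xi>. f \<xi> \<partial>\<mu>) - (\<integral>\<xi>. ?g (restrict \<xi> (V m)) \<partial>\<mu>)\<bar> = \<bar>\<integral>\<xi>. f \<xi> - ?g (restrict \<xi> (V m)) \<partial>\<mu>\<bar>"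
        using int_f int_g by simp
      also have "\<dots> \<le> (\<integral>\<xi>. \<bar>f \<xi> - ?g (restrict \<xi> (V m))\<bar> \<partial>\<mu>)" by (rule integral_abs_bound)
      also have "\<dots> \<le> (\<integral>\<xi>. e/3 \<partial>\<mu>)"
        using int_f int_g near prob_on_Xi_space[OF \<mu>] by (intro integral_mono) auto
      finally show ?thesis by (simp add: \<mu>.prob_space integral_local[OF \<mu> finite_V, of ?g])
    qed
    have 2: "\<bar>(\<integral>\<xi>. f \<xi> \<partial>bc_measure J \<beta> \<zeta> (m + k)) - (\<Sum>\<sigma>\<in>conf (V m). ?g \<sigma> * law m ((collapse ^^ k) (pinned \<zeta>)) \<sigma>)\<bar> \<le> e/3" for k
    proof -
      note message = message_pinned[OF \<zeta>]
      let ?n = "m + k"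
      have "(\<integral>\<xi>. f \<xi> \<partial>bc_measure J \<beta> \<zeta> ?n) - (\<Sum>\<sigma>\<in>conf (V m). ?g \<sigma> * law m ((collapse ^^ k) (pinned \<zeta>)) \<sigma>) =
          (\<Sum>\<tau>\<in>conf (V ?n). (f (ext ?n \<zeta> \<tau>) - ?g (restrict \<tau> (V m))) * law ?n (pinned \<zeta>) \<tau>)"
        by (simp add: integral_bc_measure[OF \<zeta> f_meas] sum_law_marginal[symmetric] sum_subtractf left_diff_distrib)
      also have "\<bar>\<dots>\<bar> \<le> (\<Sum>\<tau>\<in>conf (V ?n). e/3 * law ?n (pinned \<zeta>) \<tau>)"
      proof (rule order_trans[OF sum_abs sum_mono])
        fix \<tau> assume \<tau>: "\<tau> \<in> conf (V ?n)"
        have "restrict (ext ?n \<zeta> \<tau>) (V m) = restrict \<tau> (V m)"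
          using V_mono[of m ?n] by (auto simp: ext_def merge_def restrict_def fun_eq_iff)
        then have "\<bar>f (ext ?n \<zeta> \<tau>) - ?g (restrict \<tau> (V m))\<bar> \<le> e/3"
          using near[OF ext_in_conf[OF \<zeta> \<tau>]] by simp
        then show "\<bar>(f (ext ?n \<zeta> \<tau>) - ?g (restrict \<tau> (V m))) * law ?n (pinned \<zeta>) \<tau>\<bar> \<le> e/3 * law ?n (pinned \<zeta>) \<tau>"
          unfolding abs_mult abs_of_nonneg[OF law_nonneg[OF message \<tau>]]
          by (rule mult_right_mono) (rule law_nonneg[OF message \<tau>])
      qed
      also have "\<dots> = e/3" using sum_law[OF message, of ?n] by (simp only: sum_distrib_left[symmetric] mult_1_right)
      finally show ?thesis .
    qed
    have "(\<lambda>k. \<Sum>\<sigma>\<in>conf (V m). ?g \<sigma> * law m ((collapse ^^ k) (pinned \<zeta>)) \<sigma>) \<longlonglongrightarrow>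
        (\<Sum>\<sigma>\<in>conf (V m). ?g \<sigma> * measure \<mu> (cyl (V m) \<sigma>))"
      by (intro tendsto_sum tendsto_mult tendsto_const conv)
    from metric_LIMSEQ_D[OF this, of "e/3"] e obtain N where N: "\<And>k. k \<ge> N \<Longrightarrow>
        \<bar>(\<Sum>\<sigma>\<in>conf (V m). ?g \<sigma> * law m ((collapse ^^ k) (pinned \<zeta>)) \<sigma>) - (\<Sum>\<sigma>\<in>conf (V m). ?g \<sigma> * measure \<mu> (cyl (V m) \<sigma>))\<bar> < e/3"
      by (auto simp: dist_real_def)
    have "dist (\<integral>\<xi>. f \<xi> \<partial>bc_measure J \<beta> \<zeta> n) (\<integral>\<xi>. f \<xi> \<partial>\<mu>) < e" if "n \<ge> m + N" for n
    proof -
      from that have n: "m + (n - m) = n" "n - m \<ge> N" by auto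
      show ?thesis using 1 2[of "n - m"] N[OF n(2)] unfolding dist_real_def n(1) by linarith
    qed
    then show "\<exists>no. \<forall>n\<ge>no. dist (\<integral>\<xi>. f \<xi> \<partial>bc_measure J \<beta> \<zeta> n) (\<integral>\<xi>. f \<xi> \<partial>\<mu>) < e" by blast
  qed
qed

end

section \<open>Splitting measures are Gibbs measures\<close>

lemma touching_subset: "\<Lambda> \<subseteq> V n \<Longrightarrow> touching \<Lambda> \<subseteq> V (Suc n) - {[]}"
  by (auto simp: touching_def V_eq)

lemma touching_tl: "y \<in> touching \<Lambda> \<Longrightarrow> \<Lambda> \<subseteq> V n \<Longrightarrow> tl y \<in> V (Suc n)"
  by (auto simp: touching_def V_eq)

lemma emeasure_gibbs_kernel:
  assumes "finite \<Lambda>" "A \<subseteq> conf \<Lambda>"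
  shows "emeasure (gibbs_kernel J \<beta> \<Lambda> \<eta>) A =
    ennreal ((\<Sum>\<sigma>\<in>A. exp (\<beta> * J * (\<Sum>y\<in>touching \<Lambda>. merge \<Lambda> (- \<Lambda>) (\<sigma>, \<eta>) (tl y) * merge \<Lambda> (- \<Lambda>) (\<sigma>, \<eta>) y))) /
      (\<Sum>\<sigma>\<in>conf \<Lambda>. exp (\<beta> * J * (\<Sum>y\<in>touching \<Lambda>. merge \<Lambda> (- \<Lambda>) (\<sigma>, \<eta>) (tl y) * merge \<Lambda> (- \<Lambda>) (\<sigma>, \<eta>) y))))"
  unfolding gibbs_kernel_eq prob_propto_def
  using assms finite_subset[OF assms(2)]
  by (subst emeasure_point_measure_finite) (auto simp: sum_divide_distrib intro!: sum_ennreal divide_nonneg_nonneg sum_nonneg)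

lemma gibbs_kernel_cong:
  assumes "\<Lambda> \<subseteq> V n" "\<And>x. x \<in> V (Suc n) - \<Lambda> \<Longrightarrow> \<eta> x = \<eta>' x"
  shows "gibbs_kernel J \<beta> \<Lambda> \<eta> = gibbs_kernel J \<beta> \<Lambda> \<eta>'"
proof -
  have m: "merge \<Lambda> (- \<Lambda>) (\<sigma>, \<eta>) x = merge \<Lambda> (- \<Lambda>) (\<sigma>, \<eta>') x" if "x \<in> V (Suc n)" for x \<sigma>
    using that assms(2) by (auto simp: merge_def)
  have "(\<Sum>y\<in>touching \<Lambda>. merge \<Lambda> (- \<Lambda>) (\<sigma>, \<eta>) (tl y) * merge \<Lambda> (- \<Lambda>) (\<sigma>, \<eta>) y) =
      (\<Sum>y\<in>touching \<Lambda>. merge \<Lambda> (- \<Lambda>) (\<sigma>, \<eta>') (tl y) * merge \<Lambda> (- \<Lambda>) (\<sigma>, \<eta>') y)" for \<sigma>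
  proof (intro sum.cong refl)
    fix y assume "y \<in> touching \<Lambda>"
    then have "y \<in> V (Suc n)" "tl y \<in> V (Suc n)"
      using touching_subset[OF assms(1)] touching_tl[OF _ assms(1)] by auto
    then show "merge \<Lambda> (- \<Lambda>) (\<sigma>, \<eta>) (tl y) * merge \<Lambda> (- \<Lambda>) (\<sigma>, \<eta>) y =
      merge \<Lambda> (- \<Lambda>) (\<sigma>, \<eta>') (tl y) * merge \<Lambda> (- \<Lambda>) (\<sigma>, \<eta>') y" by (simp only: m)
  qed
  then show ?thesis unfolding gibbs_kernel_eq by simp
qed

context ferromagnet
begin

text \<open>Let \<open>\<Lambda> \<subseteq> V n\<close>, so that no spin of \<open>\<Lambda>\<close> lies on the boundary \<open>W (Suc n)\<close>. Then the weight is the product of the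
Gibbs factor of \<open>\<Lambda>\<close> and a factor that only sees the spins outside \<open>\<Lambda>\<close>.\<close>

lemma mu_h_factor:
  assumes \<Lambda>: "\<Lambda> \<subseteq> V n"
  shows "mu_h J \<beta> h (Suc n) (merge \<Lambda> (V (Suc n) - \<Lambda>) (\<sigma>, \<eta>)) =
    exp (\<beta> * J * (\<Sum>y\<in>touching \<Lambda>. merge \<Lambda> (- \<Lambda>) (\<sigma>, \<eta>) (tl y) * merge \<Lambda> (- \<Lambda>) (\<sigma>, \<eta>) y)) *
    (exp (\<beta> * J * (\<Sum>y\<in>V (Suc n) - {[]} - touching \<Lambda>. \<eta> (tl y) * \<eta> y) + (\<Sum>x\<in>W (Suc n). h x (\<eta> x))) /
      (\<Sum>\<tau>\<in>conf (V (Suc n)). mu_h_weight J \<beta> h (Suc n) \<tau>))"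
proof -
  let ?\<tau> = "merge \<Lambda> (V (Suc n) - \<Lambda>) (\<sigma>, \<eta>)" and ?\<zeta> = "merge \<Lambda> (- \<Lambda>) (\<sigma>, \<eta>)"
  have eq: "?\<tau> x = ?\<zeta> x" if "x \<in> V (Suc n)" for x using that by (simp add: merge_def)
  have tl: "tl y \<in> V (Suc n)" if "y \<in> V (Suc n)" for y using that by (simp add: V_eq)
  have "(\<Sum>y\<in>V (Suc n) - {[]}. ?\<tau> (tl y) * ?\<tau> y) = (\<Sum>y\<in>V (Suc n) - {[]}. ?\<zeta> (tl y) * ?\<zeta> y)"
  proof (intro sum.cong refl)
    fix y assume "y \<in> V (Suc n) - {[]}"
    then have "y \<in> V (Suc n)" "tl y \<in> V (Suc n)" using tl by auto
    then show "?\<tau> (tl y) * ?\<tau> y = ?\<zeta> (tl y) * ?\<zeta> y" by (simp only: eq)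
  qed
  also have "\<dots> = (\<Sum>y\<in>V (Suc n) - {[]} - touching \<Lambda>. ?\<zeta> (tl y) * ?\<zeta> y) + (\<Sum>y\<in>touching \<Lambda>. ?\<zeta> (tl y) * ?\<zeta> y)"
    using touching_subset[OF \<Lambda>] by (intro sum.subset_diff) auto
  also have "(\<Sum>y\<in>V (Suc n) - {[]} - touching \<Lambda>. ?\<zeta> (tl y) * ?\<zeta> y) =
      (\<Sum>y\<in>V (Suc n) - {[]} - touching \<Lambda>. \<eta> (tl y) * \<eta> y)"
    by (intro sum.cong) (auto simp: touching_def merge_def)
  finally have H: "- \<beta> * Ham J (Suc n) ?\<tau> = \<beta> * J * (\<Sum>y\<in>touching \<Lambda>. ?\<zeta> (tl y) * ?\<zeta> y) +
      \<beta> * J * (\<Sum>y\<in>V (Suc n) - {[]} - touching \<Lambda>. \<eta> (tl y) * \<eta> y)"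
    unfolding Ham_eq by (simp add: algebra_simps)
  have W: "(\<Sum>x\<in>W (Suc n). h x (?\<tau> x)) = (\<Sum>x\<in>W (Suc n). h x (\<eta> x))"
  proof (intro sum.cong refl)
    fix x assume "x \<in> W (Suc n)"
    then have "x \<in> V (Suc n)" "x \<notin> \<Lambda>" using \<Lambda> by (auto simp: V_eq W_eq)
    then show "h x (?\<tau> x) = h x (\<eta> x)" by (simp add: merge_def)
  qed
  show ?thesis
    unfolding mu_h_def mu_h_weight_def[of _ _ _ _ ?\<tau>] H W by (simp only: exp_add mult.assoc times_divide_eq_right)
qed

text \<open>For fixed \<open>A\<close> both sides of the DLR equation are finite measures in \<open>B\<close>, so it is enough to compare them on
boxes that constrain finitely many spins. There both are finite sums over configurations on some
\<open>V (Suc n)\<close>, and the factorisation of the weight makes the outer factor cancel in the conditional probabilities.\<close>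

theorem gibbs_measure_of_mu_h:
  assumes \<mu>: "prob_on_Xi \<mu>"
    and marg: "\<And>n \<sigma>. \<sigma> \<in> conf (V n) \<Longrightarrow> measure \<mu> (cyl (V n) \<sigma>) = mu_h J \<beta> h n \<sigma>"
  shows "gibbs_measure J \<beta> \<mu>"
  unfolding gibbs_measure_def
proof (intro conjI allI impI ballI \<mu>)
  fix \<Lambda> :: "vertex set" and A B
  assume fin: "finite \<Lambda>" and "A \<in> sets (conf_space \<Lambda>)" and B: "B \<in> sets (conf_space (- \<Lambda>))"
  then have A: "A \<subseteq> conf \<Lambda>" by (simp add: sets_conf_space)
  interpret \<mu>: prob_space \<mu> using \<mu> by (simp add: prob_on_Xi_def)
  note sets = prob_on_Xi_sets[OF \<mu>] and space = prob_on_Xi_space[OF \<mu>]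
  obtain n0 where n0: "\<Lambda> \<subseteq> V n0" using fin by (rule finite_subset_V)
  define K where "K \<eta> = emeasure (gibbs_kernel J \<beta> \<Lambda> \<eta>) A" for \<eta>
  have K_cong: "K (restrict \<eta> \<Delta>) = K \<eta>" if "V (Suc n0) - \<Lambda> \<subseteq> \<Delta>" for \<eta> \<Delta>
    unfolding K_def using that by (intro arg_cong2[of _ _ _ _ emeasure] gibbs_kernel_cong[OF n0]) auto
  have r: "(\<lambda>\<xi>. restrict \<xi> (- \<Lambda>)) \<in> \<mu> \<rightarrow>\<^sub>M conf_space (- \<Lambda>)"
    using measurable_restrict_conf[of "- \<Lambda>" UNIV] sets by (simp cong: measurable_cong_sets)
  have K_meas: "K \<in> borel_measurable (conf_space (- \<Lambda>))"
  proof -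
    have "(\<lambda>\<eta>. K (restrict \<eta> (V (Suc n0) - \<Lambda>))) \<in> borel_measurable (conf_space (- \<Lambda>))"
      by (rule measurable_local) auto
    then show ?thesis by (simp only: K_cong order_refl)
  qed
  define E where "E = {\<xi> \<in> space Xi. restrict \<xi> \<Lambda> \<in> A}"
  have E: "E \<in> sets \<mu>"
    using measurable_sets[OF measurable_restrict_conf[of \<Lambda> UNIV], of A] A sets_conf_space[OF fin] sets
    by (auto simp: E_def vimage_def Int_def conj_commute)
  \<comment> \<open>The two sides of the DLR equation as measures in \<open>B\<close>.\<close>
  define \<nu>1 where "\<nu>1 = distr (density \<mu> (indicator E)) (conf_space (- \<Lambda>)) (\<lambda>\<xi>. restrict \<xi> (- \<Lambda>))"
  define \<nu>2 where "\<nu>2 = density (distr \<mu> (conf_space (- \<Lambda>)) (\<lambda>\<xi>. restrict \<xi> (- \<Lambda>))) K"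
  have \<nu>1: "emeasure \<nu>1 C = (\<integral>\<^sup>+\<xi>. indicator E \<xi> * indicator C (restrict \<xi> (- \<Lambda>)) \<partial>\<mu>)"
    if C: "C \<in> sets (conf_space (- \<Lambda>))" for C
  proof -
    have "emeasure \<nu>1 C = emeasure (density \<mu> (indicator E)) ((\<lambda>\<xi>. restrict \<xi> (- \<Lambda>)) -` C \<inter> space \<mu>)"
      unfolding \<nu>1_def using r C by (subst emeasure_distr) auto
    also have "\<dots> = (\<integral>\<^sup>+\<xi>. indicator E \<xi> * indicator ((\<lambda>\<xi>. restrict \<xi> (- \<Lambda>)) -` C \<inter> space \<mu>) \<xi> \<partial>\<mu>)"
      using E measurable_sets[OF r C] by (intro emeasure_density) auto
    also have "\<dots> = (\<integral>\<^sup>+\<xi>. indicator E \<xi> * indicator C (restrict \<xi> (- \<Lambda>)) \<partial>\<mu>)"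
      by (intro nn_integral_cong) (auto simp: indicator_def)
    finally show ?thesis .
  qed
  have \<nu>2: "emeasure \<nu>2 C = (\<integral>\<^sup>+\<xi>. K (restrict \<xi> (- \<Lambda>)) * indicator C (restrict \<xi> (- \<Lambda>)) \<partial>\<mu>)"
    if C: "C \<in> sets (conf_space (- \<Lambda>))" for C
  proof -
    have "emeasure \<nu>2 C = (\<integral>\<^sup>+\<eta>. K \<eta> * indicator C \<eta> \<partial>distr \<mu> (conf_space (- \<Lambda>)) (\<lambda>\<xi>. restrict \<xi> (- \<Lambda>)))"
      unfolding \<nu>2_def using K_meas C by (intro emeasure_density) (auto cong: measurable_cong_sets)
    also have "\<dots> = (\<integral>\<^sup>+\<xi>. K (restrict \<xi> (- \<Lambda>)) * indicator C (restrict \<xi> (- \<Lambda>)) \<partial>\<mu>)"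
      using r K_meas C by (intro nn_integral_distr) auto
    finally show ?thesis .
  qed
  have "\<nu>1 = \<nu>2"
  proof (rule measure_eqI_PiM_infinite[of _ "- \<Lambda>" "\<lambda>x. count_space (S x)"])
    fix D :: "vertex \<Rightarrow> real set" and I :: "vertex set" assume I: "finite I" "I \<subseteq> - \<Lambda>"
    let ?C = "prod_emb (- \<Lambda>) (\<lambda>x. count_space (S x)) I (Pi\<^sub>E I D)"
    assume "\<And>x. x \<in> I \<Longrightarrow> D x \<in> sets (count_space (S x))"
    with I have C: "?C \<in> sets (conf_space (- \<Lambda>))" unfolding conf_space_def by (intro sets_PiM_I) auto
    obtain n1 where n1: "I \<subseteq> V n1" using I(1) by (rule finite_subset_V)
    define n where "n = max n0 n1"
    have \<Lambda>n: "\<Lambda> \<subseteq> V n" and In: "I \<subseteq> V (Suc n)"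
      by (rule order_trans[OF n0 V_mono], simp add: n_def) (rule order_trans[OF n1 V_mono], simp add: n_def)
    let ?\<Delta> = "V (Suc n) - \<Lambda>"
    let ?c = "\<lambda>\<tau>. of_bool (\<forall>x\<in>I. \<tau> x \<in> D x) :: ennreal"
    have C_ind: "indicator ?C (restrict \<xi> (- \<Lambda>)) = ?c (restrict \<xi> (V (Suc n)))" if "\<xi> \<in> space \<mu>" for \<xi>
      using that I(2) In
      by (auto simp: indicator_def prod_emb_def space_PiM space conf_def PiE_iff subset_iff)
    have E_ind: "indicator E \<xi> = (of_bool (restrict (restrict \<xi> (V (Suc n))) \<Lambda> \<in> A) :: ennreal)" if "\<xi> \<in> space \<mu>" for \<xi>
    proof -
      have "restrict (restrict \<xi> (V (Suc n))) \<Lambda> = restrict \<xi> \<Lambda>"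
        using \<Lambda>n V_mono[of n "Suc n"] by (auto simp: restrict_def fun_eq_iff)
      then show ?thesis using that by (simp add: E_def space space_Xi indicator_def)
    qed
    have K_ind: "K (restrict \<xi> (- \<Lambda>)) = K (restrict \<xi> (V (Suc n)))" for \<xi>
    proof -
      have "V (Suc n0) - \<Lambda> \<subseteq> - \<Lambda>" "V (Suc n0) - \<Lambda> \<subseteq> V (Suc n)" by (auto simp: V_eq n_def)
      then show ?thesis by (simp only: K_cong)
    qed
    let ?\<rho> = "\<lambda>\<eta>. exp (\<beta> * J * (\<Sum>y\<in>V (Suc n) - {[]} - touching \<Lambda>. \<eta> (tl y) * \<eta> y) + (\<Sum>x\<in>W (Suc n). h x (\<eta> x))) /
      (\<Sum>\<tau>\<in>conf (V (Suc n)). mu_h_weight J \<beta> h (Suc n) \<tau>)"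
    let ?w = "\<lambda>\<eta> \<sigma>. exp (\<beta> * J * (\<Sum>y\<in>touching \<Lambda>. merge \<Lambda> (- \<Lambda>) (\<sigma>, \<eta>) (tl y) * merge \<Lambda> (- \<Lambda>) (\<sigma>, \<eta>) y))"
    have \<rho>: "0 \<le> ?\<rho> \<eta>" for \<eta>
      by (intro divide_nonneg_nonneg sum_nonneg) (simp_all add: mu_h_weight_def)
    have w\<rho>: "0 \<le> ?w \<eta> \<sigma> * ?\<rho> \<eta>" for \<eta> \<sigma>
      by (rule mult_nonneg_nonneg[OF exp_ge_zero \<rho>])
    have sum_w\<rho>: "(\<Sum>\<sigma>\<in>X. ennreal (?w \<eta> \<sigma> * ?\<rho> \<eta>)) = ennreal ((\<Sum>\<sigma>\<in>X. ?w \<eta> \<sigma>) * ?\<rho> \<eta>)" for \<eta> X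
      unfolding sum_distrib_right by (rule sum_ennreal) (rule w\<rho>)
    have split: "V (Suc n) = \<Lambda> \<union> ?\<Delta>" using \<Lambda>n V_mono[of n "Suc n"] by auto
    have local: "(\<integral>\<^sup>+\<xi>. f (restrict \<xi> (V (Suc n))) \<partial>\<mu>) =
        (\<Sum>\<eta>\<in>conf ?\<Delta>. \<Sum>\<sigma>\<in>conf \<Lambda>. f (merge \<Lambda> ?\<Delta> (\<sigma>, \<eta>)) * ennreal (?w \<eta> \<sigma> * ?\<rho> \<eta>))"
      for f :: "config \<Rightarrow> ennreal"
    proof -
      have "(\<integral>\<^sup>+\<xi>. f (restrict \<xi> (V (Suc n))) \<partial>\<mu>) =
          (\<Sum>\<tau>\<in>conf (V (Suc n)). f \<tau> * ennreal (mu_h J \<beta> h (Suc n) \<tau>))"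
        by (simp add: nn_integral_local[OF sets finite_V] \<mu>.emeasure_eq_measure marg)
      also have "\<dots> = (\<Sum>\<sigma>\<in>conf \<Lambda>. \<Sum>\<eta>\<in>conf ?\<Delta>. f (merge \<Lambda> ?\<Delta> (\<sigma>, \<eta>)) * ennreal (?w \<eta> \<sigma> * ?\<rho> \<eta>))"
        unfolding mu_h_factor[OF \<Lambda>n, symmetric]
        by (subst (1) split, subst sum_conf_Un) auto
      finally show ?thesis by (subst sum.swap) simp
    qed
    have "emeasure \<nu>1 ?C = (\<integral>\<^sup>+\<xi>. of_bool (restrict (restrict \<xi> (V (Suc n))) \<Lambda> \<in> A) * ?c (restrict \<xi> (V (Suc n))) \<partial>\<mu>)"
      unfolding \<nu>1[OF C] by (rule nn_integral_cong) (simp only: C_ind E_ind)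
    also have "\<dots> = (\<Sum>\<eta>\<in>conf ?\<Delta>. \<Sum>\<sigma>\<in>conf \<Lambda>. of_bool (restrict (merge \<Lambda> ?\<Delta> (\<sigma>, \<eta>)) \<Lambda> \<in> A) * ?c (merge \<Lambda> ?\<Delta> (\<sigma>, \<eta>)) * ennreal (?w \<eta> \<sigma> * ?\<rho> \<eta>))"
      by (rule local)
    also have "\<dots> = (\<Sum>\<eta>\<in>conf ?\<Delta>. \<Sum>\<sigma>\<in>conf \<Lambda>. K (merge \<Lambda> ?\<Delta> (\<sigma>, \<eta>)) * ?c (merge \<Lambda> ?\<Delta> (\<sigma>, \<eta>)) * ennreal (?w \<eta> \<sigma> * ?\<rho> \<eta>))"
    proof (rule sum.cong[OF refl])
      fix \<eta> assume \<eta>: "\<eta> \<in> conf ?\<Delta>"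
      have c: "?c (merge \<Lambda> ?\<Delta> (\<sigma>, \<eta>)) = ?c \<eta>" for \<sigma>
        using I(2) In by (auto simp: merge_def subset_iff)
      have rA: "restrict \<sigma> \<Lambda> = \<sigma>" if "\<sigma> \<in> conf \<Lambda>" for \<sigma>
        using that by (auto simp: conf_def PiE_restrict)
      have K: "K (merge \<Lambda> ?\<Delta> (\<sigma>, \<eta>)) = ennreal ((\<Sum>\<sigma>\<in>A. ?w \<eta> \<sigma>) / (\<Sum>\<sigma>\<in>conf \<Lambda>. ?w \<eta> \<sigma>))" for \<sigma>
      proof -
        have "K (merge \<Lambda> ?\<Delta> (\<sigma>, \<eta>)) = K \<eta>"
          unfolding K_def by (intro arg_cong2[of _ _ _ _ emeasure] gibbs_kernel_cong[OF \<Lambda>n]) (auto simp: merge_def)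
        then show ?thesis unfolding K_def emeasure_gibbs_kernel[OF fin A] .
      qed
      \<comment> \<open>The remaining steps multiply and divide by the normalisation of the kernel.\<close>
      have Z: "0 < (\<Sum>\<sigma>\<in>conf \<Lambda>. ?w \<eta> \<sigma>)"
        using fin conf_nonempty by (intro sum_pos) auto
      have "(\<Sum>\<sigma>\<in>conf \<Lambda>. of_bool (restrict (merge \<Lambda> ?\<Delta> (\<sigma>, \<eta>)) \<Lambda> \<in> A) * ?c (merge \<Lambda> ?\<Delta> (\<sigma>, \<eta>)) * ennreal (?w \<eta> \<sigma> * ?\<rho> \<eta>)) =
          (\<Sum>\<sigma>\<in>A. ?c \<eta> * ennreal (?w \<eta> \<sigma> * ?\<rho> \<eta>))"
        using A fin by (intro sum.mono_neutral_cong_right) (auto simp: c rA subset_iff)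
      also have "\<dots> = ?c \<eta> * ennreal ((\<Sum>\<sigma>\<in>A. ?w \<eta> \<sigma>) * ?\<rho> \<eta>)"
        by (simp only: sum_distrib_left[symmetric] sum_w\<rho>)
      also have "(\<Sum>\<sigma>\<in>A. ?w \<eta> \<sigma>) * ?\<rho> \<eta> = (\<Sum>\<sigma>\<in>A. ?w \<eta> \<sigma>) / (\<Sum>\<sigma>\<in>conf \<Lambda>. ?w \<eta> \<sigma>) * ((\<Sum>\<sigma>\<in>conf \<Lambda>. ?w \<eta> \<sigma>) * ?\<rho> \<eta>)"
        using Z by simp
      also have "?c \<eta> * ennreal \<dots> = ?c \<eta> * (ennreal ((\<Sum>\<sigma>\<in>A. ?w \<eta> \<sigma>) / (\<Sum>\<sigma>\<in>conf \<Lambda>. ?w \<eta> \<sigma>)) *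
          (\<Sum>\<sigma>\<in>conf \<Lambda>. ennreal (?w \<eta> \<sigma> * ?\<rho> \<eta>)))"
      proof -
        have "0 \<le> (\<Sum>\<sigma>\<in>A. ?w \<eta> \<sigma>) / (\<Sum>\<sigma>\<in>conf \<Lambda>. ?w \<eta> \<sigma>)"
          by (intro divide_nonneg_nonneg sum_nonneg exp_ge_zero)
        moreover have "0 \<le> (\<Sum>\<sigma>\<in>conf \<Lambda>. ?w \<eta> \<sigma>) * ?\<rho> \<eta>"
          by (intro mult_nonneg_nonneg sum_nonneg exp_ge_zero \<rho>)
        moreover have "ennreal ((\<Sum>\<sigma>\<in>conf \<Lambda>. ?w \<eta> \<sigma>) * ?\<rho> \<eta>) = (\<Sum>\<sigma>\<in>conf \<Lambda>. ennreal (?w \<eta> \<sigma> * ?\<rho> \<eta>))"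
          by (simp only: sum_w\<rho>)
        ultimately show ?thesis by (simp only: ennreal_mult)
      qed
      also have "\<dots> = (\<Sum>\<sigma>\<in>conf \<Lambda>. K (merge \<Lambda> ?\<Delta> (\<sigma>, \<eta>)) * ?c (merge \<Lambda> ?\<Delta> (\<sigma>, \<eta>)) * ennreal (?w \<eta> \<sigma> * ?\<rho> \<eta>))"
        unfolding K c sum_distrib_left by (simp only: ac_simps)
      finally show "(\<Sum>\<sigma>\<in>conf \<Lambda>. of_bool (restrict (merge \<Lambda> ?\<Delta> (\<sigma>, \<eta>)) \<Lambda> \<in> A) * ?c (merge \<Lambda> ?\<Delta> (\<sigma>, \<eta>)) * ennreal (?w \<eta> \<sigma> * ?\<rho> \<eta>)) =
          (\<Sum>\<sigma>\<in>conf \<Lambda>. K (merge \<Lambda> ?\<Delta> (\<sigma>, \<eta>)) * ?c (merge \<Lambda> ?\<Delta> (\<sigma>, \<eta>)) * ennreal (?w \<eta> \<sigma> * ?\<rho> \<eta>))" .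
    qed
    also have "\<dots> = (\<integral>\<^sup>+\<xi>. K (restrict \<xi> (V (Suc n))) * ?c (restrict \<xi> (V (Suc n))) \<partial>\<mu>)"
      by (rule local[symmetric])
    also have "\<dots> = emeasure \<nu>2 ?C"
      unfolding \<nu>2[OF C] by (rule nn_integral_cong) (simp only: C_ind K_ind)
    finally show "emeasure \<nu>1 ?C = emeasure \<nu>2 ?C" .
  next
    show "finite_measure \<nu>1"
    proof (rule finite_measureI)
      have "emeasure \<nu>1 (space \<nu>1) = (\<integral>\<^sup>+\<xi>. indicator E \<xi> * indicator (space \<nu>1) (restrict \<xi> (- \<Lambda>)) \<partial>\<mu>)"
        by (rule \<nu>1) (simp add: \<nu>1_def)
      also have "\<dots> \<le> (\<integral>\<^sup>+\<xi>. 1 \<partial>\<mu>)" by (intro nn_integral_mono) (auto simp: indicator_def)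
      also have "\<dots> = 1" by (simp add: \<mu>.emeasure_space_1)
      finally show "emeasure \<nu>1 (space \<nu>1) \<noteq> \<infinity>" by (auto simp: top_unique)
    qed
  qed (simp_all add: \<nu>1_def \<nu>2_def conf_space_def)
  have "emeasure \<mu> {\<xi> \<in> space Xi. restrict \<xi> \<Lambda> \<in> A \<and> restrict \<xi> (- \<Lambda>) \<in> B} = emeasure \<nu>1 B"
  proof -
    have *: "(\<lambda>\<xi>. restrict \<xi> (- \<Lambda>)) -` B \<inter> space \<mu> \<in> sets \<mu>" using measurable_sets[OF r B] .
    have "{\<xi> \<in> space Xi. restrict \<xi> \<Lambda> \<in> A \<and> restrict \<xi> (- \<Lambda>) \<in> B} = E \<inter> ((\<lambda>\<xi>. restrict \<xi> (- \<Lambda>)) -` B \<inter> space \<mu>)"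
      by (auto simp: E_def space space_Xi)
    then have "emeasure \<mu> {\<xi> \<in> space Xi. restrict \<xi> \<Lambda> \<in> A \<and> restrict \<xi> (- \<Lambda>) \<in> B} =
        (\<integral>\<^sup>+\<xi>. indicator (E \<inter> ((\<lambda>\<xi>. restrict \<xi> (- \<Lambda>)) -` B \<inter> space \<mu>)) \<xi> \<partial>\<mu>)"
      using E * by simp
    also have "\<dots> = emeasure \<nu>1 B"
      unfolding \<nu>1[OF B] by (intro nn_integral_cong) (auto simp: indicator_def)
    finally show ?thesis .
  qed
  also have "\<dots> = (\<integral>\<^sup>+\<eta>. K \<eta> * indicator B \<eta> \<partial>distr \<mu> (conf_space (- \<Lambda>)) (\<lambda>\<xi>. restrict \<xi> (- \<Lambda>)))"
    unfolding \<open>\<nu>1 = \<nu>2\<close> unfolding \<nu>2_def using K_meas B by (intro emeasure_density) (auto cong: measurable_cong_sets)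
  finally show "emeasure \<mu> {\<xi> \<in> space Xi. restrict \<xi> \<Lambda> \<in> A \<and> restrict \<xi> (- \<Lambda>) \<in> B} =
      (\<integral>\<^sup>+\<eta>\<in>B. emeasure (gibbs_kernel J \<beta> \<Lambda> \<eta>) A \<partial>distr \<mu> (conf_space (- \<Lambda>)) (\<lambda>\<xi>. restrict \<xi> (- \<Lambda>)))"
    unfolding K_def .
qed

end

section \<open>Gibbs measures lie between the extremal ones\<close>

lemma gibbs_measure_emeasure_cyl:
  assumes "gibbs_measure J \<beta> \<mu>" "finite \<Lambda>" "\<sigma> \<in> conf \<Lambda>"
  shows "emeasure \<mu> (cyl \<Lambda> \<sigma>) = (\<integral>\<^sup>+\<xi>. emeasure (gibbs_kernel J \<beta> \<Lambda> \<xi>) {\<sigma>} \<partial>\<mu>)"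
proof -
  have \<mu>: "prob_on_Xi \<mu>" using assms by (simp add: gibbs_measure_def)
  let ?r = "\<lambda>\<xi>. restrict \<xi> (- \<Lambda>)"
  have r: "?r \<in> \<mu> \<rightarrow>\<^sub>M conf_space (- \<Lambda>)"
    using measurable_restrict_conf[of "- \<Lambda>" UNIV] prob_on_Xi_sets[OF \<mu>] by (simp cong: measurable_cong_sets)
  obtain n where n: "\<Lambda> \<subseteq> V n" using assms(2) by (rule finite_subset_V)
  let ?K = "\<lambda>\<eta>. emeasure (gibbs_kernel J \<beta> \<Lambda> \<eta>) {\<sigma>}"
  have K_cong: "?K (restrict \<eta> \<Delta>) = ?K \<eta>" if "V (Suc n) - \<Lambda> \<subseteq> \<Delta>" for \<eta> \<Delta>
    using that by (intro arg_cong2[of _ _ _ _ emeasure] gibbs_kernel_cong[OF n]) auto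
  have "(\<lambda>\<eta>. ?K (restrict \<eta> (V (Suc n) - \<Lambda>))) \<in> borel_measurable (conf_space (- \<Lambda>))"
    by (rule measurable_local[where f = ?K]) auto
  then have K_meas: "?K \<in> borel_measurable (conf_space (- \<Lambda>))" by (simp only: K_cong order_refl)
  have "emeasure \<mu> (cyl \<Lambda> \<sigma>) =
      emeasure \<mu> {\<xi> \<in> space Xi. restrict \<xi> \<Lambda> \<in> {\<sigma>} \<and> ?r \<xi> \<in> space (conf_space (- \<Lambda>))}"
    by (intro arg_cong2[of _ _ _ _ emeasure]) (auto simp: cyl_def space_conf_space)
  also have "\<dots> = (\<integral>\<^sup>+\<eta>\<in>space (conf_space (- \<Lambda>)). ?K \<eta> \<partial>distr \<mu> (conf_space (- \<Lambda>)) ?r)"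
  proof -
    have "{\<sigma>} \<in> sets (conf_space \<Lambda>)" using assms by (simp add: sets_conf_space)
    then show ?thesis using assms(1,2) unfolding gibbs_measure_def by blast
  qed
  also have "\<dots> = (\<integral>\<^sup>+\<eta>. ?K \<eta> \<partial>distr \<mu> (conf_space (- \<Lambda>)) ?r)"
    by (intro nn_integral_cong) simp
  also have "\<dots> = (\<integral>\<^sup>+\<xi>. ?K (?r \<xi>) \<partial>\<mu>)"
    using K_meas by (subst nn_integral_distr[OF r]) simp_all
  also have "\<dots> = (\<integral>\<^sup>+\<xi>. ?K \<xi> \<partial>\<mu>)"
    by (intro nn_integral_cong K_cong) auto
  finally show ?thesis .
qed

context ferromagnet
begin

text \<open>Fixing the spins on \<open>W (Suc n)\<close> and collapsing that layer leaves exactly the edges between \<open>W n\<close> and \<open>W (Suc n)\<close>.\<close>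

lemma gibbs_kernel_V:
  assumes \<xi>: "\<xi> \<in> conf UNIV" and \<sigma>: "\<sigma> \<in> conf (V n)"
  shows "emeasure (gibbs_kernel J \<beta> (V n) \<xi>) {\<sigma>} = ennreal (law n (collapse (pinned \<xi>)) \<sigma>)"
proof -
  have "exp (\<beta> * J * (\<Sum>y\<in>touching (V n). merge (V n) (- V n) (\<tau>, \<xi>) (tl y) * merge (V n) (- V n) (\<tau>, \<xi>) y)) =
      weight n (collapse (pinned \<xi>)) \<tau>" for \<tau>
  proof -
    let ?\<zeta> = "merge (V n) (- V n) (\<tau>, \<xi>)"
    have "(\<Sum>y\<in>touching (V n). ?\<zeta> (tl y) * ?\<zeta> y) =
        (\<Sum>y\<in>V n - {[]}. \<tau> (tl y) * \<tau> y) + (\<Sum>y\<in>W (Suc n). \<tau> (tl y) * \<xi> y)"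
      unfolding touching_V
    proof (rule bond_sum_Suc)
      show "?\<zeta> x = \<xi> x" if "x \<in> W (Suc n)" for x using that by (simp add: merge_def V_eq W_eq)
    qed (simp add: merge_def)
    then have "\<beta> * J * (\<Sum>y\<in>touching (V n). ?\<zeta> (tl y) * ?\<zeta> y) =
        - \<beta> * Ham J n \<tau> + (\<Sum>y\<in>W (Suc n). \<beta> * J * (\<tau> (tl y) * \<xi> y))"
      unfolding Ham_eq by (simp add: algebra_simps sum_distrib_left)
    then have "exp (\<beta> * J * (\<Sum>y\<in>touching (V n). ?\<zeta> (tl y) * ?\<zeta> y)) =
        exp (- \<beta> * Ham J n \<tau>) * (\<Prod>y\<in>W (Suc n). exp (\<beta> * J * (\<tau> (tl y) * \<xi> y)))"
      by (simp only: exp_add exp_sum[OF finite_W])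
    also have "(\<Prod>y\<in>W (Suc n). exp (\<beta> * J * (\<tau> (tl y) * \<xi> y))) = (\<Prod>x\<in>W n. collapse (pinned \<xi>) x (\<tau> x))"
      by (simp add: prod_W_Suc collapse_pinned[OF \<xi>])
    finally show ?thesis by (simp add: weight_def)
  qed
  then show ?thesis
    using \<sigma> by (subst emeasure_gibbs_kernel) (simp_all add: law_def)
qed

text \<open>The DLR equation for \<open>V n\<close>, integrated: \<open>\<mu>\<close> is a mixture of finite-volume laws.\<close>

lemma gibbs_measure_local_average:
  fixes F :: "config \<Rightarrow> real" and n :: nat
  assumes gibbs: "gibbs_measure J \<beta> \<mu>"
  defines "A \<equiv> \<lambda>\<xi>. \<Sum>\<sigma>\<in>conf (V n). F \<sigma> * law n (collapse (pinned \<xi>)) \<sigma>"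
  shows "integrable \<mu> A" and "(\<integral>\<xi>. F (restrict \<xi> (V n)) \<partial>\<mu>) = (\<integral>\<xi>. A \<xi> \<partial>\<mu>)"
proof -
  have \<mu>: "prob_on_Xi \<mu>" using gibbs by (simp add: gibbs_measure_def)
  interpret \<mu>: prob_space \<mu> using \<mu> by (simp add: prob_on_Xi_def)
  note sets = prob_on_Xi_sets[OF \<mu>] and space = prob_on_Xi_space[OF \<mu>]
  have le1: "law n (collapse (pinned \<xi>)) \<sigma> \<le> 1" and ge0: "0 \<le> law n (collapse (pinned \<xi>)) \<sigma>"
    if "\<xi> \<in> conf UNIV" "\<sigma> \<in> conf (V n)" for \<xi> \<sigma>
  proof -
    have message: "message (collapse (pinned \<xi>))" using that by (intro message_collapse message_pinned)
    show "0 \<le> law n (collapse (pinned \<xi>)) \<sigma>" using message that by (intro law_nonneg)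
    have "law n (collapse (pinned \<xi>)) \<sigma> \<le> (\<Sum>\<sigma>\<in>conf (V n). law n (collapse (pinned \<xi>)) \<sigma>)"
      using that message by (intro member_le_sum law_nonneg) auto
    then show "law n (collapse (pinned \<xi>)) \<sigma> \<le> 1" using sum_law[OF message] by simp
  qed
  have int: "integrable \<mu> (\<lambda>\<xi>. law n (collapse (pinned \<xi>)) \<sigma>)" if \<sigma>: "\<sigma> \<in> conf (V n)" for \<sigma>
  proof (rule \<mu>.integrable_const_bound[of _ 1])
    \<comment> \<open>Only the spins on \<open>W (Suc n)\<close> enter, so the law is a local function of the outer configuration.\<close>
    have *: "collapse (pinned (ext (Suc n) xi_plus (restrict \<xi> (V (Suc n))))) x s = collapse (pinned \<xi>) x s"
      if "x \<in> W n" "\<xi> \<in> conf UNIV" for x s \<xi>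
    proof -
      have "ext (Suc n) xi_plus (restrict \<xi> (V (Suc n))) \<in> conf UNIV"
        using that by (intro ext_in_conf) (auto simp: conf_UNIV_iff)
      then show ?thesis using that
        by (simp add: collapse_pinned) (simp add: ext_def merge_def V_eq W_eq)
    qed
    have weight: "weight n (collapse (pinned (ext (Suc n) xi_plus (restrict \<xi> (V (Suc n)))))) \<tau> = weight n (collapse (pinned \<xi>)) \<tau>"
      if "\<xi> \<in> conf UNIV" for \<xi> \<tau>
      unfolding weight_def using * that by simp
    have "(\<lambda>\<xi>. law n (collapse (pinned (ext (Suc n) xi_plus (restrict \<xi> (V (Suc n)))))) \<sigma>) \<in> borel_measurable Xi"
      by (rule measurable_local[where f = "\<lambda>\<tau>. law n (collapse (pinned (ext (Suc n) xi_plus \<tau>))) \<sigma>"]) auto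
    also have "?this \<longleftrightarrow> (\<lambda>\<xi>. law n (collapse (pinned \<xi>)) \<sigma>) \<in> borel_measurable Xi"
      by (rule measurable_cong) (simp add: law_def weight space_Xi)
    finally show "(\<lambda>\<xi>. law n (collapse (pinned \<xi>)) \<sigma>) \<in> borel_measurable \<mu>" using sets by (simp cong: measurable_cong_sets)
    show "AE \<xi> in \<mu>. norm (law n (collapse (pinned \<xi>)) \<sigma>) \<le> 1"
      using le1 ge0 \<sigma> by (intro AE_I2) (simp add: space)
  qed
  show "integrable \<mu> A" unfolding A_def using int by (intro Bochner_Integration.integrable_sum integrable_mult_right) auto
  have cyl: "measure \<mu> (cyl (V n) \<sigma>) = (\<integral>\<xi>. law n (collapse (pinned \<xi>)) \<sigma> \<partial>\<mu>)" if \<sigma>: "\<sigma> \<in> conf (V n)" for \<sigma>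
  proof -
    have "emeasure \<mu> (cyl (V n) \<sigma>) = (\<integral>\<^sup>+\<xi>. ennreal (law n (collapse (pinned \<xi>)) \<sigma>) \<partial>\<mu>)"
      unfolding gibbs_measure_emeasure_cyl[OF gibbs finite_V \<sigma>]
      using \<sigma> by (intro nn_integral_cong gibbs_kernel_V) (simp_all add: space)
    also have "\<dots> = ennreal (\<integral>\<xi>. law n (collapse (pinned \<xi>)) \<sigma> \<partial>\<mu>)"
      using int[OF \<sigma>] ge0 \<sigma> by (intro nn_integral_eq_integral) (auto simp: space)
    finally have "emeasure \<mu> (cyl (V n) \<sigma>) = ennreal (\<integral>\<xi>. law n (collapse (pinned \<xi>)) \<sigma> \<partial>\<mu>)" .
    moreover have "0 \<le> (\<integral>\<xi>. law n (collapse (pinned \<xi>)) \<sigma> \<partial>\<mu>)"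
      using ge0 \<sigma> by (intro Bochner_Integration.integral_nonneg) (simp add: space)
    ultimately show ?thesis by (simp add: measure_def)
  qed
  show "(\<integral>\<xi>. F (restrict \<xi> (V n)) \<partial>\<mu>) = (\<integral>\<xi>. A \<xi> \<partial>\<mu>)"
    unfolding A_def using int
    by (subst Bochner_Integration.integral_sum) (auto simp: integral_local[OF \<mu> finite_V] cyl intro!: integrable_mult_right)
qed

text \<open>Use the DLR equation in the larger volume \<open>V (m + k)\<close>. Whatever the outer configuration, its pinned message lies
between the two extremal ones, and \<open>collapse\<close> preserves this order down to \<open>V m\<close>.\<close>

lemma gibbs_measure_between:
  assumes gibbs: "gibbs_measure J \<beta> \<mu>" and F: "mono_on (conf (V m)) F"
  shows "(\<integral>\<xi>. F (restrict \<xi> (V m)) \<partial>\<mu>) \<le> (\<Sum>\<sigma>\<in>conf (V m). F \<sigma> * law m ((collapse ^^ Suc k) (pinned xi_plus)) \<sigma>)"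
    and "(\<Sum>\<sigma>\<in>conf (V m). F \<sigma> * law m ((collapse ^^ Suc k) (pinned xi_minus)) \<sigma>) \<le> (\<integral>\<xi>. F (restrict \<xi> (V m)) \<partial>\<mu>)"
proof -
  have \<mu>: "prob_on_Xi \<mu>" using gibbs by (simp add: gibbs_measure_def)
  interpret \<mu>: prob_space \<mu> using \<mu> by (simp add: prob_on_Xi_def)
  note space = prob_on_Xi_space[OF \<mu>]
  let ?n = "m + k"
  let ?F = "\<lambda>\<sigma>. F (restrict \<sigma> (V m))"
  let ?A = "\<lambda>\<xi>. \<Sum>\<sigma>\<in>conf (V ?n). ?F \<sigma> * law ?n (collapse (pinned \<xi>)) \<sigma>"
  have "restrict (restrict \<xi> (V ?n)) (V m) = restrict \<xi> (V m)" for \<xi> :: config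
    using V_mono[of m ?n] by (auto simp: restrict_def fun_eq_iff)
  then have eq: "(\<integral>\<xi>. F (restrict \<xi> (V m)) \<partial>\<mu>) = (\<integral>\<xi>. ?A \<xi> \<partial>\<mu>)"
    using gibbs_measure_local_average(2)[OF gibbs, where n = ?n and F = ?F] by simp
  note int = gibbs_measure_local_average(1)[OF gibbs, where n = ?n and F = ?F]
  have A: "?A \<xi> = (\<Sum>\<sigma>\<in>conf (V m). F \<sigma> * law m ((collapse ^^ Suc k) (pinned \<xi>)) \<sigma>)" for \<xi>
    unfolding funpow_Suc_right o_apply by (rule sum_law_marginal)
  have plus: "xi_plus \<in> conf UNIV" and minus: "xi_minus \<in> conf UNIV" by (simp_all add: conf_UNIV_iff)
  have "?A \<xi> \<le> (\<Sum>\<sigma>\<in>conf (V m). F \<sigma> * law m ((collapse ^^ Suc k) (pinned xi_plus)) \<sigma>)" if "\<xi> \<in> space \<mu>" for \<xi>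
    unfolding A using that plus F unfolding space
    by (intro average_mono message_collapse_funpow message_pinned lr_le_collapse_funpow lr_le_pinned_plus)
  then have "(\<integral>\<xi>. ?A \<xi> \<partial>\<mu>) \<le> (\<integral>\<xi>. (\<Sum>\<sigma>\<in>conf (V m). F \<sigma> * law m ((collapse ^^ Suc k) (pinned xi_plus)) \<sigma>) \<partial>\<mu>)"
    by (intro integral_mono int) auto
  then show "(\<integral>\<xi>. F (restrict \<xi> (V m)) \<partial>\<mu>) \<le> (\<Sum>\<sigma>\<in>conf (V m). F \<sigma> * law m ((collapse ^^ Suc k) (pinned xi_plus)) \<sigma>)"
    unfolding eq by (simp only: lebesgue_integral_const \<mu>.prob_space scaleR_one)
  have "(\<Sum>\<sigma>\<in>conf (V m). F \<sigma> * law m ((collapse ^^ Suc k) (pinned xi_minus)) \<sigma>) \<le> ?A \<xi>" if "\<xi> \<in> space \<mu>" for \<xi>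
    unfolding A using that minus F unfolding space
    by (intro average_mono message_collapse_funpow message_pinned lr_le_collapse_funpow lr_le_pinned_minus)
  then have "(\<integral>\<xi>. (\<Sum>\<sigma>\<in>conf (V m). F \<sigma> * law m ((collapse ^^ Suc k) (pinned xi_minus)) \<sigma>) \<partial>\<mu>) \<le> (\<integral>\<xi>. ?A \<xi> \<partial>\<mu>)"
    by (intro integral_mono int) auto
  then show "(\<Sum>\<sigma>\<in>conf (V m). F \<sigma> * law m ((collapse ^^ Suc k) (pinned xi_minus)) \<sigma>) \<le> (\<integral>\<xi>. F (restrict \<xi> (V m)) \<partial>\<mu>)"
    unfolding eq by (simp only: lebesgue_integral_const \<mu>.prob_space scaleR_one)
qed

end

section \<open>Invariance under tree automorphisms\<close>

text \<open>The root is the only vertex with exactly two neighbours.\<close>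

lemma tree_automorphism_root:
  assumes "tree_automorphism \<phi>" shows "\<phi> [] = []"
proof (rule ccontr)
  assume ne: "\<phi> [] \<noteq> []"
  have \<phi>: "bij \<phi>" "\<And>x y. adj (\<phi> x) (\<phi> y) \<longleftrightarrow> adj x y" using assms by (auto simp: tree_automorphism_def)
  have "{y. adj (\<phi> []) y} = \<phi> ` {y. adj [] y}"
  proof (intro set_eqI iffI)
    fix y assume "y \<in> {y. adj (\<phi> []) y}"
    moreover obtain z where "y = \<phi> z" using bij_pointE[OF \<phi>(1)] by metis
    ultimately show "y \<in> \<phi> ` {y. adj [] y}" using \<phi>(2) by auto
  qed (use \<phi>(2) in auto)
  then have "card {y. adj (\<phi> []) y} = card {y. adj [] y}"
    using bij_is_inj[OF \<phi>(1)] by (simp add: card_image inj_on_subset)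
  then show False using card_neighbours_root card_neighbours[of "\<phi> []"] ne by (simp add: root_def)
qed

text \<open>A neighbour of \<open>\<phi> x\<close> is a child or the parent, and by induction the parent of \<open>\<phi> x\<close> is already the image of
the parent of \<open>x\<close>.\<close>

lemma tree_automorphism_child:
  assumes "tree_automorphism \<phi>" shows "\<exists>c. \<phi> (b # x) = c # \<phi> x"
proof (induction x arbitrary: b)
  case Nil
  have "adj (\<phi> []) (\<phi> [b])" using assms by (simp add: tree_automorphism_def adj_def)
  then show ?case by (auto simp: adj_def tree_automorphism_root[OF assms])
next
  case (Cons a x)
  have "adj (\<phi> (a # x)) (\<phi> (b # a # x))" using assms by (simp add: tree_automorphism_def adj_def)
  moreover have "\<phi> (a # x) \<noteq> c # \<phi> (b # a # x)" for c
  proof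
    assume c: "\<phi> (a # x) = c # \<phi> (b # a # x)"
    moreover obtain c' where "\<phi> (a # x) = c' # \<phi> x" using Cons.IH by blast
    ultimately have "\<phi> (b # a # x) = \<phi> x" by simp
    moreover have "inj \<phi>" using assms by (simp add: tree_automorphism_def bij_is_inj)
    ultimately have "b # a # x = x" by (simp add: inj_eq)
    then show False by (auto dest: arg_cong[of _ _ length])
  qed
  ultimately show ?case by (auto simp: adj_def)
qed

lemma tree_automorphism_length:
  assumes "tree_automorphism \<phi>" shows "length (\<phi> x) = length x"
  using tree_automorphism_child[OF assms]
  by (induction x) (auto simp: tree_automorphism_root[OF assms], metis length_Cons)

lemma tree_automorphism_tl:
  assumes "tree_automorphism \<phi>" shows "\<phi> (tl x) = tl (\<phi> x)"
  using tree_automorphism_child[OF assms] by (cases x) (auto simp: tree_automorphism_root[OF assms], metis list.sel(3))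

lemma tree_automorphism_bij_betw:
  assumes "tree_automorphism \<phi>" shows "bij_betw \<phi> {x. P (length x)} {x. P (length x)}"
proof -
  have \<phi>: "bij \<phi>" using assms by (simp add: tree_automorphism_def)
  show ?thesis
  proof (rule bij_betw_imageI)
    show "inj_on \<phi> {x. P (length x)}" using \<phi> bij_is_inj inj_on_subset by blast
    show "\<phi> ` {x. P (length x)} = {x. P (length x)}"
    proof (intro set_eqI iffI)
      fix y :: vertex assume "y \<in> {x. P (length x)}"
      moreover obtain x where "y = \<phi> x" using bij_pointE[OF \<phi>] by metis
      ultimately show "y \<in> \<phi> ` {x. P (length x)}" by (simp add: tree_automorphism_length[OF assms])
    qed (auto simp: tree_automorphism_length[OF assms])
  qed
qed

lemma Ham_automorphism:
  assumes "tree_automorphism \<phi>" shows "Ham J n (\<lambda>x. \<sigma> (\<phi> x)) = Ham J n \<sigma>"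
proof -
  have "bij_betw \<phi> (V n - {[]}) (V n - {[]})"
    using tree_automorphism_bij_betw[OF assms, of "\<lambda>k. k \<le> n \<and> k \<noteq> 0"] by (simp add: V_eq set_diff_eq)
  from sum.reindex_bij_betw[OF this, of "\<lambda>y. \<sigma> (tl y) * \<sigma> y"]
  show ?thesis by (simp add: Ham_eq tree_automorphism_tl[OF assms])
qed

text \<open>An automorphism preserves the distance from the root, so it preserves the energy in every \<open>V n\<close> and, since \<open>h\<close>
is radial, also the boundary terms.\<close>

lemma period3_invariant_of_mu_h:
  assumes \<mu>: "prob_on_Xi \<mu>" and radial: "\<And>x y. length x = length y \<Longrightarrow> h x = h y"
    and marg: "\<And>n \<sigma>. \<sigma> \<in> conf (V n) \<Longrightarrow> measure \<mu> (cyl (V n) \<sigma>) = mu_h J \<beta> h n \<sigma>"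
  shows "period3_invariant \<mu>"
  unfolding period3_invariant_def
proof (intro allI impI, elim conjE)
  fix \<phi> assume \<phi>: "tree_automorphism \<phi>"
  interpret \<mu>: prob_space \<mu> using \<mu> by (simp add: prob_on_Xi_def)
  note sets = prob_on_Xi_sets[OF \<mu>] and space = prob_on_Xi_space[OF \<mu>]
  note len = tree_automorphism_length[OF \<phi>]
  have bij: "bij \<phi>" using \<phi> by (simp add: tree_automorphism_def)
  define \<psi> where "\<psi> = the_inv \<phi>"
  have \<phi>\<psi>: "\<phi> (\<psi> x) = x" and \<psi>\<phi>: "\<psi> (\<phi> x) = x" for x
    using bij by (simp_all add: \<psi>_def f_the_inv_into_f_bij_betw[OF bij] the_inv_f_f bij_is_inj)
  have len': "length (\<psi> x) = length x" for x using len[of "\<psi> x"] by (simp add: \<phi>\<psi>)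
  have SS: "S (\<phi> x) = S x" "S (\<psi> x) = S x" for x by (rule S_cong, simp add: len len')+
  have meas: "(\<lambda>\<xi>. \<xi> \<circ> \<phi>) \<in> \<mu> \<rightarrow>\<^sub>M Xi"
  proof -
    have "(\<lambda>\<xi>. \<xi> \<circ> \<phi>) \<in> Xi \<rightarrow>\<^sub>M Xi"
      unfolding conf_space_def
    proof (rule measurable_PiM_single')
      show "(\<lambda>\<xi>. (\<xi> \<circ> \<phi>) x) \<in> PiM UNIV (\<lambda>x. count_space (S x)) \<rightarrow>\<^sub>M count_space (S x)" for x
        using measurable_component_singleton[of "\<phi> x" UNIV "\<lambda>x. count_space (S x)"] by (simp add: SS)
    qed (auto simp: space_PiM PiE_iff, metis SS(1))
    then show ?thesis using sets by (simp cong: measurable_cong_sets)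
  qed
  show "distr \<mu> Xi (\<lambda>\<xi>. \<xi> \<circ> \<phi>) = \<mu>"
  proof (rule prob_on_Xi_eqI)
    show "prob_on_Xi (distr \<mu> Xi (\<lambda>\<xi>. \<xi> \<circ> \<phi>))"
      using \<mu>.prob_space_distr[OF meas] by (simp add: prob_on_Xi_def)
    fix n \<sigma> assume \<sigma>: "\<sigma> \<in> conf (V n)"
    define \<tau> where "\<tau> = restrict (\<lambda>x. \<sigma> (\<psi> x)) (V n)"
    have \<tau>: "\<tau> \<in> conf (V n)"
      using \<sigma> len' by (auto simp: \<tau>_def conf_def PiE_iff V_eq) (metis SS(2))
    have "(\<lambda>\<xi>. \<xi> \<circ> \<phi>) -` cyl (V n) \<sigma> \<inter> space \<mu> = cyl (V n) \<tau>"
    proof (intro set_eqI)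
      fix \<xi>
      have "(\<forall>x\<in>V n. \<xi> (\<phi> x) = \<sigma> x) \<longleftrightarrow> (\<forall>x\<in>V n. \<xi> x = \<sigma> (\<psi> x))"
      proof (intro iffI ballI)
        fix x assume "\<forall>x\<in>V n. \<xi> (\<phi> x) = \<sigma> x" "x \<in> V n"
        then have "\<xi> (\<phi> (\<psi> x)) = \<sigma> (\<psi> x)" by (simp add: V_eq len')
        then show "\<xi> x = \<sigma> (\<psi> x)" by (simp only: \<phi>\<psi>)
      next
        fix x assume "\<forall>x\<in>V n. \<xi> x = \<sigma> (\<psi> x)" "x \<in> V n"
        then have "\<xi> (\<phi> x) = \<sigma> (\<psi> (\<phi> x))" by (simp add: V_eq len)
        then show "\<xi> (\<phi> x) = \<sigma> x" by (simp only: \<psi>\<phi>)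
      qed
      moreover have "(\<forall>x. \<xi> (\<phi> x) \<in> S x) \<longleftrightarrow> (\<forall>x. \<xi> x \<in> S x)"
        using \<phi>\<psi> SS by metis
      ultimately show "\<xi> \<in> (\<lambda>\<xi>. \<xi> \<circ> \<phi>) -` cyl (V n) \<sigma> \<inter> space \<mu> \<longleftrightarrow> \<xi> \<in> cyl (V n) \<tau>"
        using \<sigma> by (auto simp: cyl_def space space_Xi conf_UNIV_iff \<tau>_def conf_def PiE_iff
            extensional_def restrict_def fun_eq_iff)
    qed
    then have "measure (distr \<mu> Xi (\<lambda>\<xi>. \<xi> \<circ> \<phi>)) (cyl (V n) \<sigma>) = mu_h J \<beta> h n \<tau>"
      using \<sigma> by (simp add: measure_distr[OF meas sets_cyl] marg[OF \<tau>])
    also have "\<dots> = mu_h J \<beta> h n \<sigma>"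
    proof -
      have "Ham J n \<sigma> = Ham J n (\<lambda>x. \<tau> (\<phi> x))"
        using len by (intro Ham_cong) (simp add: \<tau>_def V_eq \<psi>\<phi>)
      also have "\<dots> = Ham J n \<tau>" by (rule Ham_automorphism[OF \<phi>])
      finally have H: "Ham J n \<tau> = Ham J n \<sigma>" by simp
      have "bij_betw \<phi> (W n) (W n)"
        using tree_automorphism_bij_betw[OF \<phi>, of "\<lambda>k. k = n"] by (simp add: W_eq)
      from sum.reindex_bij_betw[OF this, of "\<lambda>x. h x (\<tau> x)"]
      have "(\<Sum>x\<in>W n. h x (\<tau> x)) = (\<Sum>x\<in>W n. h (\<phi> x) (\<tau> (\<phi> x)))" by simp
      also have "\<dots> = (\<Sum>x\<in>W n. h x (\<sigma> x))"
        using len radial[OF len] by (intro sum.cong) (auto simp: \<tau>_def V_eq W_eq \<psi>\<phi>)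
      finally show ?thesis using H by (simp add: mu_h_def mu_h_weight_def)
    qed
    finally show "measure (distr \<mu> Xi (\<lambda>\<xi>. \<xi> \<circ> \<phi>)) (cyl (V n) \<sigma>) = measure \<mu> (cyl (V n) \<sigma>)"
      using marg[OF \<sigma>] by simp
  qed (rule \<mu>)
qed

section \<open>The extremal measures\<close>

context ferromagnet
begin

theorem extremal_measure:
  assumes \<zeta>: "\<zeta> = xi_minus \<or> \<zeta> = xi_plus"
  obtains \<mu> where "prob_on_Xi \<mu>" "weak_limit (bc_measure J \<beta> \<zeta>) \<mu>" "gibbs_measure J \<beta> \<mu>"
    "splitting_gibbs_measure J \<beta> \<mu>" "period3_invariant \<mu>"
    "\<And>m \<sigma>. \<sigma> \<in> conf (V m) \<Longrightarrow> (\<lambda>k. law m ((collapse ^^ k) (pinned \<zeta>)) \<sigma>) \<longlonglongrightarrow> measure \<mu> (cyl (V m) \<sigma>)"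
proof -
  obtain h where h: "\<And>x y. length x = length y \<Longrightarrow> h x = h y" "compatible J \<beta> h"
    "\<And>m \<sigma>. \<sigma> \<in> conf (V m) \<Longrightarrow> (\<lambda>k. law m ((collapse ^^ k) (pinned \<zeta>)) \<sigma>) \<longlonglongrightarrow> mu_h J \<beta> h m \<sigma>"
    using extremal_limit[OF \<zeta>] by blast
  have \<zeta>': "\<zeta> \<in> conf UNIV" using \<zeta> by (auto simp: conf_UNIV_iff)
  have message: "message (\<lambda>x s. exp (h x s))" by (auto simp: message_def intro: xi_plus_in_S)
  obtain \<mu> where \<mu>: "prob_on_Xi \<mu>" and marg: "\<And>n \<sigma>. \<sigma> \<in> conf (V n) \<Longrightarrow> measure \<mu> (cyl (V n) \<sigma>) = mu_h J \<beta> h n \<sigma>"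
  proof (rule kolmogorov_extension_V[of "mu_h J \<beta> h"])
    show "0 \<le> mu_h J \<beta> h n \<sigma>" if "\<sigma> \<in> conf (V n)" for n \<sigma>
      unfolding mu_h_eq_law using message that by (rule law_nonneg)
    show "(\<Sum>\<sigma>\<in>conf (V n). mu_h J \<beta> h n \<sigma>) = 1" for n
      unfolding mu_h_eq_law using message by (rule sum_law)
    show "(\<Sum>\<omega>\<in>conf (W (Suc n)). mu_h J \<beta> h (Suc n) (merge (V n) (W (Suc n)) (\<sigma>, \<omega>))) = mu_h J \<beta> h n \<sigma>"
      if "\<sigma> \<in> conf (V n)" for n \<sigma>
      using h(2) that unfolding compatible_def by (auto dest!: spec[of _ "Suc n"])
  qed blast
  show thesis
  proof (rule that[OF \<mu>])
    show "weak_limit (bc_measure J \<beta> \<zeta>) \<mu>"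
      using h(3) by (intro weak_limit_bc_measure \<zeta>' \<mu>) (simp add: marg)
    show "gibbs_measure J \<beta> \<mu>" using \<mu> marg by (rule gibbs_measure_of_mu_h)
    show "splitting_gibbs_measure J \<beta> \<mu>"
      unfolding splitting_gibbs_measure_def using \<mu> h(2) marg unfolding cyl_def by blast
    show "period3_invariant \<mu>" using \<mu> h(1) marg by (rule period3_invariant_of_mu_h)
    show "(\<lambda>k. law m ((collapse ^^ k) (pinned \<zeta>)) \<sigma>) \<longlonglongrightarrow> measure \<mu> (cyl (V m) \<sigma>)" if "\<sigma> \<in> conf (V m)" for m \<sigma>
      using h(3)[OF that] marg[OF that] by simp
  qed
qed

text \<open>Let the volume grow in the finite-volume bounds; the limit has expectations with respect to \<open>\<nu>\<close>.\<close>

theorem gibbs_measure_extremal_bounds: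
  assumes gibbs: "gibbs_measure J \<beta> \<mu>" and \<nu>: "prob_on_Xi \<nu>"
  shows "(\<And>m \<sigma>. \<sigma> \<in> conf (V m) \<Longrightarrow> (\<lambda>k. law m ((collapse ^^ k) (pinned xi_plus)) \<sigma>) \<longlonglongrightarrow> measure \<nu> (cyl (V m) \<sigma>)) \<Longrightarrow> \<mu> \<preceq>\<^sub>s \<nu>"
    and "(\<And>m \<sigma>. \<sigma> \<in> conf (V m) \<Longrightarrow> (\<lambda>k. law m ((collapse ^^ k) (pinned xi_minus)) \<sigma>) \<longlonglongrightarrow> measure \<nu> (cyl (V m) \<sigma>)) \<Longrightarrow> \<nu> \<preceq>\<^sub>s \<mu>"
proof -
  have \<mu>: "prob_on_Xi \<mu>" using gibbs by (simp add: gibbs_measure_def)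
  have lim: "(\<lambda>k. \<Sum>\<sigma>\<in>conf (V m). F \<sigma> * law m ((collapse ^^ Suc k) (pinned \<zeta>)) \<sigma>) \<longlonglongrightarrow> (\<integral>\<xi>. F (restrict \<xi> (V m)) \<partial>\<nu>)"
    if "\<And>m \<sigma>. \<sigma> \<in> conf (V m) \<Longrightarrow> (\<lambda>k. law m ((collapse ^^ k) (pinned \<zeta>)) \<sigma>) \<longlonglongrightarrow> measure \<nu> (cyl (V m) \<sigma>)"
    for F :: "config \<Rightarrow> real" and m \<zeta>
    unfolding integral_local[OF \<nu> finite_V]
    by (rule LIMSEQ_Suc[where f = "\<lambda>k. \<Sum>\<sigma>\<in>conf (V m). F \<sigma> * law m ((collapse ^^ k) (pinned \<zeta>)) \<sigma>"])
       (intro tendsto_sum tendsto_mult tendsto_const that)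
  show "\<mu> \<preceq>\<^sub>s \<nu>" if conv: "\<And>m \<sigma>. \<sigma> \<in> conf (V m) \<Longrightarrow> (\<lambda>k. law m ((collapse ^^ k) (pinned xi_plus)) \<sigma>) \<longlonglongrightarrow> measure \<nu> (cyl (V m) \<sigma>)"
  proof (rule local_le_imp_stoch_le[OF \<mu> \<nu>], unfold local_le_def, intro allI impI)
    fix m and F :: "config \<Rightarrow> real" assume F: "mono_on (conf (V m)) F"
    show "(\<integral>\<xi>. F (restrict \<xi> (V m)) \<partial>\<mu>) \<le> (\<integral>\<xi>. F (restrict \<xi> (V m)) \<partial>\<nu>)"
      by (intro LIMSEQ_le_const[OF lim[OF conv]] exI[of _ 0] allI impI gibbs_measure_between(1)[OF gibbs F])
  qed
  show "\<nu> \<preceq>\<^sub>s \<mu>" if conv: "\<And>m \<sigma>. \<sigma> \<in> conf (V m) \<Longrightarrow> (\<lambda>k. law m ((collapse ^^ k) (pinned xi_minus)) \<sigma>) \<longlonglongrightarrow> measure \<nu> (cyl (V m) \<sigma>)"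
  proof (rule local_le_imp_stoch_le[OF \<nu> \<mu>], unfold local_le_def, intro allI impI)
    fix m and F :: "config \<Rightarrow> real" assume F: "mono_on (conf (V m)) F"
    show "(\<integral>\<xi>. F (restrict \<xi> (V m)) \<partial>\<nu>) \<le> (\<integral>\<xi>. F (restrict \<xi> (V m)) \<partial>\<mu>)"
      by (intro LIMSEQ_le_const2[OF lim[OF conv]] exI[of _ 0] allI impI gibbs_measure_between(2)[OF gibbs F])
  qed
qed

end

theorem proposition12:
  fixes J \<beta> :: real
  assumes "J > 0" and "\<beta> > 0"
  shows "\<exists>\<mu>m \<mu>p.
      (weak_limit (bc_measure J \<beta> xi_minus) \<mu>m \<and> weak_limit (bc_measure J \<beta> xi_plus) \<mu>p \<and>
       gibbs_measure J \<beta> \<mu>m \<and> gibbs_measure J \<beta> \<mu>p) \<and>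
      (splitting_gibbs_measure J \<beta> \<mu>m \<and> splitting_gibbs_measure J \<beta> \<mu>p \<and>
       period3_invariant \<mu>m \<and> period3_invariant \<mu>p) \<and>
      (\<forall>\<mu>. gibbs_measure J \<beta> \<mu> \<longrightarrow> \<mu>m \<preceq>\<^sub>s \<mu> \<and> \<mu> \<preceq>\<^sub>s \<mu>p) \<and>
      (\<forall>\<mu>. gibbs_measure J \<beta> \<mu> \<and> \<mu> \<preceq>\<^sub>s \<mu>m \<longrightarrow> \<mu> = \<mu>m) \<and>
      (\<forall>\<mu>. gibbs_measure J \<beta> \<mu> \<and> \<mu>p \<preceq>\<^sub>s \<mu> \<longrightarrow> \<mu> = \<mu>p)"
proof -
  interpret ferromagnet J \<beta> using assms by unfold_locales
  obtain \<mu>m where m: "prob_on_Xi \<mu>m" "weak_limit (bc_measure J \<beta> xi_minus) \<mu>m" "gibbs_measure J \<beta> \<mu>m"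
    "splitting_gibbs_measure J \<beta> \<mu>m" "period3_invariant \<mu>m"
    "\<And>m \<sigma>. \<sigma> \<in> conf (V m) \<Longrightarrow> (\<lambda>k. law m ((collapse ^^ k) (pinned xi_minus)) \<sigma>) \<longlonglongrightarrow> measure \<mu>m (cyl (V m) \<sigma>)"
    by (rule extremal_measure[of xi_minus]) auto
  obtain \<mu>p where p: "prob_on_Xi \<mu>p" "weak_limit (bc_measure J \<beta> xi_plus) \<mu>p" "gibbs_measure J \<beta> \<mu>p"
    "splitting_gibbs_measure J \<beta> \<mu>p" "period3_invariant \<mu>p"
    "\<And>m \<sigma>. \<sigma> \<in> conf (V m) \<Longrightarrow> (\<lambda>k. law m ((collapse ^^ k) (pinned xi_plus)) \<sigma>) \<longlonglongrightarrow> measure \<mu>p (cyl (V m) \<sigma>)"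
    by (rule extremal_measure[of xi_plus]) auto
  have lower: "\<mu>m \<preceq>\<^sub>s \<mu>" if "gibbs_measure J \<beta> \<mu>" for \<mu>
    using that m(1,6) by (rule gibbs_measure_extremal_bounds(2))
  have upper: "\<mu> \<preceq>\<^sub>s \<mu>p" if "gibbs_measure J \<beta> \<mu>" for \<mu>
    using that p(1,6) by (rule gibbs_measure_extremal_bounds(1))
  have prob: "prob_on_Xi \<mu>" if "gibbs_measure J \<beta> \<mu>" for \<mu>
    using that by (simp add: gibbs_measure_def)
  have minimal: "\<mu> = \<mu>m" if "gibbs_measure J \<beta> \<mu>" "\<mu> \<preceq>\<^sub>s \<mu>m" for \<mu>
    using that lower prob m(1) by (intro stoch_le_antisym)
  have maximal: "\<mu> = \<mu>p" if "gibbs_measure J \<beta> \<mu>" "\<mu>p \<preceq>\<^sub>s \<mu>" for \<mu>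
    using that upper prob p(1) by (intro stoch_le_antisym)
  show ?thesis
    using m(2-5) p(2-5) lower upper minimal maximal by blast
qed

end
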